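(* Let $X_1,\ldots,X_N$ be i.i.d. real random variables with law $P$, let $2\le j\le m\le N$ be integers, and let $h_m:\mathbb R^m\to\mathbb R$ be a permutation-symmetric, centered, square-integrable, non-degenerate kernel (see context). Let $$V_{N,j}=\frac{\binom mj^{1/2}}{\binom Nj^{1/2}}\sum_{J\in\mathcal A_N^{(j)}}h_m^{(j)}\left(\frac{X_i}{\sqrt m},\,i\in J\right),$$ $$f_j(x_1,\ldots,x_j)=\mathbb E\,h_m\left(\frac{x_1}{\sqrt m},\ldots,\frac{x_j}{\sqrt m},\frac{X_{j+1}}{\sqrt m},\ldots,\frac{X_m}{\sqrt m}\right),$$ and $\nu_k=\left(\mathbb E|X_1-\mathbb EX_1|^k\right)^{1/k}$. (A) If the kernel $h_m$ is uniformly bounded, then there exists an absolute constant $c>0$ such that $$\mathbb P(|V_{N,j}|\ge t)\le\exp\left(-\min\left(\frac1c\left(\frac{t^2}{\mathrm{Var}(h_m)}\right)^{\frac1j},\ \frac{\left(\frac{t}{\|h_m\|_\infty}\sqrt{\frac Nj}\right)^{\frac{2}{j+1}}}{c\,(m/j)^{\frac{j}{j+1}}}\right)\right)$$ whenever $$\min\left(\frac1c\left(\frac{t^2}{\mathrm{Var}(h_m)}\right)^{\frac1j},\ \frac{\left(\frac{t}{\|h_m\|_\infty}\sqrt{\frac Nj}\right)^{\frac{2}{j+1}}}{c\,(m/j)^{\frac{j}{j+1}}}\right)\ge2.$$ (B) Alternatively, suppose that (i) $\left\|\partial_{x_1}\cdots\partial_{x_j}f_j\right\|_\infty\le\left(\frac{C_1(P)}{m}\right)^{j/2}j^{\gamma_1j}$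 for some $\gamma_1\ge\frac12$; (ii) $\nu_k\le k^{\gamma_2}M$ for all integers $k\ge2$ and some $\gamma_2\ge0$, $M>0$. Then there exist constants $c_1(P),c_2(P)>0$ that depend on $\gamma_1$ and $\gamma_2$ only such that (writing $c_1=c_1(P)$, $c_2=c_2(P)$) $$\mathbb P(|V_{N,j}|\ge t)\le\exp\left(-\min\left(\frac1{c_1}\left(\frac{t^2}{\mathrm{Var}(h_m)}\right)^{\frac1j},\ \left(\frac{t\sqrt{N/j}}{\left(c_2Mj^{\gamma_1-1/2}\right)^j}\right)^{\frac{2}{1+j(2\gamma_2+1)}}\right)\right)$$ whenever $$\min\left(\frac1{c_1}\left(\frac{t^2}{\mathrm{Var}(h_m)}\right)^{\frac1j},\ \left(\frac{t\sqrt{N/j}}{\left(c_2Mj^{\gamma_1-1/2}\right)^j}\right)^{\frac{2}{1+j(2\gamma_2+1)}}\right)\ge\max\left(2,\frac{\log(N/j)}{\gamma_2j}\right).$$ Moreover, whenever $\gamma_2=0$, corresponding to the case of almost surely bounded $X_1$, the inequality in (B) is valid for all $t>0$.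
   Context: $\mathcal A_N^{(j)}=\{J\subseteq\{1,\ldots,N\}:|J|=j\}$. $C_1(P)$ denotes a positive constant that may depend on the law $P$ of $X_1$, and $P_m$ denotes the law of $X_1/\sqrt m$. The kernel $h_m:\mathbb R^m\to\mathbb R$ is invariant under permutations of its arguments, satisfies $\mathbb E h_m\left(\frac{X_1}{\sqrt m},\ldots,\frac{X_m}{\sqrt m}\right)=0$ and $\mathbb E h_m^2\left(\frac{X_1}{\sqrt m},\ldots,\frac{X_m}{\sqrt m}\right)<\infty$, and $\mathrm{Var}(h_m)$ denotes $\mathrm{Var}\left(h_m\left(\frac{X_1}{\sqrt m},\ldots,\frac{X_m}{\sqrt m}\right)\right)$. For $1\le j\le m$, the $j$-th Hoeffding projection is $$h_m^{(j)}(y_1,\ldots,y_j)=(\delta_{y_1}-P_m)\times\cdots\times(\delta_{y_j}-P_m)\times P_m^{m-j}\,h_m,$$ where $Qf=\int f\,dQ$ for a signed measure $Q$; explicitly, $h_m^{(j)}(y_1,\ldots,y_j)=\sum_{I\subseteq\{1,\ldots,j\}}(-1)^{j-|I|}\,\mathbb E\,h_m(z_1,\ldots,z_m)$ with $z_i=y_i$ for $i\in I$ and $z_i=X_i/\sqrt m$ for $i\notin I$. Non-degenerate means $\mathbb P\left(h_m^{(1)}(X_1/\sqrt m)\ne0\right)>0$. For $g:\mathbb R^d\to\mathbb R$, $\|g\|_\infty=\mathrm{ess\,sup}\{|g(y)|:\,y\in\mathbb R^d\}$.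
   Formalization: For γ₂=0 the inequality is stated only when the minimum is at least 2, not for all t>0 (false for random signs, m=N=j=2, h=2y₁y₂+y₁+y₂, t≤1); the sample space is taken to be a space of real sequences, the general case following by passing to the joint law. *)

theory Defs
  imports "HOL-Probability.Probability" "HOL-Combinatorics.Permutations"
begin

text \<open>
  Points of \<open>\<real>\<^sup>d\<close> are functions \<open>nat \<Rightarrow> real\<close> with index set \<open>{1..d}\<close> and the value \<open>undefined\<close>
  outside, i.e. elements of \<open>space (Pi\<^sub>M {1..d} (\<lambda>_. borel))\<close>.
\<close>

definition iid_sample :: "'w measure \<Rightarrow> (nat \<Rightarrow> 'w \<Rightarrow> real) \<Rightarrow> nat \<Rightarrow> bool" where
  "iid_sample M X N \<longleftrightarrow>
     prob_space M \<and>
     prob_space.indep_vars M (\<lambda>_. borel) X {1..N} \<and>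
     (\<forall>i\<in>{1..N}. distr M borel (X i) = distr M borel (X 1))"

definition scaled_law :: "'w measure \<Rightarrow> (nat \<Rightarrow> 'w \<Rightarrow> real) \<Rightarrow> nat \<Rightarrow> real measure" where
  "scaled_law M X m = distr M borel (\<lambda>\<omega>. X 1 \<omega> / sqrt (real m))"

definition kernel_rv ::
    "(nat \<Rightarrow> 'w \<Rightarrow> real) \<Rightarrow> nat \<Rightarrow> ((nat \<Rightarrow> real) \<Rightarrow> real) \<Rightarrow> 'w \<Rightarrow> real" where
  "kernel_rv X m h \<omega> = h (\<lambda>i\<in>{1..m}. X i \<omega> / sqrt (real m))"

text \<open>\<open>\<E> h(z\<^sub>1, \<dots>, z\<^sub>m)\<close> with \<open>z\<^sub>i = y\<^sub>i\<close> for \<open>i \<in> I\<close> and \<open>z\<^sub>i = X\<^sub>i / \<surd>m\<close> for \<open>i \<notin> I\<close>.\<close>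

definition kernel_mean ::
    "'w measure \<Rightarrow> (nat \<Rightarrow> 'w \<Rightarrow> real) \<Rightarrow> nat \<Rightarrow> ((nat \<Rightarrow> real) \<Rightarrow> real) \<Rightarrow> nat set \<Rightarrow> (nat \<Rightarrow> real) \<Rightarrow> real"
  where
  "kernel_mean M X m h I y =
     (\<integral>\<omega>. h (\<lambda>i\<in>{1..m}. if i \<in> I then y i else X i \<omega> / sqrt (real m)) \<partial>M)"

definition hoeffding_proj ::
    "'w measure \<Rightarrow> (nat \<Rightarrow> 'w \<Rightarrow> real) \<Rightarrow> nat \<Rightarrow> ((nat \<Rightarrow> real) \<Rightarrow> real) \<Rightarrow> nat \<Rightarrow> (nat \<Rightarrow> real) \<Rightarrow> real"
  where
  "hoeffding_proj M X m h j y =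
     (\<Sum>I\<in>Pow {1..j}. (- 1) ^ (j - card I) * kernel_mean M X m h I y)"

text \<open>The function \<open>f\<^sub>j\<close>, in the unscaled variables \<open>x\<^sub>1, \<dots>, x\<^sub>j\<close>.\<close>

definition partial_mean ::
    "'w measure \<Rightarrow> (nat \<Rightarrow> 'w \<Rightarrow> real) \<Rightarrow> nat \<Rightarrow> ((nat \<Rightarrow> real) \<Rightarrow> real) \<Rightarrow> nat \<Rightarrow> (nat \<Rightarrow> real) \<Rightarrow> real"
  where
  "partial_mean M X m h j x = kernel_mean M X m h {1..j} (\<lambda>i. x i / sqrt (real m))"

text \<open>
  \<open>h\<^sub>m\<^sup>(\<^sup>j\<^sup>)(X\<^sub>i / \<surd>m, i \<in> J)\<close> is evaluated along the increasing enumeration of \<open>J\<close>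
  (for a symmetric kernel the order is immaterial).
\<close>

definition V_stat ::
    "'w measure \<Rightarrow> (nat \<Rightarrow> 'w \<Rightarrow> real) \<Rightarrow> nat \<Rightarrow> ((nat \<Rightarrow> real) \<Rightarrow> real) \<Rightarrow> nat \<Rightarrow> nat \<Rightarrow> 'w \<Rightarrow> real"
  where
  "V_stat M X m h N j \<omega> =
     sqrt (real (m choose j)) / sqrt (real (N choose j)) *
     (\<Sum>J\<in>{J. J \<subseteq> {1..N} \<and> card J = j}.
        hoeffding_proj M X m h j (\<lambda>k. X (sorted_list_of_set J ! (k - 1)) \<omega> / sqrt (real m)))"

definition symmetric_kernel :: "nat \<Rightarrow> ((nat \<Rightarrow> real) \<Rightarrow> real) \<Rightarrow> bool" where
  "symmetric_kernel m h \<longleftrightarrow>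
     (\<forall>\<pi> y. \<pi> permutes {1..m} \<longrightarrow> y \<in> extensional {1..m} \<longrightarrow> h (y \<circ> \<pi>) = h y)"

definition nondegenerate_kernel ::
    "'w measure \<Rightarrow> (nat \<Rightarrow> 'w \<Rightarrow> real) \<Rightarrow> nat \<Rightarrow> ((nat \<Rightarrow> real) \<Rightarrow> real) \<Rightarrow> bool" where
  "nondegenerate_kernel M X m h \<longleftrightarrow>
     measure M {\<omega>\<in>space M. hoeffding_proj M X m h 1 (\<lambda>_. X 1 \<omega> / sqrt (real m)) \<noteq> 0} > 0"

definition admissible_kernel ::
    "'w measure \<Rightarrow> (nat \<Rightarrow> 'w \<Rightarrow> real) \<Rightarrow> nat \<Rightarrow> ((nat \<Rightarrow> real) \<Rightarrow> real) \<Rightarrow> bool" where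
  "admissible_kernel M X m h \<longleftrightarrow>
     h \<in> borel_measurable (Pi\<^sub>M {1..m} (\<lambda>_. borel)) \<and>
     symmetric_kernel m h \<and>
     integrable M (\<lambda>\<omega>. (kernel_rv X m h \<omega>)\<^sup>2) \<and>
     (\<integral>\<omega>. kernel_rv X m h \<omega> \<partial>M) = 0 \<and>
     nondegenerate_kernel M X m h"

definition bounded_kernel :: "nat \<Rightarrow> ((nat \<Rightarrow> real) \<Rightarrow> real) \<Rightarrow> bool" where
  "bounded_kernel m h \<longleftrightarrow> (\<exists>B. \<forall>y\<in>extensional {1..m}. \<bar>h y\<bar> \<le> B)"

text \<open>
  \<open>\<parallel>g\<parallel>\<^sub>\<infinity>\<close> with respect to a reference measure \<open>Q\<close>. For the kernel, \<open>Q\<close> is the law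
  \<open>P\<^sub>m\<^sup>m\<close> of its random argument: a Lebesgue essential supremum would ignore the values of the
  kernel on the support of a discrete \<open>P\<close>. For derivatives, \<open>Q\<close> is Lebesgue measure.
\<close>

definition ess_sup_norm :: "(nat \<Rightarrow> real) measure \<Rightarrow> ((nat \<Rightarrow> real) \<Rightarrow> real) \<Rightarrow> ereal" where
  "ess_sup_norm Q g = esssup Q (\<lambda>y. ereal \<bar>g y\<bar>)"

definition kernel_norm ::
    "'w measure \<Rightarrow> (nat \<Rightarrow> 'w \<Rightarrow> real) \<Rightarrow> nat \<Rightarrow> ((nat \<Rightarrow> real) \<Rightarrow> real) \<Rightarrow> real" where
  "kernel_norm M X m h = real_of_ereal (ess_sup_norm (Pi\<^sub>M {1..m} (\<lambda>_. scaled_law M X m)) h)"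

definition partial_deriv :: "nat \<Rightarrow> ((nat \<Rightarrow> real) \<Rightarrow> real) \<Rightarrow> (nat \<Rightarrow> real) \<Rightarrow> real" where
  "partial_deriv i f x = deriv (\<lambda>s. f (x(i := s))) (x i)"

text \<open>\<open>mixed_deriv j f = \<partial>\<^sub>1 (\<partial>\<^sub>2 (\<dots> (\<partial>\<^sub>j f)))\<close>, and the classical existence of all derivatives
  occurring in it, at every point.\<close>

fun mixed_deriv :: "nat \<Rightarrow> ((nat \<Rightarrow> real) \<Rightarrow> real) \<Rightarrow> (nat \<Rightarrow> real) \<Rightarrow> real" where
  "mixed_deriv 0 f = f"
| "mixed_deriv (Suc k) f = mixed_deriv k (partial_deriv (Suc k) f)"

fun mixed_deriv_exists :: "nat \<Rightarrow> ((nat \<Rightarrow> real) \<Rightarrow> real) \<Rightarrow> bool" where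
  "mixed_deriv_exists 0 f \<longleftrightarrow> True"
| "mixed_deriv_exists (Suc k) f \<longleftrightarrow>
     (\<forall>x. (\<lambda>s. f (x(Suc k := s))) differentiable (at (x (Suc k)))) \<and>
     mixed_deriv_exists k (partial_deriv (Suc k) f)"

definition central_moment_root :: "'w measure \<Rightarrow> ('w \<Rightarrow> real) \<Rightarrow> nat \<Rightarrow> real" where
  "central_moment_root M Y k = (\<integral>\<omega>. \<bar>Y \<omega> - (\<integral>\<omega>'. Y \<omega>' \<partial>M)\<bar> ^ k \<partial>M) powr (1 / real k)"

definition smoothness_condition ::
    "'w measure \<Rightarrow> (nat \<Rightarrow> 'w \<Rightarrow> real) \<Rightarrow> nat \<Rightarrow> ((nat \<Rightarrow> real) \<Rightarrow> real) \<Rightarrow> nat \<Rightarrow> real \<Rightarrow> real \<Rightarrow> bool"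
  where
  "smoothness_condition M X m h j C \<gamma> \<longleftrightarrow>
     mixed_deriv_exists j (partial_mean M X m h j) \<and>
     ess_sup_norm (Pi\<^sub>M {1..j} (\<lambda>_. lborel)) (mixed_deriv j (partial_mean M X m h j))
       \<le> ereal ((C / real m) powr (real j / 2) * real j powr (\<gamma> * real j))"

text \<open>Finiteness of the moments is explicit, since a non-integrable function has integral \<open>0\<close>.\<close>

definition moment_condition :: "'w measure \<Rightarrow> ('w \<Rightarrow> real) \<Rightarrow> real \<Rightarrow> real \<Rightarrow> bool" where
  "moment_condition M Y \<gamma> K \<longleftrightarrow>
     integrable M Y \<and>
     (\<forall>k\<ge>2. integrable M (\<lambda>\<omega>. \<bar>Y \<omega> - (\<integral>\<omega>'. Y \<omega>' \<partial>M)\<bar> ^ k) \<and>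
            central_moment_root M Y k \<le> real k powr \<gamma> * K)"

text \<open>
  No generality is lost by letting the sample space be of type \<open>nat \<Rightarrow> real\<close>, which is what allows
  constants that do not depend on the sample space: every sample is equivalent to the coordinate
  sample under its joint law, for all notions above.
\<close>

definition joint_law :: "'w measure \<Rightarrow> (nat \<Rightarrow> 'w \<Rightarrow> real) \<Rightarrow> nat \<Rightarrow> (nat \<Rightarrow> real) measure" where
  "joint_law M X N = distr M (Pi\<^sub>M {1..N} (\<lambda>_. borel)) (\<lambda>\<omega>. \<lambda>i\<in>{1..N}. X i \<omega>)"

abbreviation (input) coord :: "nat \<Rightarrow> (nat \<Rightarrow> real) \<Rightarrow> real" where
  "coord \<equiv> \<lambda>i x. x i"

context
  fixes M :: "'w measure" and X :: "nat \<Rightarrow> 'w \<Rightarrow> real" and N m :: nat and h :: "(nat \<Rightarrow> real) \<Rightarrow> real"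
  assumes iid: "iid_sample M X N" and mN: "1 \<le> m" "m \<le> N"
    and h_meas: "h \<in> borel_measurable (Pi\<^sub>M {1..m} (\<lambda>_. borel))"
begin

private lemma M_prob: "prob_space M"
  using iid by (simp add: iid_sample_def)

private lemma X_meas: "i \<in> {1..N} \<Longrightarrow> X i \<in> borel_measurable M"
  using iid M_prob by (auto simp: iid_sample_def prob_space.indep_vars_def)

private lemma sample_meas: "(\<lambda>\<omega>. \<lambda>i\<in>{1..N}. X i \<omega>) \<in> measurable M (Pi\<^sub>M {1..N} (\<lambda>_. borel))"
  by (intro measurable_restrict X_meas)

private lemma coord_meas:
  "i \<in> {1..N} \<Longrightarrow> coord i \<in> borel_measurable (Pi\<^sub>M {1..N} (\<lambda>_. borel))"
  by (rule measurable_component_singleton)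

private lemma one_N: "1 \<in> {1..N}"
  using mN by auto

private lemma kernel_arg_meas:
  "(\<lambda>x. h (\<lambda>i\<in>{1..m}. if i \<in> I then y i else x i / sqrt (real m)))
     \<in> borel_measurable (Pi\<^sub>M {1..N} (\<lambda>_. borel))"
proof (rule measurable_compose[OF _ h_meas], rule measurable_restrict)
  fix i assume "i \<in> {1..m}"
  then have [measurable]: "coord i \<in> borel_measurable (Pi\<^sub>M {1..N} (\<lambda>_. borel))"
    using mN by (intro coord_meas) auto
  show "(\<lambda>x. if i \<in> I then y i else x i / sqrt (real m))
          \<in> borel_measurable (Pi\<^sub>M {1..N} (\<lambda>_. borel))"
    by measurable
qed

private lemma kernel_rv_meas: "kernel_rv coord m h \<in> borel_measurable (Pi\<^sub>M {1..N} (\<lambda>_. borel))"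
  using kernel_arg_meas[of "{}" undefined] by (simp add: kernel_rv_def[abs_def] cong: restrict_cong)

private lemma kernel_rv_sample: "kernel_rv coord m h (\<lambda>i\<in>{1..N}. X i \<omega>) = kernel_rv X m h \<omega>"
  unfolding kernel_rv_def using mN by (intro arg_cong[where f=h] restrict_ext) auto

lemma law_joint_law: "i \<in> {1..N} \<Longrightarrow> distr (joint_law M X N) borel (coord i) = distr M borel (X i)"
  unfolding joint_law_def
  by (subst distr_distr[OF coord_meas sample_meas]) (auto simp: comp_def intro!: distr_cong)

lemma iid_joint_law: "iid_sample (joint_law M X N) coord N"
proof -
  interpret M: prob_space M by (rule M_prob)
  have "prob_space (joint_law M X N)"
    unfolding joint_law_def by (rule M.prob_space_distr[OF sample_meas])
  then interpret D: prob_space "joint_law M X N" .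
  have N0: "{1..N} \<noteq> {}" using one_N by blast
  have prod: "joint_law M X N = Pi\<^sub>M {1..N} (\<lambda>i. distr M borel (X i))"
    unfolding joint_law_def
    using iid M.indep_vars_iff_distr_eq_PiM'[OF N0, where X=X and M'="\<lambda>_. borel"] X_meas
    by (simp add: iid_sample_def)
  have cm: "coord i \<in> borel_measurable (joint_law M X N)" if "i \<in> {1..N}" for i
    using coord_meas[OF that] by (simp add: joint_law_def)
  have "distr (joint_law M X N) (Pi\<^sub>M {1..N} (\<lambda>_. borel)) (\<lambda>x. \<lambda>i\<in>{1..N}. coord i x) =
        distr (joint_law M X N) (joint_law M X N) (\<lambda>x. x)"
    by (rule distr_cong) (auto simp: joint_law_def space_PiM PiE_def extensional_restrict)
  also have "\<dots> = joint_law M X N" by (rule distr_id2) simp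
  also have "\<dots> = Pi\<^sub>M {1..N} (\<lambda>i. distr (joint_law M X N) borel (coord i))"
    by (subst prod, rule PiM_cong[OF refl]) (rule law_joint_law[symmetric])
  finally have "D.indep_vars (\<lambda>_. borel) coord {1..N}"
    by (rule iffD2[OF D.indep_vars_iff_distr_eq_PiM'[OF N0], rotated]) (rule cm)
  moreover have "distr (joint_law M X N) borel (coord i) = distr (joint_law M X N) borel (coord 1)"
    if "i \<in> {1..N}" for i
    unfolding law_joint_law[OF that] law_joint_law[OF one_N]
    using iid that unfolding iid_sample_def by blast
  ultimately show ?thesis
    unfolding iid_sample_def using D.prob_space_axioms by blast
qed

lemma kernel_mean_joint_law: "kernel_mean (joint_law M X N) coord m h = kernel_mean M X m h"
proof (intro ext)
  fix I y
  have "kernel_mean (joint_law M X N) coord m h I y =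
    (\<integral>\<omega>. h (\<lambda>i\<in>{1..m}. if i \<in> I then y i else (\<lambda>i\<in>{1..N}. X i \<omega>) i / sqrt (real m)) \<partial>M)"
    unfolding kernel_mean_def joint_law_def by (rule integral_distr[OF sample_meas kernel_arg_meas])
  also have "\<dots> = kernel_mean M X m h I y"
    unfolding kernel_mean_def using mN
    by (intro Bochner_Integration.integral_cong refl arg_cong[where f=h] restrict_ext) auto
  finally show "kernel_mean (joint_law M X N) coord m h I y = kernel_mean M X m h I y" .
qed

lemma hoeffding_proj_joint_law: "hoeffding_proj (joint_law M X N) coord m h = hoeffding_proj M X m h"
  by (intro ext) (simp add: hoeffding_proj_def kernel_mean_joint_law)

lemma variance_joint_law:
  "prob_space.variance (joint_law M X N) (kernel_rv coord m h) = prob_space.variance M (kernel_rv X m h)"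
proof -
  have 1: "(\<integral>x. kernel_rv coord m h x \<partial>joint_law M X N) = (\<integral>\<omega>. kernel_rv X m h \<omega> \<partial>M)"
    unfolding joint_law_def by (simp only: integral_distr[OF sample_meas kernel_rv_meas] kernel_rv_sample)
  have "(\<lambda>x. (kernel_rv coord m h x - a)\<^sup>2) \<in> borel_measurable (Pi\<^sub>M {1..N} (\<lambda>_. borel))" for a
    using kernel_rv_meas by measurable
  from integral_distr[OF sample_meas this] show ?thesis
    unfolding 1 unfolding joint_law_def by (simp only: kernel_rv_sample)
qed

lemma scaled_law_joint_law: "scaled_law (joint_law M X N) coord m = scaled_law M X m"
proof -
  have "(\<lambda>x. coord 1 x / sqrt (real m)) \<in> borel_measurable (Pi\<^sub>M {1..N} (\<lambda>_. borel))"
    using coord_meas[OF one_N] by measurable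
  from distr_distr[OF this sample_meas] show ?thesis
    using one_N unfolding scaled_law_def joint_law_def by (auto simp: comp_def intro!: distr_cong)
qed

lemma kernel_norm_joint_law: "kernel_norm (joint_law M X N) coord m h = kernel_norm M X m h"
  unfolding kernel_norm_def scaled_law_joint_law ..

lemma smoothness_joint_law:
  "smoothness_condition (joint_law M X N) coord m h = smoothness_condition M X m h"
  unfolding smoothness_condition_def[abs_def] partial_mean_def[abs_def] kernel_mean_joint_law ..

lemma moment_joint_law:
  "moment_condition (joint_law M X N) (coord 1) = moment_condition M (X 1)"
proof -
  have c: "coord 1 \<in> borel_measurable (Pi\<^sub>M {1..N} (\<lambda>_. borel))"
    by (rule coord_meas[OF one_N])
  then have ck: "(\<lambda>x. \<bar>x 1 - a\<bar> ^ k) \<in> borel_measurable (Pi\<^sub>M {1..N} (\<lambda>_. borel))" for a :: real and k :: nat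
    by measurable
  have r: "(\<lambda>i\<in>{1..N}. X i \<omega>) 1 = X 1 \<omega>" for \<omega>
    using one_N by (rule restrict_apply')
  show ?thesis
    unfolding moment_condition_def[abs_def] central_moment_root_def joint_law_def
      integral_distr[OF sample_meas c] integral_distr[OF sample_meas ck]
      integrable_distr_eq[OF sample_meas c] integrable_distr_eq[OF sample_meas ck] r ..
qed

private lemma hoeffding_proj_meas:
  assumes e: "\<And>k. k \<in> {1..j} \<Longrightarrow> e k \<in> {1..N}"
  shows "(\<lambda>x. hoeffding_proj M X m h j (\<lambda>k. coord (e k) x / sqrt (real m)))
           \<in> borel_measurable (Pi\<^sub>M {1..N} (\<lambda>_. borel))"
  unfolding hoeffding_proj_def
proof (intro borel_measurable_sum borel_measurable_times borel_measurable_const)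
  fix I assume I: "I \<in> Pow {1..j}"
  interpret prob_space M by (rule M_prob)
  let ?A = "Pi\<^sub>M {1..N} (\<lambda>_. borel) :: (nat \<Rightarrow> real) measure"
  have "(\<lambda>p. h (\<lambda>i\<in>{1..m}. if i \<in> I then fst p (e i) / sqrt (real m) else X i (snd p) / sqrt (real m)))
          \<in> borel_measurable (?A \<Otimes>\<^sub>M M)"
  proof (rule measurable_compose[OF _ h_meas], rule measurable_restrict)
    fix i assume i: "i \<in> {1..m}"
    then have [measurable]: "X i \<in> borel_measurable M"
      using mN by (intro X_meas) auto
    show "(\<lambda>p. if i \<in> I then fst p (e i) / sqrt (real m) else X i (snd p) / sqrt (real m))
            \<in> borel_measurable (?A \<Otimes>\<^sub>M M)"
    proof (cases "i \<in> I")
      case True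
      then have [measurable]: "coord (e i) \<in> borel_measurable ?A"
        using I by (intro coord_meas e) auto
      have "(\<lambda>p. coord (e i) (fst p) / sqrt (real m)) \<in> borel_measurable (?A \<Otimes>\<^sub>M M)"
        by measurable
      with True show ?thesis by simp
    next
      case False
      have "(\<lambda>p. X i (snd p) / sqrt (real m)) \<in> borel_measurable (?A \<Otimes>\<^sub>M M)"
        by measurable
      with False show ?thesis by simp
    qed
  qed
  then show "(\<lambda>x. kernel_mean M X m h I (\<lambda>k. coord (e k) x / sqrt (real m))) \<in> borel_measurable ?A"
    unfolding kernel_mean_def by (intro borel_measurable_lebesgue_integral) (simp add: case_prod_beta')
qed

lemma admissible_joint_law: "admissible_kernel (joint_law M X N) coord m h = admissible_kernel M X m h"
proof -
  let ?A = "Pi\<^sub>M {1..N} (\<lambda>_. borel) :: (nat \<Rightarrow> real) measure"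
  have sq: "(\<lambda>x. (kernel_rv coord m h x)\<^sup>2) \<in> borel_measurable ?A"
    using kernel_rv_meas by measurable
  have [measurable]: "(\<lambda>x. hoeffding_proj M X m h 1 (\<lambda>_. coord 1 x / sqrt (real m))) \<in> borel_measurable ?A"
    by (rule hoeffding_proj_meas[where e="\<lambda>_. 1", OF one_N])
  have S: "{x\<in>space ?A. hoeffding_proj M X m h 1 (\<lambda>_. coord 1 x / sqrt (real m)) \<noteq> 0} \<in> sets ?A"
    by measurable
  have r: "(\<lambda>i\<in>{1..N}. X i \<omega>) 1 = X 1 \<omega>" for \<omega>
    using one_N by (rule restrict_apply')
  have "measure (joint_law M X N)
          {x\<in>space ?A. hoeffding_proj M X m h 1 (\<lambda>_. coord 1 x / sqrt (real m)) \<noteq> 0} =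
        measure M {\<omega>\<in>space M. hoeffding_proj M X m h 1 (\<lambda>_. X 1 \<omega> / sqrt (real m)) \<noteq> 0}"
    unfolding joint_law_def measure_distr[OF sample_meas S]
    using measurable_space[OF sample_meas] r by (intro arg_cong[where f="measure M"]) auto
  then have nd: "nondegenerate_kernel (joint_law M X N) coord m h = nondegenerate_kernel M X m h"
    unfolding nondegenerate_kernel_def hoeffding_proj_joint_law by (simp add: joint_law_def)
  have eqs: "integrable (joint_law M X N) (\<lambda>x. (kernel_rv coord m h x)\<^sup>2) =
               integrable M (\<lambda>\<omega>. (kernel_rv X m h \<omega>)\<^sup>2)"
    "(\<integral>x. kernel_rv coord m h x \<partial>joint_law M X N) = (\<integral>\<omega>. kernel_rv X m h \<omega> \<partial>M)"
    unfolding joint_law_def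
    by (simp_all only: integrable_distr_eq[OF sample_meas sq]
          integral_distr[OF sample_meas kernel_rv_meas] kernel_rv_sample)
  show ?thesis
    unfolding admissible_kernel_def nd eqs ..
qed

lemma V_stat_joint_law:
  "measure (joint_law M X N) {x\<in>space (joint_law M X N). \<bar>V_stat (joint_law M X N) coord m h N j x\<bar> \<ge> t} =
   measure M {\<omega>\<in>space M. \<bar>V_stat M X m h N j \<omega>\<bar> \<ge> t}"
proof -
  let ?A = "Pi\<^sub>M {1..N} (\<lambda>_. borel) :: (nat \<Rightarrow> real) measure"
  have enum: "sorted_list_of_set J ! (k - 1) \<in> {1..N}"
    if "J \<subseteq> {1..N}" "card J = j" "k \<in> {1..j}" for J k
  proof -
    have "finite J" using that(1) by (rule finite_subset) simp
    then have "sorted_list_of_set J ! (k - 1) \<in> J"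
      using that nth_mem[of "k - 1" "sorted_list_of_set J"] by auto
    with that(1) show ?thesis by auto
  qed
  have [measurable]: "V_stat (joint_law M X N) coord m h N j \<in> borel_measurable ?A"
    unfolding V_stat_def[abs_def] hoeffding_proj_joint_law
    by (intro borel_measurable_times borel_measurable_const borel_measurable_sum hoeffding_proj_meas)
       (use enum in auto)
  have S: "{x\<in>space ?A. \<bar>V_stat (joint_law M X N) coord m h N j x\<bar> \<ge> t} \<in> sets ?A"
    by measurable
  have hp: "hoeffding_proj M X m h j y = hoeffding_proj M X m h j y'"
    if "\<And>k. k \<in> {1..j} \<Longrightarrow> y k = y' k" for y y'
    unfolding hoeffding_proj_def kernel_mean_def
    by (intro sum.cong refl arg_cong2[where f="(*)"] Bochner_Integration.integral_cong
          arg_cong[where f=h] restrict_ext) (use that in auto)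
  have V: "V_stat (joint_law M X N) coord m h N j (\<lambda>i\<in>{1..N}. X i \<omega>) = V_stat M X m h N j \<omega>" for \<omega>
    unfolding V_stat_def hoeffding_proj_joint_law
  proof (intro arg_cong2[where f="(*)"] refl sum.cong hp)
    fix J k assume "J \<in> {J. J \<subseteq> {1..N} \<and> card J = j}" "k \<in> {1..j}"
    then have "sorted_list_of_set J ! (k - 1) \<in> {1..N}"
      by (intro enum) auto
    then show "(\<lambda>i\<in>{1..N}. X i \<omega>) (sorted_list_of_set J ! (k - 1)) / sqrt (real m) =
               X (sorted_list_of_set J ! (k - 1)) \<omega> / sqrt (real m)"
      by simp
  qed
  have "measure (joint_law M X N) {x\<in>space ?A. \<bar>V_stat (joint_law M X N) coord m h N j x\<bar> \<ge> t} =
        measure M {\<omega>\<in>space M. \<bar>V_stat M X m h N j \<omega>\<bar> \<ge> t}"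
    unfolding measure_distr[OF sample_meas S, folded joint_law_def]
    using measurable_space[OF sample_meas] V by (intro arg_cong[where f="measure M"]) auto
  moreover have "space (joint_law M X N) = space ?A"
    by (simp add: joint_law_def)
  ultimately show ?thesis by simp
qed

end

text \<open>
  Two conventions of the concentration inequality.

  The constants \<open>c\<^sub>1, c\<^sub>2\<close> of the smooth case are quantified after \<open>C\<^sub>1, \<gamma>\<^sub>1, \<gamma>\<^sub>2\<close> and
  before everything else, so that they depend on the law \<open>P\<close> through \<open>C\<^sub>1 = C\<^sub>1(P)\<close> only. A
  dependence on \<open>C\<^sub>1\<close> is forced by the scaling \<open>h \<mapsto> \<lambda> h\<close>, \<open>t \<mapsto> \<lambda> t\<close>.

  For \<open>\<gamma>\<^sub>2 = 0\<close> the requirement involving \<open>ln (N / j) / (\<gamma>\<^sub>2 j)\<close> disappears, but the exponent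
  must still be at least \<open>2\<close>: for \<open>m = N = j = 2\<close>, independent random signs \<open>X\<^sub>1, X\<^sub>2\<close> and
  \<open>h(y\<^sub>1, y\<^sub>2) = 2 y\<^sub>1 y\<^sub>2 + y\<^sub>1 + y\<^sub>2\<close> one has \<open>\<bar>V\<bar> = \<bar>X\<^sub>1 X\<^sub>2\<bar> = 1\<close>, so that
  \<open>\<P>(\<bar>V\<bar> \<ge> t) \<le> exp (- r)\<close> fails for every \<open>t \<in> {0<..1}\<close> and every \<open>r > 0\<close>.
\<close>

end

theory Submission
  imports Defs
begin

text \<open>
  Write \<open>g\<close> for the \<open>j\<close>-th Hoeffding projection and \<open>F J\<close> for \<open>g\<close> evaluated at \<open>(X i, i \<in> J)\<close>.
  By degeneracy one can symmetrise \<open>\<Sum>J. F J\<close> coordinate by coordinate without decoupling, and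
  Bonami's inequality, applied conditionally on the sample, bounds the moment of order \<open>2 * p\<close> by
  \<open>(8 * p) ^ (j * p)\<close> times the moment of order \<open>p\<close> of the nonnegative U-statistic
  \<open>\<Sum>J. (F J)\<^sup>2\<close>. A Rosenthal inequality splits the latter into its mean, which Bessel's inequality
  bounds by the variance of the kernel, and a term of relative order \<open>j\<^sup>2 / N\<close> governed by the higher
  moments of \<open>g\<close>. Markov's inequality with \<open>p\<close> between \<open>r / 2\<close> and \<open>r\<close> gives the tail.

  For a smooth kernel, \<open>g y\<close> is the mean over an independent copy \<open>x\<close> of the sample of the increment
  of \<open>f\<^sub>j\<close> over the box with opposite corners \<open>x\<close> and \<open>y\<close>, which the bound on the mixed derivative
  controls by the product of the side lengths.
\<close>

section \<open>Hypercontractivity\<close>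

text \<open>The constant in (A) is absolute and stands outside the \<open>j\<close>-th root, so
  every step may lose at most a factor constant^j; the usual decoupling constants grow faster than
  that in \<open>j\<close>, hence the direct symmetrisation. The shape of the exponents can be read
  off from the powers of \<open>p\<close>: the mean part of the moment carries p^j, which inverts to
  the root of order \<open>j\<close>; the Rosenthal remainder carries one factor \<open>p\<close>
  more, hence the order j + 1, and growing moments of the sample contribute another p^(2
  \<open>\<gamma>\<^sub>2\<close> j).

  The delicate point is that Rosenthal supplies the small number j^2/N only to the power p - 1. For
  a bounded projection one factor of the square is kept as a variance and fills the gap. With moment
  bounds alone the missing power has to be paid for by an exponential in \<open>p\<close>, and this
  is what the lower bound log(N/j) / (\<open>\<gamma>\<^sub>2\<close> j) on the exponent allows. For
  \<open>\<gamma>\<^sub>2 = 0\<close> the sample is bounded and the first argument applies, so that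
  requirement disappears.

  Only moments of integer order occur, and the inequalities of Hoelder and Lyapunov are replaced by
  Young's inequality with integer exponents.\<close>

lemma Youngs_inequality_power:
  fixes x y :: real
  assumes "0 \<le> x" "0 \<le> y"
  shows "real (k + l) * (x ^ k * y ^ l) \<le> real k * x ^ (k + l) + real l * y ^ (k + l)"
proof (cases "k = 0 \<or> l = 0 \<or> x = 0 \<or> y = 0")
  case True
  then show ?thesis using assms by (auto simp: power_0_left)
next
  case False
  then have pos: "0 < x" "0 < y" "0 < k + l" using assms by auto
  have root: "(z ^ (k + l)) powr (real i / real (k + l)) = z ^ i" if "0 < z" for z :: real and i
    using that pos by (simp add: powr_realpow[symmetric] powr_powr del: of_nat_add)
  have "(x ^ (k + l)) powr (real k / real (k + l)) * (y ^ (k + l)) powr (real l / real (k + l))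
    \<le> real k / real (k + l) * x ^ (k + l) + real l / real (k + l) * y ^ (k + l)"
    using pos by (intro Youngs_inequality_0) (auto simp: add_divide_distrib[symmetric])
  then have "x ^ k * y ^ l \<le> real k / real (k + l) * x ^ (k + l) + real l / real (k + l) * y ^ (k + l)"
    using pos by (simp only: root)
  then have "real (k + l) * (x ^ k * y ^ l) \<le>
      real (k + l) * (real k / real (k + l) * x ^ (k + l) + real l / real (k + l) * y ^ (k + l))"
    by (intro mult_left_mono) auto
  also have "\<dots> = real k * x ^ (k + l) + real l * y ^ (k + l)"
    using pos by (simp add: distrib_left del: of_nat_add)
  finally show ?thesis .
qed

text \<open>The quotients of consecutive terms are compared: from \<open>k\<close> to
  \<open>k + 1\<close> the left side grows by (p-k)(2p-2k-1) / ((k+1)(2k+1)) and the right side by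
  (p-k)(2p-1) / (k+1). This is the numerical core of hypercontractivity and fixes the constant
  \<open>2 * p - 1\<close> there.\<close>

lemma binomial_double_le:
  assumes "k \<le> p"
  shows "real ((2 * p) choose (2 * k)) \<le> real (p choose k) * (2 * real p - 1) ^ k"
  using assms
proof (induction k)
  case (Suc k)
  have rec: "real (n choose Suc i) * (real i + 1) = real (n choose i) * (real n - real i)"
    if "i \<le> n" for n i :: nat
  proof -
    have "Suc i * (n choose Suc i) = (n choose i) * (n - i)"
      by (metis binomial_absorb_comp binomial_absorption mult.commute)
    then have "real (Suc i) * real (n choose Suc i) = real (n choose i) * real (n - i)"
      by (metis of_nat_mult)
    with that show ?thesis by (simp add: of_nat_diff algebra_simps)
  qed
  have p: "Suc k \<le> p" using Suc.prems .
  let ?a = "real ((2 * p) choose (2 * k))" and ?b = "real (p choose k)"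
  let ?a2 = "real ((2 * p) choose (2 * Suc k))" and ?b2 = "real (p choose Suc k)"
  have e1: "real ((2 * p) choose Suc (2 * k)) * (2 * real k + 1) = ?a * (2 * (real p - real k))"
    using rec[of "2 * k" "2 * p"] p by (simp add: algebra_simps)
  have e2: "?a2 * (2 * real k + 2) = real ((2 * p) choose Suc (2 * k)) * (2 * real p - 2 * real k - 1)"
    using rec[of "Suc (2 * k)" "2 * p"] p by (simp add: algebra_simps)
  have "?a2 * (2 * real k + 2) * (2 * real k + 1)
      = real ((2 * p) choose Suc (2 * k)) * (2 * real k + 1) * (2 * real p - 2 * real k - 1)"
    by (simp only: e2) (simp add: algebra_simps)
  also have "\<dots> = ?a * (2 * (real p - real k)) * (2 * real p - 2 * real k - 1)"
    by (simp only: e1)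
  finally have a2: "?a2 * (real k + 1) * (2 * real k + 1)
      = ?a * (real p - real k) * (2 * real p - 2 * real k - 1)"
    by (simp add: algebra_simps)
  have b2: "?b2 * (real k + 1) = ?b * (real p - real k)"
    using rec[of k p] p by simp
  have nn: "0 \<le> real p - real k" "0 \<le> 2 * real p - 2 * real k - 1" "0 \<le> 2 * real p - 1"
    using p by auto
  have "?a2 * (real k + 1) * 1 \<le> ?a2 * (real k + 1) * (2 * real k + 1)"
    by (intro mult_left_mono) auto
  also have "\<dots> = ?a * ((real p - real k) * (2 * real p - 2 * real k - 1))"
    using a2 by (simp add: algebra_simps)
  also have "\<dots> \<le> (?b * (2 * real p - 1) ^ k) * ((real p - real k) * (2 * real p - 1))"
    using Suc.IH p nn by (intro mult_mono) auto
  also have "\<dots> = ?b2 * (real k + 1) * (2 * real p - 1) ^ Suc k"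
    by (simp only: b2) (simp add: algebra_simps)
  finally have "(?a2) * (real k + 1) \<le> (?b2 * (2 * real p - 1) ^ Suc k) * (real k + 1)"
    by (simp add: algebra_simps)
  then show ?case by (rule mult_right_le_imp_le) simp
qed simp

lemma power_even_split:
  fixes a b :: real
  shows "((a + b) ^ (2 * p) + (a - b) ^ (2 * p)) / 2 =
    (\<Sum>k\<le>p. real ((2 * p) choose (2 * k)) * (b\<^sup>2) ^ k * (a\<^sup>2) ^ (p - k))"
proof -
  define g where "g k = real ((2 * p) choose k) * b ^ k * a ^ (2 * p - k)" for k
  have 1: "(a + b) ^ (2 * p) = (\<Sum>k\<le>2 * p. g k)"
    using binomial_ring[of b a "2 * p"] by (simp add: g_def add.commute mult.assoc)
  have 2: "(a - b) ^ (2 * p) = (\<Sum>k\<le>2 * p. (- 1) ^ k * g k)"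
    using binomial_ring[of "- b" a "2 * p"] by (simp add: g_def power_minus[of b] mult_ac)
  have "(a + b) ^ (2 * p) + (a - b) ^ (2 * p) = (\<Sum>k\<le>2 * p. (1 + (- 1) ^ k) * g k)"
    unfolding 1 2 by (simp add: sum.distrib distrib_right)
  also have "\<dots> = (\<Sum>k\<in>(\<lambda>k. 2 * k) ` {..p}. (1 + (- 1) ^ k) * g k)"
  proof (rule sum.mono_neutral_right)
    show "\<forall>i\<in>{..2 * p} - (\<lambda>k. 2 * k) ` {..p}. (1 + (- 1) ^ i) * g i = 0"
    proof
      fix i assume i: "i \<in> {..2 * p} - (\<lambda>k. 2 * k) ` {..p}"
      then have "odd i" by (auto elim!: evenE)
      then show "(1 + (- 1) ^ i) * g i = 0" by simp
    qed
  qed auto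
  also have "\<dots> = (\<Sum>k\<le>p. 2 * g (2 * k))"
    by (subst sum.reindex) (auto simp: inj_on_def)
  also have "\<dots> = 2 * (\<Sum>k\<le>p. real ((2 * p) choose (2 * k)) * (b\<^sup>2) ^ k * (a\<^sup>2) ^ (p - k))"
    by (simp add: sum_distrib_left g_def power_mult[symmetric] diff_mult_distrib2 mult.assoc)
  finally show ?thesis by simp
qed

text \<open>Hoelder's inequality with exponents p/k and p/l, given bounds \<open>\<alpha>\<close>
  and \<open>\<beta>\<close> for the two norms. Dividing by them reduces it to Young's inequality
  termwise; a vanishing bound forces a vanishing function and is treated separately.\<close>

lemma sum_power_product_le:
  fixes x y :: "'a \<Rightarrow> real"
  assumes "finite V" "k + l = p" "0 < p" and nn: "\<And>v. v \<in> V \<Longrightarrow> 0 \<le> x v \<and> 0 \<le> y v"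
    and ab: "0 \<le> \<alpha>" "0 \<le> \<beta>" and c: "0 \<le> c"
    and x: "(\<Sum>v\<in>V. x v ^ p) \<le> c * \<alpha> ^ p" and y: "(\<Sum>v\<in>V. y v ^ p) \<le> c * \<beta> ^ p"
  shows "(\<Sum>v\<in>V. x v ^ k * y v ^ l) \<le> c * (\<alpha> ^ k * \<beta> ^ l)"
proof -
  have vanish: "\<forall>v\<in>V. z v = 0" if "(\<Sum>v\<in>V. z v ^ p) \<le> 0" "\<And>v. v \<in> V \<Longrightarrow> 0 \<le> z v" for z :: "'a \<Rightarrow> real"
  proof -
    have "(\<Sum>v\<in>V. z v ^ p) = 0" using that by (intro antisym sum_nonneg) auto
    then show ?thesis using that assms(1) by (subst (asm) sum_nonneg_eq_0_iff) auto
  qed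
  consider "k = 0" | "l = 0" | "0 < k" "0 < l" "\<alpha> = 0 \<or> \<beta> = 0" | "0 < \<alpha>" "0 < \<beta>"
    using ab by fastforce
  then show ?thesis
  proof cases
    case 1 with y assms show ?thesis by simp
  next
    case 2 with x assms show ?thesis by simp
  next
    case 3
    have "(\<forall>v\<in>V. x v = 0) \<or> (\<forall>v\<in>V. y v = 0)"
      using 3(3)
    proof
      assume "\<alpha> = 0"
      then have "(\<Sum>v\<in>V. x v ^ p) \<le> 0" using x assms by (simp add: power_0_left)
      from vanish[OF this] nn show ?thesis by blast
    next
      assume "\<beta> = 0"
      then have "(\<Sum>v\<in>V. y v ^ p) \<le> 0" using y assms by (simp add: power_0_left)
      from vanish[OF this] nn show ?thesis by blast
    qed
    then have "(\<Sum>v\<in>V. x v ^ k * y v ^ l) = 0"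
      using 3(1,2) by (intro sum.neutral) (auto simp: power_0_left)
    then show ?thesis using ab c by simp
  next
    case 4
    have "real p * (\<Sum>v\<in>V. x v ^ k * y v ^ l)
        = (\<alpha> ^ k * \<beta> ^ l) * (\<Sum>v\<in>V. real (k + l) * ((x v / \<alpha>) ^ k * (y v / \<beta>) ^ l))"
      using 4 assms(2) by (simp add: sum_distrib_left power_divide mult_ac)
    also have "\<dots> \<le> (\<alpha> ^ k * \<beta> ^ l) *
        (\<Sum>v\<in>V. real k * (x v / \<alpha>) ^ (k + l) + real l * (y v / \<beta>) ^ (k + l))"
      using 4 nn by (intro mult_left_mono sum_mono Youngs_inequality_power) auto
    also have "\<dots> = (\<alpha> ^ k * \<beta> ^ l) *
        (real k * ((\<Sum>v\<in>V. x v ^ p) / \<alpha> ^ p) + real l * ((\<Sum>v\<in>V. y v ^ p) / \<beta> ^ p))"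
      using assms(2) by (simp add: sum.distrib sum_distrib_left sum_divide_distrib power_divide)
    also have "\<dots> \<le> (\<alpha> ^ k * \<beta> ^ l) * (real k * c + real l * c)"
      using 4 x y by (intro mult_left_mono add_mono) (auto simp: divide_le_eq)
    also have "\<dots> = real p * (c * (\<alpha> ^ k * \<beta> ^ l))"
      using assms(2) by (auto simp: algebra_simps)
    finally show ?thesis using assms(3) by simp
  qed
qed

lemma sum_Pow_insert:
  fixes f :: "'a set \<Rightarrow> 'b::comm_monoid_add"
  assumes "finite S" "i \<notin> S"
  shows "(\<Sum>T\<in>Pow (insert i S). f T) = (\<Sum>T\<in>Pow S. f T + f (insert i T))"
proof -
  have "(\<Sum>T\<in>Pow (insert i S). f T) = (\<Sum>T\<in>Pow S. f T) + (\<Sum>T\<in>insert i ` Pow S. f T)"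
    unfolding Pow_insert using assms by (intro sum.union_disjoint) auto
  also have "(\<Sum>T\<in>insert i ` Pow S. f T) = (\<Sum>T\<in>Pow S. f (insert i T))"
    using assms by (subst sum.reindex) (auto simp: inj_on_def)
  finally show ?thesis by (simp add: sum.distrib)
qed

text \<open>
  Bonami's hypercontractive inequality for even moments. The set \<open>U\<close> encodes the sign vector that
  is \<open>- 1\<close> exactly on \<open>U\<close>, so that \<open>(- 1) ^ card (T \<inter> U)\<close> is the Walsh function of \<open>T\<close>.
\<close>
lemma bonami_even:
  fixes a :: "'a set \<Rightarrow> real"
  assumes "finite S" "1 \<le> p"
  shows "(\<Sum>U\<in>Pow S. (\<Sum>T\<in>Pow S. a T * (- 1) ^ card (T \<inter> U)) ^ (2 * p))
    \<le> 2 ^ card S * (\<Sum>T\<in>Pow S. (2 * real p - 1) ^ card T * (a T)\<^sup>2) ^ p"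
  using assms(1)
proof (induction S arbitrary: a rule: finite_induct)
  case empty
  then show ?case by (simp add: power_mult)
next
  case (insert i S)
  let ?P = "2 * real p - 1"
  define f where "f b U = (\<Sum>T\<in>Pow S. b T * (- 1) ^ card (T \<inter> U))" for b :: "'a set \<Rightarrow> real" and U
  define q where "q b = (\<Sum>T\<in>Pow S. ?P ^ card T * (b T)\<^sup>2)" for b :: "'a set \<Rightarrow> real"
  let ?b = "\<lambda>T. a (insert i T)"
  have P: "0 \<le> ?P" using assms(2) by simp
  have q0: "0 \<le> q b" for b unfolding q_def using P by (intro sum_nonneg) auto
  have IH: "(\<Sum>U\<in>Pow S. ((f b U)\<^sup>2) ^ p) \<le> 2 ^ card S * q b ^ p" for b
    using insert.IH[of b] by (simp add: f_def q_def power_mult)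
  have f1: "(\<Sum>T\<in>Pow (insert i S). a T * (- 1) ^ card (T \<inter> U)) = f a U + f ?b U"
    if "U \<in> Pow S" for U
  proof -
    have e: "insert i T \<inter> U = T \<inter> U" for T using that insert.hyps by auto
    show ?thesis
      unfolding sum_Pow_insert[OF insert.hyps] e by (simp add: f_def sum.distrib)
  qed
  have f2: "(\<Sum>T\<in>Pow (insert i S). a T * (- 1) ^ card (T \<inter> insert i U)) = f a U - f ?b U"
    if "U \<in> Pow S" for U
  proof -
    have e: "T \<inter> insert i U = T \<inter> U" "card (insert i T \<inter> insert i U) = Suc (card (T \<inter> U))"
      if "T \<in> Pow S" for T
    proof -
      have "finite (T \<inter> U)" using that insert.hyps by (auto intro: finite_subset)
      moreover have "insert i T \<inter> insert i U = insert i (T \<inter> U)" by auto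
      ultimately show "card (insert i T \<inter> insert i U) = Suc (card (T \<inter> U))"
        using that \<open>U \<in> Pow S\<close> insert.hyps by (auto simp: card_insert_if)
    qed (use that insert.hyps in auto)
    show ?thesis
      unfolding sum_Pow_insert[OF insert.hyps] f_def sum_subtractf[symmetric]
      by (intro sum.cong refl, subst e(1), assumption, subst e(2), assumption) simp
  qed
  have "(\<Sum>U\<in>Pow (insert i S). (\<Sum>T\<in>Pow (insert i S). a T * (- 1) ^ card (T \<inter> U)) ^ (2 * p))
      = (\<Sum>U\<in>Pow S. (f a U + f ?b U) ^ (2 * p) + (f a U - f ?b U) ^ (2 * p))"
    unfolding sum_Pow_insert[OF insert.hyps, of "\<lambda>U. (\<Sum>T\<in>Pow (insert i S). a T * (- 1) ^ card (T \<inter> U)) ^ (2 * p)"]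
    by (intro sum.cong refl) (simp add: f1 f2)
  also have "\<dots> = 2 * (\<Sum>U\<in>Pow S. ((f a U + f ?b U) ^ (2 * p) + (f a U - f ?b U) ^ (2 * p)) / 2)"
    by (simp add: sum_divide_distrib[symmetric])
  also have "(\<Sum>U\<in>Pow S. ((f a U + f ?b U) ^ (2 * p) + (f a U - f ?b U) ^ (2 * p)) / 2)
      = (\<Sum>k\<le>p. real ((2 * p) choose (2 * k)) * (\<Sum>U\<in>Pow S. ((f ?b U)\<^sup>2) ^ k * ((f a U)\<^sup>2) ^ (p - k)))"
    unfolding power_even_split sum_distrib_left by (subst sum.swap) (simp add: mult.assoc)
  \<comment> \<open>The sums over \<open>U\<close> mix the halves \<open>a\<close> and
    \<open>?b\<close>. Hoelder separates them by the induction hypothesis for each half, and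
    \<open>binomial_double_le\<close> turns the coefficients into those of the binomial expansion of
    \<open>(?P * q ?b + q a) ^ p\<close>.\<close>
  also have "\<dots> \<le> (\<Sum>k\<le>p. (real (p choose k) * ?P ^ k) * (2 ^ card S * (q ?b ^ k * q a ^ (p - k))))"
    using insert.hyps IH q0 P assms(2)
    by (intro sum_mono mult_mono binomial_double_le sum_power_product_le) (auto intro!: sum_nonneg)
  also have "\<dots> = 2 ^ card S * (\<Sum>k\<le>p. real (p choose k) * (?P * q ?b) ^ k * q a ^ (p - k))"
    by (simp add: sum_distrib_left power_mult_distrib mult_ac)
  also have "\<dots> = 2 ^ card S * (?P * q ?b + q a) ^ p"
    by (simp add: binomial_ring)
  also have "?P * q ?b + q a = (\<Sum>T\<in>Pow (insert i S). ?P ^ card T * (a T)\<^sup>2)"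
  proof -
    have "card (insert i T) = Suc (card T)" if "T \<in> Pow S" for T
      using that insert.hyps by (subst card_insert_disjoint) (auto intro: finite_subset)
    then have "?P * q ?b = (\<Sum>T\<in>Pow S. ?P ^ card (insert i T) * (a (insert i T))\<^sup>2)"
      unfolding q_def sum_distrib_left by (intro sum.cong refl) simp
    then show ?thesis
      unfolding sum_Pow_insert[OF insert.hyps] sum.distrib by (simp add: q_def)
  qed
  finally show ?case using insert.hyps by (simp add: mult.assoc)
qed

text \<open>\<open>a + b\<close> is the midpoint of \<open>a\<close> and \<open>a + 2 * b\<close>,
  which leaves half of \<open>a ^ (2 * p)\<close>; the tangent at \<open>a\<close> bounds this power
  by its value at \<open>a - 2 * b\<close> plus a term linear in \<open>b\<close>. The step
  \<open>2 * b\<close> is the factor 2 per symmetrised coordinate, and degeneracy will remove the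
  linear term.\<close>

lemma convex_even_power_split:
  fixes a b :: real
  assumes "1 \<le> p"
  shows "(a + b) ^ (2 * p) \<le> ((a + 2 * b) ^ (2 * p) + (a - 2 * b) ^ (2 * p)) / 2
    + 2 * real p * (a ^ (2 * p - 1) * b)"
proof -
  have conv: "convex_on (UNIV :: real set) (\<lambda>x. x ^ (2 * p))"
    by (rule convex_power_even) simp
  have "((1 - 1/2) *\<^sub>R a + (1/2) *\<^sub>R (a + 2 * b)) ^ (2 * p)
      \<le> (1 - 1/2) * a ^ (2 * p) + (1/2) * (a + 2 * b) ^ (2 * p)"
    by (rule convex_onD[OF conv]) auto
  moreover have "(1 - 1/2) *\<^sub>R a + (1/2) *\<^sub>R (a + 2 * b) = a + b"
    by (simp add: algebra_simps)
  moreover have "(2 * real p * a ^ (2 * p - 1)) * ((a - 2 * b) - a) \<le> (a - 2 * b) ^ (2 * p) - a ^ (2 * p)"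
  proof (rule convex_on_imp_above_tangent[OF conv])
    show "((\<lambda>x. x ^ (2 * p)) has_field_derivative 2 * real p * a ^ (2 * p - 1)) (at a within UNIV)"
      using DERIV_power[of "\<lambda>x. x" 1 a UNIV "2 * p"] by (simp add: mult_ac)
  qed auto
  ultimately have "(a + b) ^ (2 * p) \<le> 1/2 * a ^ (2 * p) + 1/2 * (a + 2 * b) ^ (2 * p)"
    "(2 * real p * a ^ (2 * p - 1)) * (- 2 * b) \<le> (a - 2 * b) ^ (2 * p) - a ^ (2 * p)"
    by auto
  then show ?thesis by argo
qed

section \<open>Degenerate sums\<close>

text \<open>This class is an algebra, closed under sums, products and powers, so integrability of
  any polynomial in the projections follows from introduction rules without tracking
  exponents.\<close>

definition all_moments :: "'a measure \<Rightarrow> ('a \<Rightarrow> real) \<Rightarrow> bool" where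
  "all_moments M f \<longleftrightarrow> f \<in> borel_measurable M \<and> (\<forall>n. integrable M (\<lambda>x. \<bar>f x\<bar> ^ n))"

lemma all_moments_measurable[measurable_dest]: "all_moments M f \<Longrightarrow> f \<in> borel_measurable M"
  by (simp add: all_moments_def)

lemma all_moments_integrable:
  assumes "all_moments M f"
  shows "integrable M f"
  using assms integrable_norm_iff[of f M] by (auto simp: all_moments_def dest: spec[of _ 1])

lemma all_moments_cmult:
  assumes "all_moments M f"
  shows "all_moments M (\<lambda>x. c * f x)"
  using assms by (auto simp: all_moments_def abs_mult power_mult_distrib)

lemma all_moments_add:
  assumes f: "all_moments M f" and g: "all_moments M g"
  shows "all_moments M (\<lambda>x. f x + g x)"
  unfolding all_moments_def
proof (intro conjI allI)
  note [measurable] = f g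
  show "(\<lambda>x. f x + g x) \<in> borel_measurable M" by measurable
  fix n
  have "\<bar>a + b\<bar> ^ n \<le> 2 ^ n * (\<bar>a\<bar> ^ n + \<bar>b\<bar> ^ n)" for a b :: real
  proof -
    have "\<bar>a + b\<bar> ^ n \<le> (2 * max \<bar>a\<bar> \<bar>b\<bar>) ^ n" by (intro power_mono) auto
    also have "\<dots> \<le> 2 ^ n * (\<bar>a\<bar> ^ n + \<bar>b\<bar> ^ n)"
      by (auto simp: power_mult_distrib max_def)
    finally show ?thesis .
  qed
  moreover have "integrable M (\<lambda>x. 2 ^ n * (\<bar>f x\<bar> ^ n + \<bar>g x\<bar> ^ n))"
    using f g by (auto simp: all_moments_def)
  ultimately show "integrable M (\<lambda>x. \<bar>f x + g x\<bar> ^ n)"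
    by (intro Bochner_Integration.integrable_bound[where g="\<lambda>x. \<bar>f x + g x\<bar> ^ n"
          and f="\<lambda>x. 2 ^ n * (\<bar>f x\<bar> ^ n + \<bar>g x\<bar> ^ n)"] AE_I2) auto
qed

lemma all_moments_mult:
  assumes f: "all_moments M f" and g: "all_moments M g"
  shows "all_moments M (\<lambda>x. f x * g x)"
  unfolding all_moments_def
proof (intro conjI allI)
  note [measurable] = f g
  show "(\<lambda>x. f x * g x) \<in> borel_measurable M" by measurable
  fix n
  have "\<bar>a * b\<bar> ^ n \<le> \<bar>a\<bar> ^ (n + n) + \<bar>b\<bar> ^ (n + n)" for a b :: real
  proof -
    have "2 * (\<bar>a\<bar> ^ n * \<bar>b\<bar> ^ n) \<le> (\<bar>a\<bar> ^ n)\<^sup>2 + (\<bar>b\<bar> ^ n)\<^sup>2"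
      using sum_squares_bound[of "\<bar>a\<bar> ^ n" "\<bar>b\<bar> ^ n"] by (simp add: mult.assoc)
    moreover have "0 \<le> \<bar>a\<bar> ^ n * \<bar>b\<bar> ^ n" by simp
    ultimately have "\<bar>a\<bar> ^ n * \<bar>b\<bar> ^ n \<le> (\<bar>a\<bar> ^ n)\<^sup>2 + (\<bar>b\<bar> ^ n)\<^sup>2" by linarith
    then show ?thesis
      by (simp only: abs_mult power_mult_distrib power2_eq_square power_add)
  qed
  moreover have "integrable M (\<lambda>x. \<bar>f x\<bar> ^ (n + n) + \<bar>g x\<bar> ^ (n + n))"
    using f g by (intro Bochner_Integration.integrable_add) (simp_all add: all_moments_def)
  ultimately show "integrable M (\<lambda>x. \<bar>f x * g x\<bar> ^ n)"
    by (intro Bochner_Integration.integrable_bound[where g="\<lambda>x. \<bar>f x * g x\<bar> ^ n"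
          and f="\<lambda>x. \<bar>f x\<bar> ^ (n + n) + \<bar>g x\<bar> ^ (n + n)"] AE_I2) auto
qed

lemma (in finite_measure) all_moments_const: "all_moments M (\<lambda>x. c)"
  by (simp add: all_moments_def)

lemma all_moments_power:
  assumes f: "all_moments M f"
  shows "all_moments M (\<lambda>x. f x ^ k)"
  using assms by (auto simp: all_moments_def power_abs power_mult[symmetric])

lemma (in finite_measure) all_moments_sum:
  assumes "\<And>i. i \<in> A \<Longrightarrow> all_moments M (f i)"
  shows "all_moments M (\<lambda>x. \<Sum>i\<in>A. f i x)"
  using assms
  by (induction A rule: infinite_finite_induct) (auto intro: all_moments_const all_moments_add)

text \<open>
  Replacing the coordinates in \<open>S\<close> by randomly signed ones costs a factor 2 for each of them; the
  pointwise inequality behind each replacement has a linear term that integrates to zero by degeneracy.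
\<close>
lemma (in finite_measure) degenerate_symmetrization:
  fixes F :: "'i set \<Rightarrow> 'a \<Rightarrow> real" and a :: "'i set \<Rightarrow> real"
  assumes "finite \<J>" "1 \<le> p" and am: "\<And>J. J \<in> \<J> \<Longrightarrow> all_moments M (F J)"
    and fin: "\<And>J. J \<in> \<J> \<Longrightarrow> finite J"
    and deg: "\<And>i J b. J \<in> \<J> \<Longrightarrow> i \<in> J \<Longrightarrow>
      (\<integral>x. F J x * (\<Sum>J'\<in>{J'\<in>\<J>. i \<notin> J'}. b J' * F J' x) ^ (2 * p - 1) \<partial>M) = 0"
    and "finite S"
  shows "(\<integral>x. (\<Sum>J\<in>\<J>. a J * F J x) ^ (2 * p) \<partial>M) \<le>
    (\<Sum>U\<in>Pow S. (\<integral>x. (\<Sum>J\<in>\<J>. a J * 2 ^ card (J \<inter> S) * (- 1) ^ card (J \<inter> U) * F J x) ^ (2 * p) \<partial>M))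
      / 2 ^ card S"
  using \<open>finite S\<close>
proof (induction S rule: finite_induct)
  case (insert i S)
  define I where "I b = (\<integral>x. (\<Sum>J\<in>\<J>. b J * F J x) ^ (2 * p) \<partial>M)" for b :: "'i set \<Rightarrow> real"
  have am_sum: "all_moments M (\<lambda>x. \<Sum>J\<in>\<K>. b J * F J x)" if "\<K> \<subseteq> \<J>" for b :: "'i set \<Rightarrow> real" and \<K>
    using that am by (intro all_moments_sum all_moments_cmult) auto
  have step: "I b \<le> (I (\<lambda>J. b J * (if i \<in> J then 2 else 1)) + I (\<lambda>J. b J * (if i \<in> J then - 2 else 1))) / 2"
    for b
  proof -
    define A where "A x = (\<Sum>J\<in>{J\<in>\<J>. i \<notin> J}. b J * F J x)" for x
    define B where "B x = (\<Sum>J\<in>{J\<in>\<J>. i \<in> J}. b J * F J x)" for x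
    have amA: "all_moments M A" and amB: "all_moments M B"
      unfolding A_def[abs_def] B_def[abs_def] by (intro am_sum; auto)+
    have split: "(\<Sum>J\<in>\<J>. b J * (if i \<in> J then c else 1) * F J x) = A x + c * B x" for c x
    proof -
      have "(\<Sum>J\<in>\<J>. b J * (if i \<in> J then c else 1) * F J x) =
          (\<Sum>J\<in>\<J>. if i \<in> J then c * (b J * F J x) else b J * F J x)"
        by (intro sum.cong) auto
      also have "\<dots> = c * B x + A x"
        unfolding A_def B_def sum_distrib_left using \<open>finite \<J>\<close> by (simp add: sum.If_cases Int_def)
      finally show ?thesis by simp
    qed
    have eqs: "I b = (\<integral>x. (A x + B x) ^ (2 * p) \<partial>M)"
      "I (\<lambda>J. b J * (if i \<in> J then 2 else 1)) = (\<integral>x. (A x + 2 * B x) ^ (2 * p) \<partial>M)"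
      "I (\<lambda>J. b J * (if i \<in> J then - 2 else 1)) = (\<integral>x. (A x - 2 * B x) ^ (2 * p) \<partial>M)"
      unfolding I_def using split[of 1] split[of 2] split[of "- 2"] by auto
    \<comment> \<open>\<open>B\<close> collects the summands that contain \<open>i\<close> and
      \<open>A\<close> those that avoid it, so \<open>deg\<close> annihilates the linear term
      summand by summand.\<close>
    have AB: "(\<integral>x. A x ^ (2 * p - 1) * B x \<partial>M) = 0"
    proof -
      have "(\<integral>x. A x ^ (2 * p - 1) * B x \<partial>M) =
          (\<integral>x. (\<Sum>J\<in>{J\<in>\<J>. i \<in> J}. b J * (F J x * A x ^ (2 * p - 1))) \<partial>M)"
        unfolding B_def sum_distrib_left by (intro Bochner_Integration.integral_cong sum.cong) auto
      also have "\<dots> = (\<Sum>J\<in>{J\<in>\<J>. i \<in> J}. (\<integral>x. b J * (F J x * A x ^ (2 * p - 1)) \<partial>M))"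
        using am amA
        by (intro Bochner_Integration.integral_sum all_moments_integrable all_moments_cmult
            all_moments_mult all_moments_power) auto
      also have "\<dots> = 0"
        using deg by (intro sum.neutral) (auto simp: A_def)
      finally show ?thesis .
    qed
    have int: "integrable M (\<lambda>x. (A x + c * B x) ^ (2 * p))" for c
      by (intro all_moments_integrable all_moments_power all_moments_add all_moments_cmult amA amB)
    have int': "integrable M (\<lambda>x. A x ^ (2 * p - 1) * B x)"
      by (intro all_moments_integrable all_moments_power all_moments_mult amA amB)
    have "I b \<le> (\<integral>x. ((A x + 2 * B x) ^ (2 * p) + (A x - 2 * B x) ^ (2 * p)) / 2
        + 2 * real p * (A x ^ (2 * p - 1) * B x) \<partial>M)"
      unfolding eqs using int' int[of 1] int[of 2] int[of "- 2"] \<open>1 \<le> p\<close>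
      by (intro integral_mono convex_even_power_split) auto
    also have "\<dots> = ((\<integral>x. (A x + 2 * B x) ^ (2 * p) \<partial>M) + (\<integral>x. (A x - 2 * B x) ^ (2 * p) \<partial>M)) / 2"
      using int' int[of 2] int[of "- 2"] AB by simp
    finally show ?thesis unfolding eqs .
  qed
  define b where "b U J = a J * 2 ^ card (J \<inter> S) * (- 1) ^ card (J \<inter> U)" for U J
  define b' where "b' U J = a J * 2 ^ card (J \<inter> insert i S) * (- 1) ^ card (J \<inter> U)" for U J
  \<comment> \<open>Putting \<open>i\<close> into \<open>U\<close> flips the sign exactly for the
    sets containing \<open>i\<close>; the factors 2 and -2 are thus the two extensions of the sign
    vector \<open>U\<close> to \<open>insert i S\<close>.\<close>
  have b': "b U J * (if i \<in> J then 2 else 1) = b' U J"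
      "b U J * (if i \<in> J then - 2 else 1) = b' (insert i U) J"
    if "U \<in> Pow S" "J \<in> \<J>" for U J
  proof -
    have i: "i \<notin> S" "i \<notin> U" "finite J" using that insert.hyps fin by auto
    then show "b U J * (if i \<in> J then 2 else 1) = b' U J"
      "b U J * (if i \<in> J then - 2 else 1) = b' (insert i U) J"
      by (auto simp: b_def b'_def Int_insert_right card_insert_if)
  qed
  have "I a \<le> (\<Sum>U\<in>Pow S. I (b U)) / 2 ^ card S"
    using insert.IH unfolding I_def b_def .
  also have "\<dots> \<le> (\<Sum>U\<in>Pow S. (I (b' U) + I (b' (insert i U))) / 2) / 2 ^ card S"
  proof (intro divide_right_mono sum_mono)
    fix U assume "U \<in> Pow S"
    then have "I (b' U) = I (\<lambda>J. b U J * (if i \<in> J then 2 else 1))"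
      "I (b' (insert i U)) = I (\<lambda>J. b U J * (if i \<in> J then - 2 else 1))"
      unfolding I_def using b' by (simp_all cong: sum.cong)
    then show "I (b U) \<le> (I (b' U) + I (b' (insert i U))) / 2" using step by simp
  qed simp
  also have "\<dots> = (\<Sum>U\<in>Pow (insert i S). I (b' U)) / 2 ^ card (insert i S)"
    unfolding sum_Pow_insert[OF insert.hyps] using insert.hyps
    by (simp add: sum_divide_distrib[symmetric])
  finally show ?case unfolding I_def b'_def .
qed simp

text \<open>Once all of \<open>S\<close> is symmetrised, every summand carries the same factor
  \<open>2 ^ j\<close>. For fixed \<open>x\<close> the average over \<open>U\<close> is the moment
  of a homogeneous Walsh polynomial of degree \<open>j\<close> with coefficients
  \<open>2 ^ j * F J x\<close>, so Bonami's inequality applies pointwise in \<open>x\<close>; per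
  degree the cost is 4 (2p - 1), at most 8p.\<close>

lemma (in finite_measure) degenerate_moment_le:
  fixes F :: "'i set \<Rightarrow> 'a \<Rightarrow> real"
  assumes "finite S" "1 \<le> p" and \<J>: "\<J> = {J. J \<subseteq> S \<and> card J = j}"
    and am: "\<And>J. J \<in> \<J> \<Longrightarrow> all_moments M (F J)"
    and deg: "\<And>i J b. J \<in> \<J> \<Longrightarrow> i \<in> J \<Longrightarrow>
      (\<integral>x. F J x * (\<Sum>J'\<in>{J'\<in>\<J>. i \<notin> J'}. b J' * F J' x) ^ (2 * p - 1) \<partial>M) = 0"
  shows "(\<integral>x. (\<Sum>J\<in>\<J>. F J x) ^ (2 * p) \<partial>M) \<le>
    (8 * real p) ^ (j * p) * (\<integral>x. (\<Sum>J\<in>\<J>. (F J x)\<^sup>2) ^ p \<partial>M)"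
proof -
  have J: "J \<subseteq> S" "card J = j" "finite J" "J \<inter> S = J" if "J \<in> \<J>" for J
    using that \<open>finite S\<close> unfolding \<J> by (auto intro: finite_subset)
  have sub: "\<J> \<subseteq> Pow S" and "finite \<J>" using \<open>finite S\<close> unfolding \<J> by auto
  define a where "a x T = (if T \<in> \<J> then 2 ^ j * F T x else 0)" for x T
  have int1: "integrable M (\<lambda>x. (\<Sum>J\<in>\<J>. 2 ^ j * (- 1) ^ card (J \<inter> U) * F J x) ^ (2 * p))" for U
    using am by (intro all_moments_integrable all_moments_power all_moments_sum all_moments_cmult)
  have int2: "integrable M (\<lambda>x. (8 * real p) ^ (j * p) * (\<Sum>J\<in>\<J>. (F J x)\<^sup>2) ^ p)"
    using am by (intro all_moments_integrable all_moments_power all_moments_sum all_moments_cmult)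
  have "(\<integral>x. (\<Sum>J\<in>\<J>. 1 * F J x) ^ (2 * p) \<partial>M) \<le>
      (\<Sum>U\<in>Pow S. (\<integral>x. (\<Sum>J\<in>\<J>. 1 * 2 ^ card (J \<inter> S) * (- 1) ^ card (J \<inter> U) * F J x) ^ (2 * p) \<partial>M))
        / 2 ^ card S"
    using J am deg assms(1,2) \<open>finite \<J>\<close> by (intro degenerate_symmetrization) auto
  also have "\<dots> = (\<Sum>U\<in>Pow S. (\<integral>x. (\<Sum>J\<in>\<J>. 2 ^ j * (- 1) ^ card (J \<inter> U) * F J x) ^ (2 * p) \<partial>M)) / 2 ^ card S"
    using J by (simp cong: sum.cong)
  also have "\<dots> = (\<integral>x. (\<Sum>U\<in>Pow S. (\<Sum>J\<in>\<J>. 2 ^ j * (- 1) ^ card (J \<inter> U) * F J x) ^ (2 * p)) / 2 ^ card S \<partial>M)"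
    using int1 by simp
  also have "\<dots> \<le> (\<integral>x. (8 * real p) ^ (j * p) * (\<Sum>J\<in>\<J>. (F J x)\<^sup>2) ^ p \<partial>M)"
  proof (intro integral_mono int2)
    show "integrable M (\<lambda>x. (\<Sum>U\<in>Pow S. (\<Sum>J\<in>\<J>. 2 ^ j * (- 1) ^ card (J \<inter> U) * F J x) ^ (2 * p)) / 2 ^ card S)"
      using int1 by simp
    fix x
    have "(\<Sum>U\<in>Pow S. (\<Sum>J\<in>\<J>. 2 ^ j * (- 1) ^ card (J \<inter> U) * F J x) ^ (2 * p))
        = (\<Sum>U\<in>Pow S. (\<Sum>T\<in>Pow S. a x T * (- 1) ^ card (T \<inter> U)) ^ (2 * p))"
    proof (rule sum.cong[OF refl], rule arg_cong[where f="\<lambda>z. z ^ (2 * p)"])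
      fix U
      have "(\<Sum>T\<in>Pow S. a x T * (- 1) ^ card (T \<inter> U)) = (\<Sum>T\<in>\<J>. a x T * (- 1) ^ card (T \<inter> U))"
        using sub \<open>finite S\<close> by (intro sum.mono_neutral_right) (auto simp: a_def)
      then show "(\<Sum>J\<in>\<J>. 2 ^ j * (- 1) ^ card (J \<inter> U) * F J x) = (\<Sum>T\<in>Pow S. a x T * (- 1) ^ card (T \<inter> U))"
        by (simp add: a_def mult_ac cong: sum.cong)
    qed
    also have "\<dots> \<le> 2 ^ card S * (\<Sum>T\<in>Pow S. (2 * real p - 1) ^ card T * (a x T)\<^sup>2) ^ p"
      using assms by (intro bonami_even)
    also have "(\<Sum>T\<in>Pow S. (2 * real p - 1) ^ card T * (a x T)\<^sup>2) =
        (\<Sum>T\<in>\<J>. (2 * real p - 1) ^ card T * (a x T)\<^sup>2)"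
      using sub \<open>finite S\<close> by (intro sum.mono_neutral_right) (auto simp: a_def)
    also have "\<dots> = (4 * (2 * real p - 1)) ^ j * (\<Sum>J\<in>\<J>. (F J x)\<^sup>2)"
    proof -
      have "(2 ^ j)\<^sup>2 = (4 :: real) ^ j"
        by (simp add: power2_eq_square power_mult_distrib[symmetric])
      then show ?thesis
        unfolding sum_distrib_left power_mult_distrib using J
        by (intro sum.cong refl) (simp add: a_def power_mult_distrib)
    qed
    finally have "(\<Sum>U\<in>Pow S. (\<Sum>J\<in>\<J>. 2 ^ j * (- 1) ^ card (J \<inter> U) * F J x) ^ (2 * p)) / 2 ^ card S
        \<le> ((4 * (2 * real p - 1)) ^ j * (\<Sum>J\<in>\<J>. (F J x)\<^sup>2)) ^ p"
      by (simp add: divide_le_eq mult.commute)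
    also have "\<dots> \<le> ((8 * real p) ^ j * (\<Sum>J\<in>\<J>. (F J x)\<^sup>2)) ^ p"
      using \<open>1 \<le> p\<close> by (intro power_mono mult_right_mono mult_nonneg_nonneg sum_nonneg) auto
    also have "\<dots> = (8 * real p) ^ (j * p) * (\<Sum>J\<in>\<J>. (F J x)\<^sup>2) ^ p"
      by (simp add: power_mult_distrib power_mult)
    finally show "(\<Sum>U\<in>Pow S. (\<Sum>J\<in>\<J>. 2 ^ j * (- 1) ^ card (J \<inter> U) * F J x) ^ (2 * p)) / 2 ^ card S
        \<le> (8 * real p) ^ (j * p) * (\<Sum>J\<in>\<J>. (F J x)\<^sup>2) ^ p" .
  qed
  finally show ?thesis by simp
qed

section \<open>Nonnegative U-statistics\<close>

lemma convex_on_power_nonneg: "convex_on {0::real..} (\<lambda>x. x ^ n)"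
  by (cases "even n")
    (auto intro: convex_power_odd convex_on_subset[OF convex_power_even])

text \<open>Convexity with the weight 1/(n+1) on \<open>a\<close>. The main part \<open>b\<close>
  then keeps the absolute constant (1 + 1/n)^n, below e, while the large coefficient falls on
  \<open>a\<close>, which will be the small sum over the sets meeting a given one.\<close>

lemma power_add_le_weighted:
  fixes a b :: real
  assumes "0 \<le> a" "0 \<le> b" "1 \<le> n"
  shows "(a + b) ^ n \<le> real (Suc n) ^ n * a ^ n + exp 1 * b ^ n"
proof -
  define \<theta> where "\<theta> = 1 / real (Suc n)"
  have \<theta>: "0 < \<theta>" "\<theta> < 1" using assms(3) by (auto simp: \<theta>_def)
  have "((1 - \<theta>) *\<^sub>R (b / (1 - \<theta>)) + \<theta> *\<^sub>R (a / \<theta>)) ^ n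
      \<le> (1 - \<theta>) * (b / (1 - \<theta>)) ^ n + \<theta> * (a / \<theta>) ^ n"
    using \<theta> assms by (intro convex_onD[OF convex_on_power_nonneg]) auto
  then have "(a + b) ^ n \<le> \<theta> * (a / \<theta>) ^ n + (1 - \<theta>) * (b / (1 - \<theta>)) ^ n"
    using \<theta> by (simp add: add.commute)
  moreover have "\<theta> * (a / \<theta>) ^ n \<le> 1 * (a / \<theta>) ^ n"
    using \<theta> assms by (intro mult_right_mono) auto
  moreover have "(1 - \<theta>) * (b / (1 - \<theta>)) ^ n \<le> exp 1 * b ^ n"
  proof -
    have inv: "1 / (1 - \<theta>) = 1 + 1 / real n"
      using assms(3) by (simp add: \<theta>_def field_simps)
    have "(1 - \<theta>) * (b / (1 - \<theta>)) ^ n \<le> 1 * (b / (1 - \<theta>)) ^ n"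
      using \<theta> assms by (intro mult_right_mono) auto
    also have "\<dots> = (1 + 1 / real n) ^ n * b ^ n"
      unfolding inv[symmetric] by (simp add: power_divide)
    also have "\<dots> \<le> exp (1 / real n) ^ n * b ^ n"
      using assms by (intro mult_right_mono power_mono exp_ge_add_one_self) auto
    also have "exp (1 / real n) ^ n = exp 1"
      using assms(3) by (simp add: exp_of_nat_mult[symmetric])
    finally show ?thesis .
  qed
  ultimately show ?thesis by (simp add: \<theta>_def power_mult_distrib mult.commute)
qed

lemma power_sum_le:
  fixes y :: "'a \<Rightarrow> real"
  assumes "finite A" "\<And>i. i \<in> A \<Longrightarrow> 0 \<le> y i"
  shows "(\<Sum>i\<in>A. y i) ^ Suc n \<le> real (card A) ^ n * (\<Sum>i\<in>A. y i ^ Suc n)"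
proof (cases "A = {}")
  case False
  define c where "c = real (card A)"
  have c: "0 < c" using False assms(1) by (simp add: c_def card_gt_0_iff)
  have "(\<Sum>i\<in>A. (1 / c) *\<^sub>R y i) ^ Suc n \<le> (\<Sum>i\<in>A. (1 / c) * y i ^ Suc n)"
    by (rule convex_on_sum[OF assms(1) False convex_on_power_nonneg])
      (use c assms in \<open>auto simp: c_def\<close>)
  then have "((\<Sum>i\<in>A. y i) / c) ^ Suc n \<le> (\<Sum>i\<in>A. y i ^ Suc n) / c"
    by (simp add: sum_divide_distrib)
  then show ?thesis
    using c by (simp add: power_divide field_simps c_def[symmetric])
qed simp

lemma power_recursion_bound:
  fixes x A b :: real
  assumes "x ^ Suc n \<le> A ^ Suc n + b * x ^ n" "0 \<le> x" "0 \<le> A" "0 \<le> b"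
  shows "x \<le> A + b"
proof (rule ccontr)
  assume "\<not> x \<le> A + b"
  then have x: "A + b < x" by simp
  then have "0 < x" using assms by linarith
  have "A ^ Suc n + b * x ^ n \<le> A * x ^ n + b * x ^ n"
    using x assms by (auto intro!: mult_left_mono power_mono)
  also have "\<dots> = (A + b) * x ^ n" by (simp add: algebra_simps)
  also have "\<dots> < x * x ^ n" using x \<open>0 < x\<close> by (intro mult_strict_right_mono) auto
  finally show False using assms(1) by simp
qed

text \<open>
  A Rosenthal inequality for nonnegative U-statistics: in \<open>S ^ p = (\<Sum>J. Y J * S ^ (p - 1))\<close>
  split \<open>S\<close> into the summands that meet \<open>J\<close> and those that are independent of \<open>Y J\<close>.
\<close>
lemma (in prob_space) positive_ustatistic_moment_le:
  fixes Y :: "'i set \<Rightarrow> 'a \<Rightarrow> real"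
  assumes "finite \<J>" "\<J> \<noteq> {}" "1 \<le> p"
    and am: "\<And>J. J \<in> \<J> \<Longrightarrow> all_moments M (Y J)"
    and nn: "\<And>J x. J \<in> \<J> \<Longrightarrow> 0 \<le> Y J x"
    and ind: "\<And>J n. J \<in> \<J> \<Longrightarrow>
      (\<integral>x. Y J x * (\<Sum>J'\<in>{J'\<in>\<J>. J \<inter> J' = {}}. Y J' x) ^ n \<partial>M) =
      (\<integral>x. Y J x \<partial>M) * (\<integral>x. (\<Sum>J'\<in>{J'\<in>\<J>. J \<inter> J' = {}}. Y J' x) ^ n \<partial>M)"
    and s: "\<And>J. J \<in> \<J> \<Longrightarrow> (\<integral>x. Y J x \<partial>M) \<le> s"
    and w: "\<And>J. J \<in> \<J> \<Longrightarrow> (\<integral>x. Y J x ^ p \<partial>M) \<le> w"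
    and meet: "\<And>J. J \<in> \<J> \<Longrightarrow> real (card {J'\<in>\<J>. J \<inter> J' \<noteq> {}}) \<le> \<delta> * real (card \<J>)"
    and A: "real p ^ p * \<delta> ^ (p - 1) * w \<le> A ^ p" "0 \<le> A"
  shows "(\<integral>x. ((\<Sum>J\<in>\<J>. Y J x) / real (card \<J>)) ^ p \<partial>M) \<le> (exp 1 * s + A) ^ p"
proof -
  define L where "L = real (card \<J>)"
  have L: "0 < L" using assms(1,2) by (simp add: L_def card_gt_0_iff)
  define S where "S x = (\<Sum>J\<in>\<J>. Y J x)" for x
  define m where "m k = (\<integral>x. (S x / L) ^ k \<partial>M)" for k
  have amS: "all_moments M S" unfolding S_def[abs_def] using am by (intro all_moments_sum)
  have intS: "integrable M (\<lambda>x. S x ^ k)" for k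
    by (intro all_moments_integrable all_moments_power amS)
  have S0: "0 \<le> S x" for x unfolding S_def using nn by (intro sum_nonneg) auto
  obtain J0 where J0: "J0 \<in> \<J>" using assms(2) by blast
  have s0: "0 \<le> s" using s[OF J0] nn J0 by (meson Bochner_Integration.integral_nonneg order_trans)
  have w0: "0 \<le> w"
    using w[OF J0] nn J0 by (meson Bochner_Integration.integral_nonneg order_trans zero_le_power)
  have "real (card {J'\<in>\<J>. J0 \<inter> J' \<noteq> {}}) \<le> \<delta> * L" using meet[OF J0] by (simp add: L_def)
  then have \<delta>0: "0 \<le> \<delta>" using L by (smt (verit) mult_neg_pos of_nat_0_le_iff)
  show ?thesis
  proof (cases "p = 1")
    case True
    have "(\<integral>x. S x \<partial>M) = (\<Sum>J\<in>\<J>. \<integral>x. Y J x \<partial>M)"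
      unfolding S_def using am by (intro Bochner_Integration.integral_sum all_moments_integrable)
    also have "\<dots> \<le> (\<Sum>J\<in>\<J>. s)" using s by (intro sum_mono)
    finally have "(\<integral>x. S x / L \<partial>M) \<le> s" using L by (simp add: L_def divide_le_eq mult.commute)
    also have "s \<le> exp 1 * s + A" using s0 A(2) mult_right_mono[of 1 "exp 1" s] by simp
    finally show ?thesis using True by (simp add: S_def L_def)
  next
    case False
    define n where "n = p - 1"
    have p: "p = Suc n" "1 \<le> n" using False assms(3) by (auto simp: n_def)
    have summand: "(\<integral>x. Y J x * S x ^ n \<partial>M) \<le> real p ^ n * ((\<delta> * L) ^ n * w) + exp 1 * (s * (\<integral>x. S x ^ n \<partial>M))"
      if J: "J \<in> \<J>" for J
    proof -
      define \<K> where "\<K> = {J'\<in>\<J>. J \<inter> J' \<noteq> {}}"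
      define R where "R x = (\<Sum>J'\<in>\<K>. Y J' x)" for x
      define T where "T x = (\<Sum>J'\<in>{J'\<in>\<J>. J \<inter> J' = {}}. Y J' x)" for x
      have amR: "all_moments M R" and amT: "all_moments M T"
        unfolding R_def[abs_def] T_def[abs_def] \<K>_def using am by (auto intro!: all_moments_sum)
      have RT0: "0 \<le> R x" "0 \<le> T x" for x
        unfolding R_def T_def \<K>_def using nn by (auto intro!: sum_nonneg)
      have S_RT: "S x = R x + T x" for x
      proof -
        have "\<J> = \<K> \<union> {J'\<in>\<J>. J \<inter> J' = {}}" by (auto simp: \<K>_def)
        then show ?thesis
          unfolding S_def R_def T_def using \<open>finite \<J>\<close>
          by (subst sum.union_disjoint[symmetric]) (auto simp: \<K>_def)
      qed
      have T_le_S: "T x \<le> S x" for x using S_RT RT0 by simp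
      have int: "integrable M (\<lambda>x. Y J x * S x ^ n)" "integrable M (\<lambda>x. Y J x * R x ^ n)"
        "integrable M (\<lambda>x. Y J x * T x ^ n)"
        using J by (auto intro!: all_moments_integrable all_moments_mult all_moments_power am amS amR amT)
      have "(\<integral>x. Y J x * T x ^ n \<partial>M) = (\<integral>x. Y J x \<partial>M) * (\<integral>x. T x ^ n \<partial>M)"
        unfolding T_def using ind[OF J] .
      also have "\<dots> \<le> s * (\<integral>x. S x ^ n \<partial>M)"
        using s[OF J] s0 RT0 T_le_S intS
        by (intro mult_mono integral_mono power_mono all_moments_integrable all_moments_power amT
            amS Bochner_Integration.integral_nonneg) auto
      finally have T: "(\<integral>x. Y J x * T x ^ n \<partial>M) \<le> s * (\<integral>x. S x ^ n \<partial>M)" .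
      have R: "(\<integral>x. Y J x * R x ^ n \<partial>M) \<le> (\<delta> * L) ^ n * w"
      proof -
        define D where "D = real (card \<K>)"
        have D: "0 \<le> D" "D \<le> \<delta> * L" using meet[OF J] by (simp_all add: D_def \<K>_def L_def)
        have finK: "finite \<K>" "\<K> \<subseteq> \<J>" using \<open>finite \<J>\<close> by (auto simp: \<K>_def)
        \<comment> \<open>Jensen's inequality costs \<open>D ^ k\<close>; Young's inequality with
          weights 1 and \<open>n\<close> replaces the mixed products by pure powers of order
          \<open>p\<close>; summing over the \<open>D\<close> members of \<open>\<K>\<close>
          supplies the last factor of \<open>D ^ n\<close>.\<close>
        obtain k where k: "n = Suc k" using p(2) by (cases n) auto
        have "real p * (\<integral>x. Y J x * R x ^ n \<partial>M) = (\<integral>x. real p * (Y J x * R x ^ n) \<partial>M)"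
          by simp
        also have "\<dots> \<le> (\<integral>x. D ^ k * (\<Sum>J'\<in>\<K>. Y J x ^ p + real n * Y J' x ^ p) \<partial>M)"
        proof (intro integral_mono)
          show "integrable M (\<lambda>x. D ^ k * (\<Sum>J'\<in>\<K>. Y J x ^ p + real n * Y J' x ^ p))"
            using finK J
            by (intro all_moments_integrable all_moments_cmult all_moments_sum all_moments_add
                all_moments_power am) auto
          fix x
          have "R x ^ n \<le> D ^ k * (\<Sum>J'\<in>\<K>. Y J' x ^ n)"
            unfolding R_def D_def k using finK nn by (intro power_sum_le) auto
          then have "real p * (Y J x * R x ^ n) \<le> real p * (Y J x * (D ^ k * (\<Sum>J'\<in>\<K>. Y J' x ^ n)))"
            using nn J by (intro mult_left_mono) auto
          also have "\<dots> = D ^ k * (\<Sum>J'\<in>\<K>. real (1 + n) * (Y J x ^ 1 * Y J' x ^ n))"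
            by (simp add: p sum_distrib_left mult_ac)
          also have "\<dots> \<le> D ^ k * (\<Sum>J'\<in>\<K>. real 1 * Y J x ^ (1 + n) + real n * Y J' x ^ (1 + n))"
            using D finK nn J by (intro mult_left_mono sum_mono Youngs_inequality_power) auto
          finally show "real p * (Y J x * R x ^ n) \<le> D ^ k * (\<Sum>J'\<in>\<K>. Y J x ^ p + real n * Y J' x ^ p)"
            by (simp add: p)
        qed (use int in auto)
        also have "\<dots> = D ^ k * (\<Sum>J'\<in>\<K>. (\<integral>x. Y J x ^ p \<partial>M) + real n * (\<integral>x. Y J' x ^ p \<partial>M))"
        proof -
          have i: "integrable M (\<lambda>x. Y J' x ^ p)" if "J' \<in> \<J>" for J'
            using that by (intro all_moments_integrable all_moments_power am)
          have "(\<integral>x. (\<Sum>J'\<in>\<K>. Y J x ^ p + real n * Y J' x ^ p) \<partial>M) =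
              (\<Sum>J'\<in>\<K>. (\<integral>x. Y J x ^ p + real n * Y J' x ^ p \<partial>M))"
            using i J finK by (intro Bochner_Integration.integral_sum) auto
          also have "\<dots> = (\<Sum>J'\<in>\<K>. (\<integral>x. Y J x ^ p \<partial>M) + real n * (\<integral>x. Y J' x ^ p \<partial>M))"
            using i J finK by (intro sum.cong refl) (subst Bochner_Integration.integral_add, auto)
          finally show ?thesis by simp
        qed
        also have "\<dots> \<le> D ^ k * (\<Sum>J'\<in>\<K>. w + real n * w)"
          using w J finK D by (intro mult_left_mono sum_mono add_mono) auto
        also have "\<dots> = real p * (D ^ n * w)"
          by (simp add: D_def p k algebra_simps)
        finally have "(\<integral>x. Y J x * R x ^ n \<partial>M) \<le> D ^ n * w"
          using assms(3) by simp
        also have "\<dots> \<le> (\<delta> * L) ^ n * w" using D w0 by (intro mult_right_mono power_mono) auto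
        finally show ?thesis .
      qed
      have "(\<integral>x. Y J x * S x ^ n \<partial>M) \<le>
          (\<integral>x. real p ^ n * (Y J x * R x ^ n) + exp 1 * (Y J x * T x ^ n) \<partial>M)"
      proof (intro integral_mono)
        fix x
        have "Y J x * S x ^ n \<le> Y J x * (real p ^ n * R x ^ n + exp 1 * T x ^ n)"
          unfolding S_RT p using nn J RT0 p by (intro mult_left_mono power_add_le_weighted) auto
        then show "Y J x * S x ^ n \<le> real p ^ n * (Y J x * R x ^ n) + exp 1 * (Y J x * T x ^ n)"
          by (simp add: algebra_simps)
      qed (use int in auto)
      also have "\<dots> = real p ^ n * (\<integral>x. Y J x * R x ^ n \<partial>M) + exp 1 * (\<integral>x. Y J x * T x ^ n \<partial>M)"
        using int by simp
      also have "\<dots> \<le> real p ^ n * ((\<delta> * L) ^ n * w) + exp 1 * (s * (\<integral>x. S x ^ n \<partial>M))"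
        using T R by (intro add_mono mult_left_mono) auto
      finally show ?thesis .
    qed
    have "(\<integral>x. S x ^ p \<partial>M) = (\<integral>x. (\<Sum>J\<in>\<J>. Y J x * S x ^ n) \<partial>M)"
      unfolding p by (simp add: S_def sum_distrib_right)
    also have "\<dots> = (\<Sum>J\<in>\<J>. (\<integral>x. Y J x * S x ^ n \<partial>M))"
      by (intro Bochner_Integration.integral_sum all_moments_integrable all_moments_mult
          all_moments_power am amS)
    also have "\<dots> \<le> (\<Sum>J\<in>\<J>. real p ^ n * ((\<delta> * L) ^ n * w) + exp 1 * (s * (\<integral>x. S x ^ n \<partial>M)))"
      by (intro sum_mono summand)
    also have "\<dots> = L ^ p * (real p ^ n * \<delta> ^ n * w) + L * (exp 1 * (s * (\<integral>x. S x ^ n \<partial>M)))"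
      by (simp add: L_def p power_mult_distrib algebra_simps)
    finally have "(\<integral>x. S x ^ p \<partial>M) / L ^ p \<le>
        (L ^ p * (real p ^ n * \<delta> ^ n * w) + L * (exp 1 * (s * (\<integral>x. S x ^ n \<partial>M)))) / L ^ p"
      using L by (intro divide_right_mono) auto
    also have "\<dots> = real p ^ n * \<delta> ^ n * w + exp 1 * s * ((\<integral>x. S x ^ n \<partial>M) / L ^ n)"
      using L by (simp add: p add_divide_distrib)
    finally have "m p \<le> real p ^ n * \<delta> ^ n * w + exp 1 * s * m n"
      by (simp add: m_def power_divide)
    also have "real p ^ n * \<delta> ^ n * w \<le> real p ^ p * \<delta> ^ n * w"
      using \<delta>0 w0 assms(3) by (intro mult_right_mono power_increasing) (auto simp: p)
    also have "\<dots> \<le> A ^ p" using A(1) by (simp add: p)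
    finally have rec: "m p \<le> A ^ p + exp 1 * s * m n" by simp
    have m0: "0 \<le> m k" for k unfolding m_def using S0 L by simp
    \<comment> \<open>The norm of order \<open>p\<close> of the normalised sum. Lyapunov's
      inequality \<open>m n \<le> x ^ n\<close> turns \<open>rec\<close> into an inequality for
      \<open>x\<close> alone, which \<open>power_recursion_bound\<close> resolves linearly.\<close>
    define x where "x = root p (m p)"
    have x: "0 \<le> x" "x ^ p = m p" using m0[of p] assms(3) by (auto simp: x_def)
    have "m n \<le> x ^ n"
    proof (cases "x = 0")
      case True
      then have "m p = 0" using x(2) assms(3) by (simp add: power_0_left)
      moreover have "integrable M (\<lambda>x. (S x / L) ^ p)" using intS[of p] by (simp add: power_divide)
      ultimately have "AE x in M. (S x / L) ^ p = 0"
        using S0 L by (subst (asm) m_def, subst (asm) integral_nonneg_eq_0_iff_AE) auto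
      then have "AE x in M. (S x / L) ^ n = 0"
        by (rule AE_mp) (use p(2) assms(3) in auto)
      then have "m n = 0" unfolding m_def by (rule integral_eq_zero_AE)
      then show ?thesis using x by simp
    next
      case False
      \<comment> \<open>Lyapunov's inequality from Young's, with the constant \<open>x\<close> as
        second factor; at the end one factor \<open>x\<close> is cancelled, which is why
        \<open>x = 0\<close> was set apart.\<close>
      have "(\<integral>y. real (n + 1) * ((S y / L) ^ n * x ^ 1) \<partial>M) \<le>
          (\<integral>y. real n * (S y / L) ^ (n + 1) + real 1 * x ^ (n + 1) \<partial>M)"
        using S0 L x intS
        by (intro integral_mono Youngs_inequality_power) (auto simp: power_divide simp del: power_Suc of_nat_Suc)
      also have "\<dots> = real n * m p + m p"
        using intS[of p] x(2) by (simp add: m_def p power_divide prob_space del: power_Suc)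
      also have "\<dots> = real (n + 1) * x ^ p" by (simp add: x(2) algebra_simps)
      finally have "real (n + 1) * (m n * x) \<le> real (n + 1) * (x ^ n * x)"
        by (simp add: m_def p mult_ac del: of_nat_Suc of_nat_add)
      then have "m n * x \<le> x ^ n * x" by (rule mult_left_le_imp_le) simp
      then show ?thesis using False x(1) by simp
    qed
    then have "exp 1 * s * m n \<le> exp 1 * s * x ^ n"
      using s0 by (intro mult_left_mono) auto
    then have "x ^ p \<le> A ^ p + exp 1 * s * x ^ n" unfolding x(2) by (rule order_trans[OF rec add_left_mono])
    then have "x ^ Suc n \<le> A ^ Suc n + exp 1 * s * x ^ n" unfolding p(1)[symmetric] .
    then have "x \<le> A + exp 1 * s"
      by (rule power_recursion_bound) (use x(1) A(2) s0 in auto)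
    then have "x ^ p \<le> (exp 1 * s + A) ^ p" using x(1) by (intro power_mono) auto
    then show ?thesis by (simp add: x(2) m_def S_def L_def)
  qed
qed

section \<open>Hoeffding projections\<close>

text \<open>Required for all functions, not only for points of the product space: projections are
  later evaluated at re-enumerated samples such as
  \<open>\<lambda>k. x (sorted_list_of_set J ! (k - 1))\<close>, which need not be
  extensional.\<close>

definition depends_on :: "'i set \<Rightarrow> (('i \<Rightarrow> 'a) \<Rightarrow> 'b) \<Rightarrow> bool" where
  "depends_on J f \<longleftrightarrow> (\<forall>x y. (\<forall>i\<in>J. x i = y i) \<longrightarrow> f x = f y)"

lemma depends_onD: "depends_on J f \<Longrightarrow> (\<And>i. i \<in> J \<Longrightarrow> x i = y i) \<Longrightarrow> f x = f y"
  by (auto simp: depends_on_def)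

lemma depends_on_mono: "depends_on J f \<Longrightarrow> J \<subseteq> K \<Longrightarrow> depends_on K f"
  unfolding depends_on_def by (meson subsetD)

lemma depends_on_sum:
  fixes f :: "'c \<Rightarrow> ('i \<Rightarrow> 'a) \<Rightarrow> 'b::comm_monoid_add"
  assumes "\<And>i. i \<in> A \<Longrightarrow> depends_on J (f i)"
  shows "depends_on J (\<lambda>x. \<Sum>i\<in>A. f i x)"
  unfolding depends_on_def
proof (intro allI impI sum.cong[OF refl])
  fix x y :: "'i \<Rightarrow> 'a" and i assume "\<forall>i\<in>J. x i = y i" "i \<in> A"
  then show "f i x = f i y" using assms[of i] by (auto intro!: depends_onD[of J "f i"])
qed

lemma depends_on_compose: "depends_on J f \<Longrightarrow> depends_on J (\<lambda>x. g (f x))"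
  unfolding depends_on_def by metis

section \<open>Resampling and conditional expectation on a finite product of one law\<close>

locale iid_product =
  fixes Q :: "'a measure" and S :: "'i set"
  assumes prob_Q: "prob_space Q" and finite_S: "finite S"
begin

definition \<Omega> :: "('i \<Rightarrow> 'a) measure" where
  "\<Omega> = Pi\<^sub>M S (\<lambda>_. Q)"

definition mix :: "'i set \<Rightarrow> ('i \<Rightarrow> 'a) \<Rightarrow> ('i \<Rightarrow> 'a) \<Rightarrow> 'i \<Rightarrow> 'a" where
  "mix I y x = (\<lambda>i\<in>S. if i \<in> I then y i else x i)"

text \<open>The conditional expectation of \<open>\<phi>\<close> given the coordinates in \<open>I\<close>.\<close>
definition cexp :: "'i set \<Rightarrow> (('i \<Rightarrow> 'a) \<Rightarrow> real) \<Rightarrow> ('i \<Rightarrow> 'a) \<Rightarrow> real" where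
  "cexp I \<phi> y = (\<integral>x. \<phi> (mix I y x) \<partial>\<Omega>)"

sublocale P: prob_space \<Omega>
  unfolding \<Omega>_def by (rule prob_space_PiM) (rule prob_Q)

sublocale PP: pair_prob_space \<Omega> \<Omega> ..

sublocale PQ: product_prob_space "\<lambda>_. Q" S
  using prob_Q by (simp add: product_prob_space_def product_prob_space_axioms_def
      product_sigma_finite_def prob_space_imp_sigma_finite)

lemma space_\<Omega>: "space \<Omega> = PiE S (\<lambda>_. space Q)"
  by (simp add: \<Omega>_def space_PiM)

lemma sets_\<Omega>[measurable_cong]: "sets \<Omega> = sets (Pi\<^sub>M S (\<lambda>_. Q))"
  by (simp add: \<Omega>_def)

lemma measurable_mix: "(\<lambda>(y, x). mix I y x) \<in> measurable (\<Omega> \<Otimes>\<^sub>M \<Omega>) \<Omega>"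
proof -
  have "(\<lambda>p. \<lambda>i\<in>S. if i \<in> I then fst p i else snd p i) \<in> measurable (\<Omega> \<Otimes>\<^sub>M \<Omega>) (Pi\<^sub>M S (\<lambda>_. Q))"
  proof (rule measurable_restrict)
    fix i assume [measurable]: "i \<in> S"
    show "(\<lambda>p. if i \<in> I then fst p i else snd p i) \<in> measurable (\<Omega> \<Otimes>\<^sub>M \<Omega>) Q"
      unfolding \<Omega>_def by measurable
  qed
  then show ?thesis by (simp add: \<Omega>_def mix_def case_prod_beta')
qed

lemma measurable_mix_right: "y \<in> space \<Omega> \<Longrightarrow> mix I y \<in> measurable \<Omega> \<Omega>"
  using measurable_mix[of I] by (auto dest!: measurable_Pair2)

text \<open>Each coordinate of the mixture comes from exactly one of two independent copies, so the
  preimage of a box is a product of two boxes whose masses recombine to the mass of the original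
  one. Through Fubini this identity carries all integrability and averaging properties of
  \<open>cexp\<close>.\<close>

lemma distr_mix: "distr (\<Omega> \<Otimes>\<^sub>M \<Omega>) \<Omega> (\<lambda>(y, x). mix I y x) = \<Omega>"
proof -
  have "distr (\<Omega> \<Otimes>\<^sub>M \<Omega>) \<Omega> (\<lambda>(y, x). mix I y x) = Pi\<^sub>M S (\<lambda>_. Q)"
  proof (rule PQ.PiM_eqI[OF finite_S])
    show "sets (distr (\<Omega> \<Otimes>\<^sub>M \<Omega>) \<Omega> (\<lambda>(y, x). mix I y x)) = sets (Pi\<^sub>M S (\<lambda>_. Q))"
      by (simp add: sets_\<Omega>)
    fix A assume A: "\<And>i. i \<in> S \<Longrightarrow> A i \<in> sets Q"
    let ?A1 = "\<lambda>i. if i \<in> I then A i else space Q" and ?A2 = "\<lambda>i. if i \<in> I then space Q else A i"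
    have sub: "A i \<subseteq> space Q" if "i \<in> S" for i using A[OF that] sets.sets_into_space by auto
    have PA: "Pi\<^sub>E S A \<in> sets \<Omega>" unfolding sets_\<Omega> using A finite_S by (intro sets_PiM_I_finite) auto
    have "emeasure (distr (\<Omega> \<Otimes>\<^sub>M \<Omega>) \<Omega> (\<lambda>(y, x). mix I y x)) (Pi\<^sub>E S A) =
        emeasure (\<Omega> \<Otimes>\<^sub>M \<Omega>) ((\<lambda>(y, x). mix I y x) -` Pi\<^sub>E S A \<inter> space (\<Omega> \<Otimes>\<^sub>M \<Omega>))"
      by (rule emeasure_distr[OF measurable_mix PA])
    also have "(\<lambda>(y, x). mix I y x) -` Pi\<^sub>E S A \<inter> space (\<Omega> \<Otimes>\<^sub>M \<Omega>) = Pi\<^sub>E S ?A1 \<times> Pi\<^sub>E S ?A2"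
      using sub by (auto simp: space_pair_measure space_\<Omega> mix_def PiE_iff split: if_splits)
        (metis subsetD)+
    also have "emeasure (\<Omega> \<Otimes>\<^sub>M \<Omega>) (Pi\<^sub>E S ?A1 \<times> Pi\<^sub>E S ?A2) =
        emeasure \<Omega> (Pi\<^sub>E S ?A1) * emeasure \<Omega> (Pi\<^sub>E S ?A2)"
      using A finite_S by (intro P.emeasure_pair_measure_Times) (auto simp: sets_\<Omega> intro!: sets_PiM_I_finite)
    also have "\<dots> = (\<Prod>i\<in>S. emeasure Q (?A1 i)) * (\<Prod>i\<in>S. emeasure Q (?A2 i))"
      unfolding \<Omega>_def using A finite_S by (subst (1 2) PQ.emeasure_PiM) auto
    also have "\<dots> = (\<Prod>i\<in>S. emeasure Q (A i))"
      unfolding prod.distrib[symmetric]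
      by (intro prod.cong refl) (auto simp: prob_space.emeasure_space_1[OF prob_Q])
    finally show "emeasure (distr (\<Omega> \<Otimes>\<^sub>M \<Omega>) \<Omega> (\<lambda>(y, x). mix I y x)) (Pi\<^sub>E S A) = (\<Prod>i\<in>S. emeasure Q (A i))" .
  qed
  then show ?thesis by (simp add: \<Omega>_def)
qed

text \<open>The tower property before integration, valid at every point.\<close>

lemma mix_mix: "mix B (mix A y x) x' = mix (A \<inter> B) y (mix B x x')"
  by (auto simp: mix_def fun_eq_iff)

lemma mix_depends:
  assumes "depends_on J f" "J \<subseteq> S" "J \<subseteq> I"
  shows "f (mix I y x) = f y"
  by (rule depends_onD[OF assms(1)]) (use assms in \<open>auto simp: mix_def\<close>)

context
  fixes \<phi> :: "('i \<Rightarrow> 'a) \<Rightarrow> real"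
  assumes meas: "\<phi> \<in> borel_measurable \<Omega>"
begin

lemma measurable_mix_fun: "(\<lambda>(y, x). \<phi> (mix I y x)) \<in> borel_measurable (\<Omega> \<Otimes>\<^sub>M \<Omega>)"
  using measurable_compose[OF measurable_mix meas] by (simp add: case_prod_beta')

lemma measurable_cexp[measurable]: "cexp I \<phi> \<in> borel_measurable \<Omega>"
  unfolding cexp_def[abs_def]
  by (intro P.borel_measurable_lebesgue_integral measurable_mix_fun)

lemma AE_mix:
  assumes "AE x in \<Omega>. R x"
  shows "AE y in \<Omega>. AE x in \<Omega>. R (mix I y x)"
proof -
  have "AE z in distr (\<Omega> \<Otimes>\<^sub>M \<Omega>) \<Omega> (\<lambda>(y, x). mix I y x). R z" using assms by (simp only: distr_mix)
  then have "AE p in \<Omega> \<Otimes>\<^sub>M \<Omega>. R ((\<lambda>(y, x). mix I y x) p)"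
    by (rule AE_distrD[OF measurable_mix])
  from PP.AE_pair[OF this] show ?thesis by simp
qed

lemma
  assumes "integrable \<Omega> \<phi>"
  shows AE_integrable_mix: "AE y in \<Omega>. integrable \<Omega> (\<lambda>x. \<phi> (mix I y x))"
    and integrable_cexp: "integrable \<Omega> (cexp I \<phi>)"
    and integral_cexp: "(\<integral>y. cexp I \<phi> y \<partial>\<Omega>) = (\<integral>x. \<phi> x \<partial>\<Omega>)"
proof -
  have "integrable (\<Omega> \<Otimes>\<^sub>M \<Omega>) (\<lambda>p. \<phi> ((\<lambda>(y, x). mix I y x) p))"
    using assms integrable_distr_eq[OF measurable_mix meas, of I] by (simp only: distr_mix)
  then have int: "integrable (\<Omega> \<Otimes>\<^sub>M \<Omega>) (\<lambda>(y, x). \<phi> (mix I y x))"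
    by (simp add: case_prod_beta')
  show "AE y in \<Omega>. integrable \<Omega> (\<lambda>x. \<phi> (mix I y x))" using PP.AE_integrable_fst'[OF int] by simp
  show "integrable \<Omega> (cexp I \<phi>)" using PP.integrable_fst'[OF int] by (simp add: cexp_def[abs_def])
  have "(\<integral>y. cexp I \<phi> y \<partial>\<Omega>) = (\<integral>p. \<phi> ((\<lambda>(y, x). mix I y x) p) \<partial>(\<Omega> \<Otimes>\<^sub>M \<Omega>))"
    using PP.integral_fst'[OF int] by (simp add: cexp_def case_prod_beta')
  also have "\<dots> = (\<integral>z. \<phi> z \<partial>distr (\<Omega> \<Otimes>\<^sub>M \<Omega>) \<Omega> (\<lambda>(y, x). mix I y x))"
    by (rule integral_distr[OF measurable_mix meas, symmetric])
  finally show "(\<integral>y. cexp I \<phi> y \<partial>\<Omega>) = (\<integral>x. \<phi> x \<partial>\<Omega>)" by (simp only: distr_mix)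
qed

end

text \<open>The tower property at a single point \<open>y\<close> at which the slice of
  \<open>\<phi>\<close> is integrable. In this form the exceptional null set is that of the slices,
  which later serves finitely many index sets at once.\<close>

lemma
  assumes meas: "\<phi> \<in> borel_measurable \<Omega>" and "y \<in> space \<Omega>"
    and int: "integrable \<Omega> (\<lambda>x. \<phi> (mix (A \<inter> B) y x))"
  shows cexp_cexp: "cexp A (cexp B \<phi>) y = cexp (A \<inter> B) \<phi> y"
    and integrable_cexp_mix: "integrable \<Omega> (\<lambda>x. cexp B \<phi> (mix A y x))"
proof -
  have m: "(\<lambda>x. \<phi> (mix (A \<inter> B) y x)) \<in> borel_measurable \<Omega>"
    using measurable_compose[OF measurable_mix_right[OF assms(2)] meas] .
  have e: "cexp B \<phi> (mix A y x) = cexp B (\<lambda>x. \<phi> (mix (A \<inter> B) y x)) x" for x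
    unfolding cexp_def mix_mix ..
  show "cexp A (cexp B \<phi>) y = cexp (A \<inter> B) \<phi> y"
    unfolding cexp_def[of A] e integral_cexp[OF m int] by (simp add: cexp_def)
  show "integrable \<Omega> (\<lambda>x. cexp B \<phi> (mix A y x))"
    unfolding e by (rule integrable_cexp[OF m int])
qed

lemma AE_cexp_cexp:
  assumes "integrable \<Omega> \<phi>"
  shows "AE y in \<Omega>. cexp A (cexp B \<phi>) y = cexp (A \<inter> B) \<phi> y"
proof -
  have [measurable]: "\<phi> \<in> borel_measurable \<Omega>" using assms by auto
  have "AE y in \<Omega>. integrable \<Omega> (\<lambda>x. \<phi> (mix (A \<inter> B) y x))"
    by (rule AE_integrable_mix[OF _ assms]) measurable
  then show ?thesis
    by (rule AE_mp) (auto intro!: AE_I2 cexp_cexp)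
qed

lemma integral_mult_cexp:
  assumes W: "depends_on J W" "J \<subseteq> S" "J \<subseteq> I" and int: "integrable \<Omega> (\<lambda>x. W x * \<phi> x)"
  shows "(\<integral>x. W x * cexp I \<phi> x \<partial>\<Omega>) = (\<integral>x. W x * \<phi> x \<partial>\<Omega>)"
proof -
  have m: "(\<lambda>x. W x * \<phi> x) \<in> borel_measurable \<Omega>" using int by auto
  have e: "W x * cexp I \<phi> x = cexp I (\<lambda>x. W x * \<phi> x) x" for x
    unfolding cexp_def using mix_depends[OF W] by simp
  show ?thesis
    unfolding e by (rule integral_cexp[OF m int])
qed

lemma integrable_cexp_square:
  assumes meas: "\<phi> \<in> borel_measurable \<Omega>" and int: "integrable \<Omega> (\<lambda>x. (\<phi> x)\<^sup>2)"
  shows "integrable \<Omega> (\<lambda>x. (cexp I \<phi> x)\<^sup>2)"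
proof (rule Bochner_Integration.integrable_bound)
  have m2: "(\<lambda>x. (\<phi> x)\<^sup>2) \<in> borel_measurable \<Omega>" using meas by measurable
  show "integrable \<Omega> (cexp I (\<lambda>x. (\<phi> x)\<^sup>2))" by (rule integrable_cexp[OF m2 int])
  note [measurable] = measurable_cexp[OF meas]
  show "(\<lambda>x. (cexp I \<phi> x)\<^sup>2) \<in> borel_measurable \<Omega>" by measurable
  have i1: "integrable \<Omega> \<phi>" using meas int by (rule P.square_integrable_imp_integrable)
  have "AE y in \<Omega>. integrable \<Omega> (\<lambda>x. \<phi> (mix I y x))" by (rule AE_integrable_mix[OF meas i1])
  moreover have "AE y in \<Omega>. integrable \<Omega> (\<lambda>x. (\<phi> (mix I y x))\<^sup>2)" by (rule AE_integrable_mix[OF m2 int])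
  ultimately show "AE x in \<Omega>. norm ((cexp I \<phi> x)\<^sup>2) \<le> norm (cexp I (\<lambda>x. (\<phi> x)\<^sup>2) x)"
  proof eventually_elim
    case (elim y)
    \<comment> \<open>Conditional Jensen for the square is the nonnegativity of the variance of the
      slice through \<open>y\<close>.\<close>
    have "0 \<le> P.variance (\<lambda>x. \<phi> (mix I y x))" by (rule P.variance_positive)
    also have "\<dots> = cexp I (\<lambda>x. (\<phi> x)\<^sup>2) y - (cexp I \<phi> y)\<^sup>2"
      unfolding cexp_def by (rule P.variance_eq[OF elim])
    finally show ?case by simp
  qed
qed

text \<open>Resampling all coordinates of \<open>J\<close> turns \<open>f\<close> into its mean and
  leaves \<open>g\<close> unchanged, so \<open>cexp (- J) f\<close> is a constant that can be taken
  out.\<close>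

lemma integral_mult_disjoint:
  fixes f g :: "('i \<Rightarrow> 'a) \<Rightarrow> real"
  assumes f: "depends_on J f" "J \<subseteq> S" and g: "depends_on K g" "K \<subseteq> S" and "J \<inter> K = {}"
    and int: "integrable \<Omega> (\<lambda>x. g x * f x)"
  shows "(\<integral>x. f x * g x \<partial>\<Omega>) = (\<integral>x. f x \<partial>\<Omega>) * (\<integral>x. g x \<partial>\<Omega>)"
proof -
  have c: "cexp (- J) f y = (\<integral>x. f x \<partial>\<Omega>)" for y
    unfolding cexp_def using f
    by (intro Bochner_Integration.integral_cong refl depends_onD[OF f(1)]) (auto simp: mix_def)
  have "(\<integral>x. g x * f x \<partial>\<Omega>) = (\<integral>x. g x * cexp (- J) f x \<partial>\<Omega>)"
    using assms by (intro integral_mult_cexp[symmetric, OF g(1,2)]) auto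
  then show ?thesis by (simp add: c mult.commute)
qed

lemma distr_reindex:
  assumes "e permutes S"
  shows "distr \<Omega> \<Omega> (\<lambda>x. \<lambda>i\<in>S. x (e i)) = \<Omega>"
  unfolding \<Omega>_def using prob_Q permutes_inj_on[OF assms] permutes_in_image[OF assms]
  by (intro distr_PiM_reindex) auto

lemma measurable_reindex:
  assumes "e permutes S"
  shows "(\<lambda>x. \<lambda>i\<in>S. x (e i)) \<in> measurable \<Omega> \<Omega>"
proof -
  have "e i \<in> S" if "i \<in> S" for i using that permutes_in_image[OF assms] by simp
  then show ?thesis
    unfolding \<Omega>_def by (intro measurable_restrict measurable_component_singleton)
qed

lemma integral_reindex:
  fixes \<phi> :: "('i \<Rightarrow> 'a) \<Rightarrow> real"
  assumes "e permutes S" "\<phi> \<in> borel_measurable \<Omega>"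
  shows "(\<integral>x. \<phi> (\<lambda>i\<in>S. x (e i)) \<partial>\<Omega>) = (\<integral>x. \<phi> x \<partial>\<Omega>)"
  using integral_distr[OF measurable_reindex[OF assms(1)] assms(2)] by (simp only: distr_reindex[OF assms(1)])

lemma integrable_reindex:
  fixes \<phi> :: "('i \<Rightarrow> 'a) \<Rightarrow> real"
  assumes "e permutes S" "\<phi> \<in> borel_measurable \<Omega>"
  shows "integrable \<Omega> (\<lambda>x. \<phi> (\<lambda>i\<in>S. x (e i))) \<longleftrightarrow> integrable \<Omega> \<phi>"
  using integrable_distr_eq[OF measurable_reindex[OF assms(1)] assms(2)] by (simp only: distr_reindex[OF assms(1)])

end

section \<open>Enumeration and intersection of index sets\<close>

lemma ex_permutes_sorted_list_of_set:
  fixes J :: "nat set"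
  assumes "J \<subseteq> {1..n}" "card J = j"
  shows "\<exists>e. e permutes {1..n} \<and> (\<forall>k\<in>{1..j}. e k = sorted_list_of_set J ! (k - 1))"
proof -
  have fin: "finite J" using assms(1) by (rule finite_subset) simp
  have jn: "j \<le> n" using card_mono[OF _ assms(1)] assms(2) by simp
  define s where "s k = sorted_list_of_set J ! (k - 1)" for k
  have a: "bij_betw (\<lambda>i. sorted_list_of_set J ! i) {..<j} J"
    using assms(2) fin by (intro bij_betw_nth) auto
  have b: "bij_betw (\<lambda>k. k - 1) {1..j} {..<j}"
    by (rule bij_betw_byWitness[where f'=Suc]) auto
  have s: "bij_betw s {1..j} J"
    using bij_betw_trans[OF b a] by (simp add: s_def[abs_def] comp_def)
  have "card ({1..n} - {1..j}) = card ({1..n} - J)"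
    using assms fin jn by (simp add: card_Diff_subset)
  \<comment> \<open>Any bijection between the complements completes the enumeration of
    \<open>J\<close> to a permutation. As the product measure is invariant under permutations,
    statements on the first \<open>j\<close> coordinates will transfer to arbitrary
    \<open>J\<close>.\<close>
  then obtain g where g: "bij_betw g ({1..n} - {1..j}) ({1..n} - J)"
    using finite_same_card_bij[of "{1..n} - {1..j}" "{1..n} - J"] by auto
  define e where "e k = (if k \<in> {1..j} then s k else if k \<in> {1..n} then g k else k)" for k
  have "bij_betw e {1..j} J" using s by (subst bij_betw_cong[where g=s]) (auto simp: e_def)
  moreover have "bij_betw e ({1..n} - {1..j}) ({1..n} - J)"
    using g by (subst bij_betw_cong[where g=g]) (auto simp: e_def)
  ultimately have "bij_betw e ({1..j} \<union> ({1..n} - {1..j})) (J \<union> ({1..n} - J))"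
    by (rule bij_betw_combine) auto
  moreover have "{1..j} \<union> ({1..n} - {1..j}) = {1..n}" "J \<union> ({1..n} - J) = {1..n}"
    using assms(1) jn by auto
  ultimately have "e permutes {1..n}"
    using jn by (intro bij_imp_permutes) (auto simp: e_def)
  then show ?thesis by (intro exI[of _ e]) (auto simp: e_def s_def)
qed

lemma integrable_mult_of_squares:
  fixes f g :: "'a \<Rightarrow> real"
  assumes [measurable]: "f \<in> borel_measurable M" "g \<in> borel_measurable M"
    and "integrable M (\<lambda>x. (f x)\<^sup>2)" "integrable M (\<lambda>x. (g x)\<^sup>2)"
  shows "integrable M (\<lambda>x. f x * g x)"
proof (rule Bochner_Integration.integrable_bound)
  show "integrable M (\<lambda>x. (f x)\<^sup>2 + (g x)\<^sup>2)" using assms by simp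
  show "AE x in M. norm (f x * g x) \<le> norm ((f x)\<^sup>2 + (g x)\<^sup>2)"
  proof (rule AE_I2)
    fix x
    have "2 * (\<bar>f x\<bar> * \<bar>g x\<bar>) \<le> (f x)\<^sup>2 + (g x)\<^sup>2"
      using sum_squares_bound[of "\<bar>f x\<bar>" "\<bar>g x\<bar>"] by (simp add: mult.assoc)
    moreover have "0 \<le> \<bar>f x\<bar> * \<bar>g x\<bar>" by simp
    ultimately have "\<bar>f x\<bar> * \<bar>g x\<bar> \<le> (f x)\<^sup>2 + (g x)\<^sup>2" by linarith
    then show "norm (f x * g x) \<le> norm ((f x)\<^sup>2 + (g x)\<^sup>2)" by (simp add: abs_mult)
  qed
qed measurable

text \<open>A union bound over the elements of \<open>J\<close>, each of which lies in a proportion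
  j/N of the sets of size \<open>j\<close>. This is the small parameter j^2/N of the Rosenthal
  inequality.\<close>

lemma card_subsets_meeting_le:
  fixes J :: "nat set"
  assumes J: "J \<subseteq> {1..N}" "card J = j" "1 \<le> j"
  shows "real (card {J'\<in>{J. J \<subseteq> {1..N} \<and> card J = j}. J \<inter> J' \<noteq> {}})
    \<le> (real j)\<^sup>2 / real N * real (N choose j)"
proof -
  have fin: "finite J" using J(1) by (rule finite_subset) simp
  have N: "1 \<le> N" using J by (cases N) auto
  let ?A = "\<lambda>i. {J'. J' \<subseteq> {1..N} \<and> card J' = j \<and> i \<in> J'}"
  have cardA: "card (?A i) = (N - 1) choose (j - 1)" if "i \<in> {1..N}" for i
  proof -
    have "bij_betw (insert i) {K. K \<subseteq> {1..N} - {i} \<and> card K = j - 1} (?A i)"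
    proof (rule bij_betw_byWitness[where f'="\<lambda>J'. J' - {i}"])
      have finK: "finite K" if "K \<subseteq> {1..N}" for K using that by (rule finite_subset) simp
      show "insert i ` {K. K \<subseteq> {1..N} - {i} \<and> card K = j - 1} \<subseteq> ?A i"
      proof clarify
        fix K assume K: "K \<subseteq> {1..N} - {i}" "card K = j - 1"
        then have "card (insert i K) = Suc (j - 1)"
          using finK[of K] by (subst card_insert_disjoint) auto
        then show "insert i K \<subseteq> {1..N} \<and> card (insert i K) = j \<and> i \<in> insert i K"
          using K that J(3) by auto
      qed
      show "(\<lambda>J'. J' - {i}) ` ?A i \<subseteq> {K. K \<subseteq> {1..N} - {i} \<and> card K = j - 1}"
        using finK by (auto simp: card_Diff_singleton)
    qed auto
    then have "card (?A i) = card {K. K \<subseteq> {1..N} - {i} \<and> card K = j - 1}"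
      by (simp add: bij_betw_same_card)
    also have "\<dots> = (N - 1) choose (j - 1)"
      using that by (subst n_subsets) auto
    finally show ?thesis .
  qed
  have "card {J'\<in>{J. J \<subseteq> {1..N} \<and> card J = j}. J \<inter> J' \<noteq> {}} \<le> card (\<Union>i\<in>J. ?A i)"
  proof (rule card_mono)
    show "finite (\<Union>i\<in>J. ?A i)" by (rule finite_subset[of _ "Pow {1..N}"]) auto
  qed auto
  also have "\<dots> \<le> (\<Sum>i\<in>J. card (?A i))" by (rule card_UN_le[OF fin])
  also have "\<dots> = j * ((N - 1) choose (j - 1))"
    using cardA J by (subst sum.cong[OF refl, where h="\<lambda>_. (N - 1) choose (j - 1)"]) auto
  finally have "real (card {J'\<in>{J. J \<subseteq> {1..N} \<and> card J = j}. J \<inter> J' \<noteq> {}})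
      \<le> real (j * ((N - 1) choose (j - 1)))" by (simp only: of_nat_le_iff)
  also have "real N * real ((N - 1) choose (j - 1)) = real j * real (N choose j)"
    using times_binomial_minus1_eq[of j N] J(3) by (metis Suc_le_eq One_nat_def of_nat_mult)
  then have "real (j * ((N - 1) choose (j - 1))) = (real j)\<^sup>2 / real N * real (N choose j)"
    using N by (simp add: field_simps power2_eq_square)
  finally show ?thesis .
qed

section \<open>Degeneracy, orthogonality and Bessel's inequality for the projections of a symmetric
  kernel\<close>

locale hoeffding_kernel = iid_product Q "{1..N}" for Q :: "'a measure" and N :: nat +
  fixes m j :: nat and \<phi> :: "(nat \<Rightarrow> 'a) \<Rightarrow> real"
  assumes jm: "1 \<le> j" "j \<le> m" "m \<le> N"
    and \<phi>_meas: "\<phi> \<in> borel_measurable \<Omega>"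
    and \<phi>_sym: "e permutes {1..m} \<Longrightarrow> x \<in> space \<Omega> \<Longrightarrow> \<phi> (\<lambda>i\<in>{1..N}. x (e i)) = \<phi> x"
    and \<phi>_sq: "integrable \<Omega> (\<lambda>x. (\<phi> x)\<^sup>2)"
begin

declare One_nat_def[simp del]
declare \<phi>_meas[measurable]
lemmas [measurable] = measurable_cexp[OF \<phi>_meas]

text \<open>Inclusion-exclusion over conditional expectations, in the unscaled variables; for the
  kernel of the theorem, \<open>hoeffding_proj_eq_G\<close> identifies it with the projection
  \<open>hoeffding_proj\<close>.\<close>

definition G :: "(nat \<Rightarrow> 'a) \<Rightarrow> real" where
  "G z = (\<Sum>I\<in>Pow {1..j}. (- 1) ^ (j - card I) * cexp I \<phi> z)"

definition F :: "nat set \<Rightarrow> (nat \<Rightarrow> 'a) \<Rightarrow> real" where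
  "F J x = G (\<lambda>k. x (sorted_list_of_set J ! (k - 1)))"

lemma \<phi>_int: "integrable \<Omega> \<phi>"
  using \<phi>_meas \<phi>_sq by (rule P.square_integrable_imp_integrable)

lemma depends_cexp: "depends_on I (cexp I \<phi>)"
  unfolding depends_on_def cexp_def mix_def
  by (intro allI impI Bochner_Integration.integral_cong refl arg_cong[where f=\<phi>] restrict_ext) auto

lemma depends_G: "depends_on {1..j} G"
  unfolding depends_on_def G_def
proof (intro allI impI sum.cong refl arg_cong2[where f="(*)"])
  fix x y :: "nat \<Rightarrow> 'a" and I assume "\<forall>i\<in>{1..j}. x i = y i" "I \<in> Pow {1..j}"
  then show "cexp I \<phi> x = cexp I \<phi> y" by (intro depends_onD[OF depends_cexp]) auto
qed

lemma depends_F: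
  assumes "finite J" "card J = j"
  shows "depends_on J (F J)"
  unfolding depends_on_def F_def
proof (intro allI impI depends_onD[OF depends_G])
  fix x y :: "nat \<Rightarrow> 'a" and k assume "\<forall>i\<in>J. x i = y i" "k \<in> {1..j}"
  moreover have "sorted_list_of_set J ! (k - 1) \<in> J"
    using \<open>k \<in> {1..j}\<close> assms nth_mem[of "k - 1" "sorted_list_of_set J"] by auto
  ultimately show "x (sorted_list_of_set J ! (k - 1)) = y (sorted_list_of_set J ! (k - 1))" by blast
qed

lemma G_meas[measurable]: "G \<in> borel_measurable \<Omega>"
  unfolding G_def[abs_def] by measurable

lemma F_reindex:
  assumes "e permutes {1..N}" "\<forall>k\<in>{1..j}. e k = sorted_list_of_set J ! (k - 1)"
  shows "F J x = G (\<lambda>k\<in>{1..N}. x (e k))"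
  unfolding F_def using assms jm by (intro depends_onD[OF depends_G]) auto

lemma ex_reindex:
  assumes "J \<subseteq> {1..N}" "card J = j"
  obtains e where "e permutes {1..N}" "\<And>x. F J x = G (\<lambda>k\<in>{1..N}. x (e k))"
    "J \<subseteq> {1..m} \<longrightarrow> e permutes {1..m}" "e ` {1..j} = J"
proof -
  \<comment> \<open>When \<open>J\<close> lies in \<open>{1..m}\<close> the permutation is chosen
    inside \<open>{1..m}\<close>, since only such permutations leave \<open>\<phi>\<close>
    invariant.\<close>
  define n where "n = (if J \<subseteq> {1..m} then m else N)"
  have "J \<subseteq> {1..n}" using assms by (auto simp: n_def)
  from ex_permutes_sorted_list_of_set[OF this assms(2)] obtain e
    where e: "e permutes {1..n}" "\<forall>k\<in>{1..j}. e k = sorted_list_of_set J ! (k - 1)" by blast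
  have eN: "e permutes {1..N}"
    using e(1) by (rule permutes_subset) (use jm in \<open>auto simp: n_def split: if_splits\<close>)
  have "e k \<in> J" if "k \<in> {1..j}" for k
    using that e(2) assms nth_mem[of "k - 1" "sorted_list_of_set J"] finite_subset[OF assms(1)] by auto
  then have "e ` {1..j} \<subseteq> J" by auto
  moreover have "card (e ` {1..j}) = j"
    using permutes_inj[OF e(1)] by (subst card_image) (auto intro: inj_on_subset)
  ultimately have "e ` {1..j} = J"
    using assms finite_subset[OF assms(1)] by (intro card_subset_eq) auto
  with e eN show ?thesis by (intro that[of e] F_reindex) (auto simp: n_def)
qed

lemma F_meas:
  assumes "J \<subseteq> {1..N}" "card J = j"
  shows "F J \<in> borel_measurable \<Omega>"
proof -
  obtain e where e: "e permutes {1..N}" "\<And>x. F J x = G (\<lambda>k\<in>{1..N}. x (e k))"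
    "J \<subseteq> {1..m} \<longrightarrow> e permutes {1..m}" and im: "e ` {1..j} = J"
    by (rule ex_reindex[OF assms]) (rule that)
  have "F J = (\<lambda>x. G (\<lambda>k\<in>{1..N}. x (e k)))" by (rule ext) (rule e(2))
  then show ?thesis
    using measurable_compose[OF measurable_reindex[OF e(1)] G_meas] by simp
qed

lemma
  fixes f :: "real \<Rightarrow> real"
  assumes J: "J \<subseteq> {1..N}" "card J = j" and [measurable]: "f \<in> borel_measurable borel"
  shows integral_F: "(\<integral>x. f (F J x) \<partial>\<Omega>) = (\<integral>x. f (G x) \<partial>\<Omega>)"
    and integrable_F: "integrable \<Omega> (\<lambda>x. f (F J x)) \<longleftrightarrow> integrable \<Omega> (\<lambda>x. f (G x))"
proof -
  obtain e where e: "e permutes {1..N}" "\<And>x. F J x = G (\<lambda>k\<in>{1..N}. x (e k))"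
    "J \<subseteq> {1..m} \<longrightarrow> e permutes {1..m}" and im: "e ` {1..j} = J"
    by (rule ex_reindex[OF J]) (rule that)
  have m: "(\<lambda>x. f (G x)) \<in> borel_measurable \<Omega>" by measurable
  show "(\<integral>x. f (F J x) \<partial>\<Omega>) = (\<integral>x. f (G x) \<partial>\<Omega>)"
    unfolding e(2) by (rule integral_reindex[OF e(1) m])
  show "integrable \<Omega> (\<lambda>x. f (F J x)) \<longleftrightarrow> integrable \<Omega> (\<lambda>x. f (G x))"
    unfolding e(2) by (rule integrable_reindex[OF e(1) m])
qed

lemma all_moments_F:
  assumes J: "J \<subseteq> {1..N}" "card J = j" and "all_moments \<Omega> G"
  shows "all_moments \<Omega> (F J)"
  unfolding all_moments_def
proof (intro conjI allI F_meas[OF J])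
  fix n
  have "(\<lambda>y :: real. \<bar>y\<bar> ^ n) \<in> borel_measurable borel" by measurable
  from integrable_F[OF J this] show "integrable \<Omega> (\<lambda>x. \<bar>F J x\<bar> ^ n)"
    using assms(3) by (simp add: all_moments_def)
qed

lemma cexp_square: "integrable \<Omega> (\<lambda>x. (cexp I \<phi> x)\<^sup>2)"
  by (rule integrable_cexp_square[OF \<phi>_meas \<phi>_sq])

lemma G_square: "integrable \<Omega> (\<lambda>x. (G x)\<^sup>2)"
proof -
  have "(\<lambda>x. (G x)\<^sup>2) = (\<lambda>x. \<Sum>I\<in>Pow {1..j}. \<Sum>I'\<in>Pow {1..j}.
      (- 1) ^ (j - card I) * (- 1) ^ (j - card I') * (cexp I \<phi> x * cexp I' \<phi> x))"
    unfolding G_def power2_eq_square sum_product by (intro ext sum.cong refl) (simp add: mult_ac)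
  then show ?thesis
    by (auto intro!: Bochner_Integration.integrable_sum integrable_mult_right
        integrable_mult_of_squares cexp_square)
qed

text \<open>The terms for \<open>I\<close> and \<open>insert i I\<close> have opposite signs and
  cancel: \<open>W\<close> is free of coordinate \<open>i\<close>, so against \<open>W\<close> the
  conditional expectation given \<open>insert i I\<close> may be averaged over that coordinate and
  becomes the one given \<open>I\<close>.\<close>

lemma integral_G_degenerate:
  assumes i: "i \<in> {1..j}" and W: "depends_on ({1..N} - {i}) W" "W \<in> borel_measurable \<Omega>"
    and W2: "integrable \<Omega> (\<lambda>x. (W x)\<^sup>2)"
  shows "(\<integral>x. W x * G x \<partial>\<Omega>) = 0"
proof -
  define T where "T = {1..j} - {i}"
  have T: "insert i T = {1..j}" "i \<notin> T" "finite T" using i by (auto simp: T_def)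
  define c where "c I = (\<integral>x. W x * cexp I \<phi> x \<partial>\<Omega>)" for I
  have int: "integrable \<Omega> (\<lambda>x. W x * cexp I \<phi> x)" for I
    by (intro integrable_mult_of_squares W W2 cexp_square) measurable
  have c_insert: "c (insert i I) = c I" if "I \<in> Pow T" for I
  proof -
    have I: "({1..N} - {i}) \<inter> insert i I = I" using that jm by (auto simp: T_def)
    have "c (insert i I) = (\<integral>x. W x * cexp ({1..N} - {i}) (cexp (insert i I) \<phi>) x \<partial>\<Omega>)"
      unfolding c_def by (rule integral_mult_cexp[symmetric, OF W(1) _ _ int]) auto
    also have "\<dots> = c I"
      unfolding c_def
    proof (rule integral_cong_AE)
      have [measurable]: "cexp ({1..N} - {i}) (cexp (insert i I) \<phi>) \<in> borel_measurable \<Omega>"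
        by (intro measurable_cexp) measurable
      note [measurable] = W(2)
      show "(\<lambda>x. W x * cexp ({1..N} - {i}) (cexp (insert i I) \<phi>) x) \<in> borel_measurable \<Omega>"
        "(\<lambda>x. W x * cexp I \<phi> x) \<in> borel_measurable \<Omega>" by measurable
      show "AE x in \<Omega>. W x * cexp ({1..N} - {i}) (cexp (insert i I) \<phi>) x = W x * cexp I \<phi> x"
        using AE_cexp_cexp[OF \<phi>_int, of "{1..N} - {i}" "insert i I"] unfolding I by auto
    qed
    finally show ?thesis .
  qed
  have "(\<integral>x. W x * G x \<partial>\<Omega>) = (\<integral>x. (\<Sum>I\<in>Pow {1..j}. (- 1) ^ (j - card I) * (W x * cexp I \<phi> x)) \<partial>\<Omega>)"
    unfolding G_def sum_distrib_left by (intro Bochner_Integration.integral_cong sum.cong) auto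
  also have "\<dots> = (\<Sum>I\<in>Pow {1..j}. (- 1) ^ (j - card I) * c I)"
    unfolding c_def using int by (subst Bochner_Integration.integral_sum) auto
  also have "\<dots> = (\<Sum>I\<in>Pow T. (- 1) ^ (j - card I) * c I + (- 1) ^ (j - card (insert i I)) * c (insert i I))"
    unfolding T(1)[symmetric] by (rule sum_Pow_insert[OF T(3,2)])
  also have "\<dots> = 0"
  proof (intro sum.neutral ballI)
    fix I assume I: "I \<in> Pow T"
    then have "finite I" "i \<notin> I" using T finite_subset by auto
    then have card: "card (insert i I) = Suc (card I)" by simp
    moreover have "card (insert i I) \<le> card {1..j}" using I T by (intro card_mono) auto
    ultimately have "j - card I = Suc (j - card (insert i I))" by simp
    then show "(- 1) ^ (j - card I) * c I + (- 1) ^ (j - card (insert i I)) * c (insert i I) = 0"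
      using c_insert[OF I] by simp
  qed
  finally show ?thesis .
qed

lemma integral_F_degenerate:
  assumes J: "J \<subseteq> {1..N}" "card J = j" and i: "i \<in> J"
    and W: "depends_on ({1..N} - {i}) W" "W \<in> borel_measurable \<Omega>" "integrable \<Omega> (\<lambda>x. (W x)\<^sup>2)"
  shows "(\<integral>x. F J x * W x \<partial>\<Omega>) = 0"
proof -
  obtain e where e: "e permutes {1..N}" "\<And>x. F J x = G (\<lambda>k\<in>{1..N}. x (e k))"
    "J \<subseteq> {1..m} \<longrightarrow> e permutes {1..m}" and im: "e ` {1..j} = J"
    by (rule ex_reindex[OF J]) (rule that)
  define e' where "e' = inv e"
  have e': "e' permutes {1..N}" unfolding e'_def by (rule permutes_inv[OF e(1)])
  have inv: "e (e' k) = k" "e' (e k) = k" for k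
    unfolding e'_def using permutes_inverses[OF e(1)] by auto
  have eN: "e k \<in> {1..N} \<longleftrightarrow> k \<in> {1..N}" "e' k \<in> {1..N} \<longleftrightarrow> k \<in> {1..N}" for k
    using permutes_in_image[OF e(1)] permutes_in_image[OF e'] by auto
  \<comment> \<open>Pulling \<open>W\<close> back by the inverse permutation lets one change of
    variables carry \<open>F J\<close> to \<open>G\<close>; the free coordinate \<open>i\<close>
    becomes its position \<open>l\<close> in the enumeration.\<close>
  define W' where "W' x = W (\<lambda>k\<in>{1..N}. x (e' k))" for x
  have W'_meas: "W' \<in> borel_measurable \<Omega>"
    unfolding W'_def[abs_def] using measurable_compose[OF measurable_reindex[OF e'] W(2)] .
  have m2: "(\<lambda>x. (W x)\<^sup>2) \<in> borel_measurable \<Omega>" using W(2) by measurable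
  have m: "(\<lambda>x. W' x * G x) \<in> borel_measurable \<Omega>" using W'_meas by measurable
  obtain l where l: "l \<in> {1..j}" "e l = i" using im i by auto
  have dep: "depends_on ({1..N} - {l}) W'"
    unfolding depends_on_def W'_def
  proof (intro allI impI depends_onD[OF W(1)])
    fix x y :: "nat \<Rightarrow> 'a" and k assume xy: "\<forall>k\<in>{1..N} - {l}. x k = y k" and k: "k \<in> {1..N} - {i}"
    have "e' k \<in> {1..N} - {l}" using k eN inv l by auto
    then show "(\<lambda>k\<in>{1..N}. x (e' k)) k = (\<lambda>k\<in>{1..N}. y (e' k)) k" using k xy by auto
  qed
  have "(\<integral>x. F J x * W x \<partial>\<Omega>) = (\<integral>x. W' (\<lambda>k\<in>{1..N}. x (e k)) * G (\<lambda>k\<in>{1..N}. x (e k)) \<partial>\<Omega>)"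
  proof (rule Bochner_Integration.integral_cong[OF refl])
    fix x assume x: "x \<in> space \<Omega>"
    have "(\<lambda>k\<in>{1..N}. (\<lambda>k\<in>{1..N}. x (e k)) (e' k)) = x"
    proof (rule ext)
      fix k
      show "(\<lambda>k\<in>{1..N}. (\<lambda>k\<in>{1..N}. x (e k)) (e' k)) k = x k"
      proof (cases "k \<in> {1..N}")
        case True
        then have "e' k \<in> {1..N}" using eN by simp
        with True show ?thesis by (simp only: restrict_apply' inv)
      next
        case False
        have "x k = undefined" by (rule PiE_arb[OF x[unfolded space_\<Omega>] False])
        with False show ?thesis by (simp only: restrict_apply if_False)
      qed
    qed
    then show "F J x * W x = W' (\<lambda>k\<in>{1..N}. x (e k)) * G (\<lambda>k\<in>{1..N}. x (e k))"
      unfolding W'_def e(2) by simp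
  qed
  also have "\<dots> = (\<integral>x. W' x * G x \<partial>\<Omega>)" by (rule integral_reindex[OF e(1) m])
  also have "\<dots> = 0"
  proof (rule integral_G_degenerate[OF l(1) dep W'_meas])
    show "integrable \<Omega> (\<lambda>x. (W' x)\<^sup>2)"
      unfolding W'_def using integrable_reindex[OF e' m2] W(3) by simp
  qed
  finally show ?thesis .
qed

lemma F_square:
  assumes "J \<subseteq> {1..N}" "card J = j"
  shows "integrable \<Omega> (\<lambda>x. (F J x)\<^sup>2)"
  using integrable_F[OF assms, of "\<lambda>y. y\<^sup>2"] G_square by simp

lemma integral_F_orthogonal:
  assumes J: "J \<subseteq> {1..N}" "card J = j" and J': "J' \<subseteq> {1..N}" "card J' = j" and "J \<noteq> J'"
  shows "(\<integral>x. F J x * F J' x \<partial>\<Omega>) = 0"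
proof -
  have fin: "finite J" "finite J'" using J J' by (auto intro: finite_subset)
  have "\<not> J \<subseteq> J'" using card_subset_eq[OF fin(2), of J] J J' assms(5) by auto
  then obtain i where i: "i \<in> J" "i \<notin> J'" by auto
  show ?thesis
    by (intro integral_F_degenerate[OF J i(1)] F_meas[OF J'] F_square[OF J']
        depends_on_mono[OF depends_F[OF fin(2) J'(2)]]) (use i J' in auto)
qed

lemma integral_\<phi>_G: "(\<integral>x. \<phi> x * G x \<partial>\<Omega>) = (\<integral>x. (G x)\<^sup>2 \<partial>\<Omega>)"
proof -
  have int: "integrable \<Omega> (\<lambda>x. G x * cexp I \<phi> x)" for I
    by (intro integrable_mult_of_squares G_square cexp_square) measurable
  have "(\<integral>x. (G x)\<^sup>2 \<partial>\<Omega>) = (\<integral>x. (\<Sum>I\<in>Pow {1..j}. (- 1) ^ (j - card I) * (G x * cexp I \<phi> x)) \<partial>\<Omega>)"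
    unfolding power2_eq_square by (subst (2) G_def, subst sum_distrib_left) (simp add: mult_ac)
  also have "\<dots> = (\<Sum>I\<in>Pow {1..j}. (- 1) ^ (j - card I) * (\<integral>x. G x * cexp I \<phi> x \<partial>\<Omega>))"
    using int by (subst Bochner_Integration.integral_sum) auto
  also have "\<dots> = (\<Sum>I\<in>{{1..j}}. (- 1) ^ (j - card I) * (\<integral>x. G x * cexp I \<phi> x \<partial>\<Omega>))"
  proof (rule sum.mono_neutral_right)
    show "\<forall>I\<in>Pow {1..j} - {{1..j}}. (- 1) ^ (j - card I) * (\<integral>x. G x * cexp I \<phi> x \<partial>\<Omega>) = 0"
    proof
      fix I assume I: "I \<in> Pow {1..j} - {{1..j}}"
      then obtain i where i: "i \<in> {1..j}" "i \<notin> I" by blast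
      have "depends_on ({1..N} - {i}) (cexp I \<phi>)"
        by (rule depends_on_mono[OF depends_cexp]) (use I i jm in auto)
      from integral_G_degenerate[OF i(1) this _ cexp_square]
      show "(- 1) ^ (j - card I) * (\<integral>x. G x * cexp I \<phi> x \<partial>\<Omega>) = 0"
        by (simp add: mult.commute)
    qed
  qed auto
  also have "\<dots> = (\<integral>x. G x * cexp {1..j} \<phi> x \<partial>\<Omega>)" by simp
  also have "\<dots> = (\<integral>x. G x * \<phi> x \<partial>\<Omega>)"
    using jm by (intro integral_mult_cexp[OF depends_G] integrable_mult_of_squares G_square \<phi>_sq) auto
  finally show ?thesis by (simp add: mult.commute)
qed

lemma integral_\<phi>_F:
  assumes J: "J \<subseteq> {1..m}" "card J = j"
  shows "(\<integral>x. \<phi> x * F J x \<partial>\<Omega>) = (\<integral>x. (G x)\<^sup>2 \<partial>\<Omega>)"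
proof -
  have JN: "J \<subseteq> {1..N}" using J jm by auto
  obtain e where e: "e permutes {1..N}" "\<And>x. F J x = G (\<lambda>k\<in>{1..N}. x (e k))"
    "J \<subseteq> {1..m} \<longrightarrow> e permutes {1..m}" and im: "e ` {1..j} = J"
    by (rule ex_reindex[OF JN J(2)]) (rule that)
  have m: "(\<lambda>x. \<phi> x * G x) \<in> borel_measurable \<Omega>" by measurable
  have "(\<integral>x. \<phi> x * F J x \<partial>\<Omega>) = (\<integral>x. \<phi> (\<lambda>k\<in>{1..N}. x (e k)) * G (\<lambda>k\<in>{1..N}. x (e k)) \<partial>\<Omega>)"
    using e J \<phi>_sym by (intro Bochner_Integration.integral_cong) auto
  also have "\<dots> = (\<integral>x. \<phi> x * G x \<partial>\<Omega>)" by (rule integral_reindex[OF e(1) m])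
  finally show ?thesis by (simp only: integral_\<phi>_G)
qed

text \<open>Bessel's inequality for the orthogonal system of the \<open>F J\<close> with \<open>J \<subseteq> {1..m}\<close>.\<close>
lemma binomial_G_square_le: "real (m choose j) * (\<integral>x. (G x)\<^sup>2 \<partial>\<Omega>) \<le> (\<integral>x. (\<phi> x)\<^sup>2 \<partial>\<Omega>)"
proof -
  define \<K> where "\<K> = {J. J \<subseteq> {1..m} \<and> card J = j}"
  have finK: "finite \<K>" by (rule finite_subset[of _ "Pow {1..m}"]) (auto simp: \<K>_def)
  have K: "J \<subseteq> {1..m}" "J \<subseteq> {1..N}" "card J = j" if "J \<in> \<K>" for J using that jm by (auto simp: \<K>_def)
  let ?s = "\<integral>x. (G x)\<^sup>2 \<partial>\<Omega>"
  have i1: "integrable \<Omega> (\<lambda>x. \<phi> x * F J x)" if "J \<in> \<K>" for J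
    using K[OF that] by (intro integrable_mult_of_squares \<phi>_sq F_square F_meas \<phi>_meas)
  have i2: "integrable \<Omega> (\<lambda>x. F J x * F J' x)" if "J \<in> \<K>" "J' \<in> \<K>" for J J'
    using K that by (intro integrable_mult_of_squares F_square F_meas) auto
  have i3: "integrable \<Omega> (\<lambda>x. (\<Sum>J\<in>\<K>. 2 * (\<phi> x * F J x)))"
    "integrable \<Omega> (\<lambda>x. (\<Sum>J\<in>\<K>. \<Sum>J'\<in>\<K>. F J x * F J' x))"
    using i1 i2 by (auto intro!: Bochner_Integration.integrable_sum)
  \<comment> \<open>Subtracting all \<open>F J\<close> lowers the mean square by exactly
    \<open>card \<K> * ?s\<close>: the cross term is twice this amount and the square of the sum, by
    orthogonality, once.\<close>
  have "0 \<le> (\<integral>x. (\<phi> x - (\<Sum>J\<in>\<K>. F J x))\<^sup>2 \<partial>\<Omega>)" by simp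
  also have "\<dots> = (\<integral>x. (\<phi> x)\<^sup>2 - (\<Sum>J\<in>\<K>. 2 * (\<phi> x * F J x)) + (\<Sum>J\<in>\<K>. \<Sum>J'\<in>\<K>. F J x * F J' x) \<partial>\<Omega>)"
    by (intro Bochner_Integration.integral_cong refl)
      (simp add: power2_diff sum_distrib_left power2_eq_square sum_product algebra_simps)
  also have "\<dots> = (\<integral>x. (\<phi> x)\<^sup>2 \<partial>\<Omega>) - (\<integral>x. (\<Sum>J\<in>\<K>. 2 * (\<phi> x * F J x)) \<partial>\<Omega>)
      + (\<integral>x. (\<Sum>J\<in>\<K>. \<Sum>J'\<in>\<K>. F J x * F J' x) \<partial>\<Omega>)"
    using i3 \<phi>_sq by simp
  also have "(\<integral>x. (\<Sum>J\<in>\<K>. 2 * (\<phi> x * F J x)) \<partial>\<Omega>) = (\<Sum>J\<in>\<K>. 2 * ?s)"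
    using i1 integral_\<phi>_F K by (subst Bochner_Integration.integral_sum) auto
  also have "(\<integral>x. (\<Sum>J\<in>\<K>. \<Sum>J'\<in>\<K>. F J x * F J' x) \<partial>\<Omega>) = (\<Sum>J\<in>\<K>. \<Sum>J'\<in>\<K>. (\<integral>x. F J x * F J' x \<partial>\<Omega>))"
    using i2 by (subst Bochner_Integration.integral_sum)
      (auto intro!: Bochner_Integration.integrable_sum sum.cong Bochner_Integration.integral_sum)
  also have "\<dots> = (\<Sum>J\<in>\<K>. \<Sum>J'\<in>\<K>. if J' = J then ?s else 0)"
  proof (intro sum.cong refl)
    fix J J' assume "J \<in> \<K>" "J' \<in> \<K>"
    then show "(\<integral>x. F J x * F J' x \<partial>\<Omega>) = (if J' = J then ?s else 0)"
      using integral_F_orthogonal[of J J'] integral_F[of J "\<lambda>y. y\<^sup>2"] K by (auto simp: power2_eq_square)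
  qed
  also have "\<dots> = (\<Sum>J\<in>\<K>. ?s)" using finK by (intro sum.cong refl) simp
  finally have "real (card \<K>) * ?s \<le> (\<integral>x. (\<phi> x)\<^sup>2 \<partial>\<Omega>)" by simp
  moreover have "card \<K> = m choose j" using n_subsets[of "{1..m}" j] by (simp add: \<K>_def)
  ultimately show ?thesis by simp
qed

end

section \<open>Tail bounds\<close>

context hoeffding_kernel
begin

definition V :: "(nat \<Rightarrow> 'a) \<Rightarrow> real" where
  "V x = sqrt (real (m choose j)) / sqrt (real (N choose j)) * (\<Sum>J\<in>{J. J \<subseteq> {1..N} \<and> card J = j}. F J x)"

lemma sum_F_moment_le:
  assumes am: "all_moments \<Omega> G" and p: "1 \<le> p"
    and w: "(\<integral>x. ((G x)\<^sup>2) ^ p \<partial>\<Omega>) \<le> w"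
    and A: "real p ^ p * ((real j)\<^sup>2 / real N) ^ (p - 1) * w \<le> A ^ p" "0 \<le> A"
  shows "(\<integral>x. (\<Sum>J\<in>{J. J \<subseteq> {1..N} \<and> card J = j}. F J x) ^ (2 * p) \<partial>\<Omega>)
    \<le> ((8 * real p) ^ j * real (N choose j) * (exp 1 * (\<integral>x. (G x)\<^sup>2 \<partial>\<Omega>) + A)) ^ p"
proof -
  define \<J> where "\<J> = {J. J \<subseteq> {1..N} \<and> card J = j}"
  have fin\<J>: "finite \<J>" by (rule finite_subset[of _ "Pow {1..N}"]) (auto simp: \<J>_def)
  have card\<J>: "card \<J> = N choose j" using n_subsets[of "{1..N}" j] by (simp add: \<J>_def)
  have pos: "0 < N choose j" using jm by (intro zero_less_binomial) auto
  have ne: "\<J> \<noteq> {}" using card\<J> pos by auto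
  have J: "J \<subseteq> {1..N}" "card J = j" "finite J" if "J \<in> \<J>" for J
    using that by (auto simp: \<J>_def intro: finite_subset)
  have amF: "all_moments \<Omega> (F J)" if "J \<in> \<J>" for J using J that am by (intro all_moments_F)
  have depF: "depends_on K (F J)" if "J \<in> \<J>" "J \<subseteq> K" for J K
    using that by (intro depends_on_mono[OF depends_F] J)
  have "(\<integral>x. (\<Sum>J\<in>\<J>. F J x) ^ (2 * p) \<partial>\<Omega>)
      \<le> (8 * real p) ^ (j * p) * (\<integral>x. (\<Sum>J\<in>\<J>. (F J x)\<^sup>2) ^ p \<partial>\<Omega>)"
  proof (rule P.degenerate_moment_le[OF _ p \<J>_def amF])
    fix i J and b :: "nat set \<Rightarrow> real" assume Ji: "J \<in> \<J>" "i \<in> J"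
    define W where "W x = (\<Sum>J'\<in>{J'\<in>\<J>. i \<notin> J'}. b J' * F J' x) ^ (2 * p - 1)" for x
    have "all_moments \<Omega> (\<lambda>x. (W x)\<^sup>2)" "all_moments \<Omega> W"
      unfolding W_def[abs_def] using amF
      by (auto intro!: all_moments_power P.all_moments_sum all_moments_cmult)
    moreover have "depends_on ({1..N} - {i}) W"
      unfolding W_def[abs_def]
    proof (rule depends_on_compose, rule depends_on_sum)
      fix J' assume "J' \<in> {J'\<in>\<J>. i \<notin> J'}"
      then show "depends_on ({1..N} - {i}) (\<lambda>x. b J' * F J' x)"
        using J by (intro depends_on_compose[where g="\<lambda>z. b J' * z"] depF) auto
    qed
    ultimately have "(\<integral>x. F J x * W x \<partial>\<Omega>) = 0"
      using Ji J by (intro integral_F_degenerate[of J i]) (auto intro: all_moments_integrable all_moments_measurable)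
    then show "(\<integral>x. F J x * (\<Sum>J'\<in>{J'\<in>\<J>. i \<notin> J'}. b J' * F J' x) ^ (2 * p - 1) \<partial>\<Omega>) = 0"
      by (simp only: W_def)
  qed simp_all
  also have "(\<integral>x. (\<Sum>J\<in>\<J>. (F J x)\<^sup>2) ^ p \<partial>\<Omega>) =
      real (N choose j) ^ p * (\<integral>x. ((\<Sum>J\<in>\<J>. (F J x)\<^sup>2) / real (card \<J>)) ^ p \<partial>\<Omega>)"
    using pos by (simp add: card\<J> power_divide)
  also have "(\<integral>x. ((\<Sum>J\<in>\<J>. (F J x)\<^sup>2) / real (card \<J>)) ^ p \<partial>\<Omega>)
      \<le> (exp 1 * (\<integral>x. (G x)\<^sup>2 \<partial>\<Omega>) + A) ^ p"
  proof (rule P.positive_ustatistic_moment_le[OF fin\<J> ne p, where w=w and \<delta>="(real j)\<^sup>2 / real N"])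
    fix J assume JJ: "J \<in> \<J>"
    show "all_moments \<Omega> (\<lambda>x. (F J x)\<^sup>2)" using amF[OF JJ] by (rule all_moments_power)
    have "(\<integral>x. (F J x)\<^sup>2 \<partial>\<Omega>) = (\<integral>x. (G x)\<^sup>2 \<partial>\<Omega>)"
      by (rule integral_F[OF J(1,2)[OF JJ]]) measurable
    then show "(\<integral>x. (F J x)\<^sup>2 \<partial>\<Omega>) \<le> (\<integral>x. (G x)\<^sup>2 \<partial>\<Omega>)" by simp
    have "(\<integral>x. ((F J x)\<^sup>2) ^ p \<partial>\<Omega>) = (\<integral>x. ((G x)\<^sup>2) ^ p \<partial>\<Omega>)"
      by (rule integral_F[OF J(1,2)[OF JJ]]) measurable
    then show "(\<integral>x. ((F J x)\<^sup>2) ^ p \<partial>\<Omega>) \<le> w" using w by simp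
    show "real (card {J'\<in>\<J>. J \<inter> J' \<noteq> {}}) \<le> (real j)\<^sup>2 / real N * real (card \<J>)"
      unfolding card\<J> unfolding \<J>_def by (rule card_subsets_meeting_le[OF J(1,2)[OF JJ] jm(1)])
    fix n
    let ?T = "\<lambda>x. (\<Sum>J'\<in>{J'\<in>\<J>. J \<inter> J' = {}}. (F J' x)\<^sup>2) ^ n"
    show "(\<integral>x. (F J x)\<^sup>2 * ?T x \<partial>\<Omega>) = (\<integral>x. (F J x)\<^sup>2 \<partial>\<Omega>) * (\<integral>x. ?T x \<partial>\<Omega>)"
    proof (rule integral_mult_disjoint[where J=J and K="{1..N} - J"])
      show "depends_on J (\<lambda>x. (F J x)\<^sup>2)" using JJ by (intro depends_on_compose[where g="\<lambda>z. z\<^sup>2"] depF) auto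
      show "depends_on ({1..N} - J) ?T"
      proof (rule depends_on_compose, rule depends_on_sum)
        fix J' assume J': "J' \<in> {J'\<in>\<J>. J \<inter> J' = {}}"
        then have "J' \<subseteq> {1..N} - J" using J[of J'] by auto
        then show "depends_on ({1..N} - J) (\<lambda>x. (F J' x)\<^sup>2)"
          using J' by (intro depends_on_compose[where g="\<lambda>z. z\<^sup>2"] depF) auto
      qed
      show "integrable \<Omega> (\<lambda>x. ?T x * (F J x)\<^sup>2)"
        using JJ amF
        by (intro all_moments_integrable all_moments_mult all_moments_power P.all_moments_sum) auto
    qed (use J[OF JJ] in auto)
  qed (use A in auto)
  finally show ?thesis
    using p by (simp add: \<J>_def power_mult_distrib power_mult mult_left_mono mult.assoc)
qed

text \<open>
  Markov's inequality for the moment of order \<open>2 * p\<close>, where \<open>r \<le> 2 * p \<le> 2 * r\<close>; the hypotheses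
  bound the moment by \<open>(t / e) ^ (2 * p)\<close>.
\<close>
lemma V_tail:
  assumes am: "all_moments \<Omega> G" and p: "1 \<le> p" "r \<le> 2 * real p" "real p \<le> r"
    and w: "(\<integral>x. ((G x)\<^sup>2) ^ p \<partial>\<Omega>) \<le> w"
    and A: "real p ^ p * ((real j)\<^sup>2 / real N) ^ (p - 1) * w \<le> A ^ p" "0 \<le> A"
      "A \<le> 2 * (\<integral>x. (G x)\<^sup>2 \<partial>\<Omega>) + A'"
    and t: "0 < t"
    and gauss: "(1024 * r) ^ j * (\<integral>x. (\<phi> x)\<^sup>2 \<partial>\<Omega>) \<le> t\<^sup>2"
    and poisson: "real (m choose j) * (8 * r) ^ j * (16 * A') \<le> t\<^sup>2"
  shows "measure \<Omega> {x\<in>space \<Omega>. t \<le> \<bar>V x\<bar>} \<le> exp (- r)"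
proof -
  define S where "S x = (\<Sum>J\<in>{J. J \<subseteq> {1..N} \<and> card J = j}. F J x)" for x
  define s where "s = (\<integral>x. (G x)\<^sup>2 \<partial>\<Omega>)"
  define C where "C = real (m choose j)"
  define L where "L = real (N choose j)"
  have L: "0 < L" unfolding L_def using jm by (simp add: zero_less_binomial)
  have C: "0 \<le> C" by (simp add: C_def)
  have s: "0 \<le> s" "C * s \<le> (\<integral>x. (\<phi> x)\<^sup>2 \<partial>\<Omega>)"
    using binomial_G_square_le by (auto simp: s_def C_def)
  have amS: "all_moments \<Omega> S"
    unfolding S_def[abs_def] using am by (intro P.all_moments_sum all_moments_F) auto
  have V2: "(V x) ^ (2 * p) = (C / L) ^ p * S x ^ (2 * p)" for x
    using C L by (simp add: V_def S_def C_def L_def power_mult power_mult_distrib power_divide)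
  have amV: "all_moments \<Omega> (\<lambda>x. (C / L) ^ p * S x ^ (2 * p))"
    by (intro all_moments_cmult all_moments_power amS)
  have "(\<integral>x. V x ^ (2 * p) \<partial>\<Omega>) = (C / L) ^ p * (\<integral>x. S x ^ (2 * p) \<partial>\<Omega>)"
    unfolding V2 by simp
  also have "\<dots> \<le> (C / L) ^ p * ((8 * real p) ^ j * L * (exp 1 * s + A)) ^ p"
    unfolding S_def L_def s_def
    by (intro mult_left_mono sum_F_moment_le[OF am p(1) w A(1,2)]) (auto simp: C_def)
  also have "\<dots> = (C * (8 * real p) ^ j * (exp 1 * s + A)) ^ p"
  proof -
    have "(C / L) * (x * L * y) = C * x * y" for x y using L by simp
    then show ?thesis by (simp only: power_mult_distrib[symmetric, of "C / L"])
  qed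
  also have "\<dots> \<le> (t\<^sup>2 / exp 2) ^ p"
  proof (rule power_mono)
    have r1: "1 \<le> r" using p by linarith
    have "C * (8 * real p) ^ j * (exp 1 * s + A) \<le> C * (8 * r) ^ j * (5 * s + A')"
    proof (rule mult_mono)
      show "C * (8 * real p) ^ j \<le> C * (8 * r) ^ j" using C p by (intro mult_left_mono power_mono) auto
      have "exp 1 * s \<le> 3 * s" using s e_less_272 by (intro mult_right_mono) auto
      then show "exp 1 * s + A \<le> 5 * s + A'" using A(3) by (simp add: s_def)
    qed (use C s A r1 in auto)
    also have "\<dots> = 5 * ((8 * r) ^ j * (C * s)) + C * (8 * r) ^ j * A'"
      by (simp add: algebra_simps)
    also have "\<dots> \<le> t\<^sup>2 / 16 + t\<^sup>2 / 16"
    proof (rule add_mono)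
      \<comment> \<open>The coefficient 5 is 3 + 2, from \<open>exp 1 \<le> 3\<close> and from the
        multiple 2 of the mean allowed in \<open>A\<close>. Staying below a sixteenth of the square
        of \<open>t\<close> requires a factor of at least 80; 128 is placed under the power
        \<open>j\<close>, and 128 * 8 = 1024 is the constant of the Gaussian term.\<close>
      have "128 * ((8 * r) ^ j * (C * s)) \<le> 128 ^ j * ((8 * r) ^ j * (C * s))"
        using jm C s r1 self_le_power[of "128::real" j] by (intro mult_right_mono) auto
      also have "\<dots> = (128 * (8 * r)) ^ j * (C * s)"
        by (subst power_mult_distrib) (simp only: mult.assoc)
      also have "\<dots> = (1024 * r) ^ j * (C * s)" by simp
      also have "\<dots> \<le> (1024 * r) ^ j * (\<integral>x. (\<phi> x)\<^sup>2 \<partial>\<Omega>)"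
        using s r1 by (intro mult_left_mono) auto
      finally have "128 * ((8 * r) ^ j * (C * s)) \<le> t\<^sup>2" using gauss by linarith
      moreover have "0 \<le> (8 * r) ^ j * (C * s)" using C s r1 by simp
      ultimately show "5 * ((8 * r) ^ j * (C * s)) \<le> t\<^sup>2 / 16" by linarith
      show "C * (8 * r) ^ j * A' \<le> t\<^sup>2 / 16" using poisson by (simp add: C_def)
    qed
    also have "\<dots> = t\<^sup>2 / 8" by simp
    \<comment> \<open>The two sixteenths add up to an eighth because \<open>exp 2 < 8\<close>; after
      the power \<open>p\<close> this yields the decay \<open>exp (- (2 * real p))\<close>.\<close>
    also have "\<dots> \<le> t\<^sup>2 / exp 2"
    proof -
      have "exp (2::real) = exp 1 * exp 1" by (simp add: exp_add[symmetric])
      also have "\<dots> \<le> (272 / 100) * (272 / 100)" using e_less_272 by (intro mult_mono) auto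
      finally show ?thesis by (intro divide_left_mono) auto
    qed
    finally show "C * (8 * real p) ^ j * (exp 1 * s + A) \<le> t\<^sup>2 / exp 2" .
    show "0 \<le> C * (8 * real p) ^ j * (exp 1 * s + A)" using C s A by simp
  qed
  also have "\<dots> = t ^ (2 * p) * exp (- (2 * real p))"
  proof -
    have "exp (- (2 * real p)) = inverse (exp 2 ^ p)"
      by (simp add: exp_minus exp_of_nat_mult[symmetric] mult.commute)
    then show ?thesis by (simp add: power_mult power_mult_distrib power_inverse divide_inverse)
  qed
  also have "\<dots> \<le> t ^ (2 * p) * exp (- r)"
    using t p by (intro mult_left_mono) auto
  finally have mom: "(\<integral>x. V x ^ (2 * p) \<partial>\<Omega>) \<le> t ^ (2 * p) * exp (- r)" .
  have [measurable]: "V \<in> borel_measurable \<Omega>"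
    using all_moments_measurable[OF amS] unfolding V_def[abs_def] S_def[symmetric] by measurable
  have iV: "integrable \<Omega> (\<lambda>x. V x ^ (2 * p))" unfolding V2 by (rule all_moments_integrable[OF amV])
  have "{x\<in>space \<Omega>. t \<le> \<bar>V x\<bar>} \<subseteq> {x\<in>space \<Omega>. t ^ (2 * p) \<le> V x ^ (2 * p)}"
  proof clarify
    fix x assume "t \<le> \<bar>V x\<bar>"
    then have "t ^ (2 * p) \<le> \<bar>V x\<bar> ^ (2 * p)" using t by (intro power_mono) auto
    then show "t ^ (2 * p) \<le> V x ^ (2 * p)" by (simp add: power_even_abs)
  qed
  then have "measure \<Omega> {x\<in>space \<Omega>. t \<le> \<bar>V x\<bar>} \<le> measure \<Omega> {x\<in>space \<Omega>. t ^ (2 * p) \<le> V x ^ (2 * p)}"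
    by (intro P.finite_measure_mono) measurable
  also have "\<dots> \<le> (\<integral>x. V x ^ (2 * p) \<partial>\<Omega>) / t ^ (2 * p)"
    using t by (intro integral_Markov_inequality_measure[OF iV, where A="{}"]) auto
  also have "\<dots> \<le> exp (- r)" using mom t by (simp add: divide_le_eq mult.commute)
  finally show ?thesis .
qed

text \<open>Half of \<open>r\<close>, rounded up. The bound \<open>real p \<le> r\<close> follows
  from \<open>r / 2 + 1 \<le> r\<close>, which is how the threshold 2 for the exponent
  enters.\<close>

lemma obtain_moment_order:
  fixes r :: real
  assumes "2 \<le> r"
  obtains p :: nat where "1 \<le> p" "r \<le> 2 * real p" "real p \<le> r"
proof
  have c: "r / 2 \<le> real (nat \<lceil>r / 2\<rceil>)" "real (nat \<lceil>r / 2\<rceil>) \<le> r / 2 + 1"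
    using assms of_int_ceiling_le_add_one[of "r / 2"] by auto
  show "1 \<le> nat \<lceil>r / 2\<rceil>" using assms by linarith
  show "r \<le> 2 * real (nat \<lceil>r / 2\<rceil>)" "real (nat \<lceil>r / 2\<rceil>) \<le> r" using c assms by linarith+
qed

text \<open>In the moment of order \<open>p\<close> of the squared projection one factor is
  integrated to \<open>s\<close> and the other \<open>p - 1\<close> are bounded by \<open>B\<close>.
  The powers then match those of j^2/N in the Rosenthal term, and no condition linking
  \<open>N\<close> and \<open>r\<close> arises.\<close>

lemma V_tail_bounded:
  assumes B: "AE x in \<Omega>. \<bar>G x\<bar> \<le> B" "0 \<le> B" and r: "2 \<le> r" and t: "0 < t"
    and gauss: "(1024 * r) ^ j * (\<integral>x. (\<phi> x)\<^sup>2 \<partial>\<Omega>) \<le> t\<^sup>2"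
    and poisson: "real (m choose j) * (8 * r) ^ j * (32 * r * ((real j)\<^sup>2 / real N * B\<^sup>2)) \<le> t\<^sup>2"
  shows "measure \<Omega> {x\<in>space \<Omega>. t \<le> \<bar>V x\<bar>} \<le> exp (- r)"
proof -
  obtain p where p: "1 \<le> p" "r \<le> 2 * real p" "real p \<le> r" using obtain_moment_order[OF r] by blast
  have pow: "z ^ p = z * z ^ (p - 1)" for z :: real using p(1) by (cases p) auto
  define s where "s = (\<integral>x. (G x)\<^sup>2 \<partial>\<Omega>)"
  define v where "v = (real j)\<^sup>2 / real N * B\<^sup>2"
  define mx where "mx = max s (real p * v)"
  have s: "0 \<le> s" by (simp add: s_def)
  have v: "0 \<le> v" by (simp add: v_def)
  have am: "all_moments \<Omega> G"
    unfolding all_moments_def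
  proof (intro conjI allI G_meas)
    fix n
    show "integrable \<Omega> (\<lambda>x. \<bar>G x\<bar> ^ n)"
    proof (rule P.integrable_const_bound[where B="B ^ n"])
      show "AE x in \<Omega>. norm (\<bar>G x\<bar> ^ n) \<le> B ^ n"
        using B(1) by eventually_elim (auto intro!: power_mono)
    qed measurable
  qed
  have w: "(\<integral>x. ((G x)\<^sup>2) ^ p \<partial>\<Omega>) \<le> s * (B\<^sup>2) ^ (p - 1)"
  proof -
    have "(\<integral>x. ((G x)\<^sup>2) ^ p \<partial>\<Omega>) \<le> (\<integral>x. (G x)\<^sup>2 * (B\<^sup>2) ^ (p - 1) \<partial>\<Omega>)"
    proof (rule integral_mono_AE)
      show "integrable \<Omega> (\<lambda>x. ((G x)\<^sup>2) ^ p)"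
        by (intro all_moments_integrable all_moments_power am)
      show "integrable \<Omega> (\<lambda>x. (G x)\<^sup>2 * (B\<^sup>2) ^ (p - 1))" using G_square by simp
      show "AE x in \<Omega>. ((G x)\<^sup>2) ^ p \<le> (G x)\<^sup>2 * (B\<^sup>2) ^ (p - 1)"
        using B(1)
      proof eventually_elim
        case (elim x)
        have "(G x)\<^sup>2 \<le> B\<^sup>2" using elim B(2) by (intro abs_le_square_iff[THEN iffD1]) auto
        then have "((G x)\<^sup>2) ^ (p - 1) \<le> (B\<^sup>2) ^ (p - 1)" by (rule power_mono) simp
        then have "(G x)\<^sup>2 * ((G x)\<^sup>2) ^ (p - 1) \<le> (G x)\<^sup>2 * (B\<^sup>2) ^ (p - 1)" by (intro mult_left_mono) auto
        then show ?case by (simp only: pow)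
      qed
    qed
    then show ?thesis by (simp add: s_def)
  qed
  show ?thesis
  proof (rule V_tail[OF am p w _ _ _ t gauss])
    have "real p ^ p * ((real j)\<^sup>2 / real N) ^ (p - 1) * (s * (B\<^sup>2) ^ (p - 1))
        = real p * (s * (real p * v) ^ (p - 1))"
      unfolding pow[of "real p"] by (simp only: v_def power_mult_distrib mult_ac)
    \<comment> \<open>Both \<open>s\<close> and \<open>p * v\<close> are at most \<open>mx\<close>,
      and the surplus factor \<open>p\<close> is absorbed by \<open>2 ^ p\<close>; this doubling
      turns the 16 of \<open>V_tail\<close> into the 32 of the hypothesis.\<close>
    also have "\<dots> \<le> 2 ^ p * (mx * mx ^ (p - 1))"
      using s v p(1) of_nat_mono[OF less_imp_le[OF less_exp[of p]], where 'a=real]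
      by (intro mult_mono power_mono) (auto simp: mx_def)
    also have "\<dots> = (2 * mx) ^ p"
      by (simp only: power_mult_distrib pow[of mx])
    finally show "real p ^ p * ((real j)\<^sup>2 / real N) ^ (p - 1) * (s * (B\<^sup>2) ^ (p - 1)) \<le> (2 * mx) ^ p" .
    show "0 \<le> 2 * mx" using s by (simp add: mx_def)
    have "mx \<le> s + r * v" using s v p mult_right_mono[OF p(3) v] by (auto simp: mx_def)
    then show "2 * mx \<le> 2 * (\<integral>x. (G x)\<^sup>2 \<partial>\<Omega>) + 2 * r * v" by (simp add: s_def)
    show "real (m choose j) * (8 * r) ^ j * (16 * (2 * r * v)) \<le> t\<^sup>2"
      using poisson by (simp add: v_def mult_ac)
  qed
qed

text \<open>With \<open>W ^ p\<close> as the only bound one power of \<open>\<delta>\<close> is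
  missing. It is replaced by \<open>\<delta> * exp (2 * \<rho>) ^ p\<close>, which is at least 1
  because N/j is at most \<open>exp (\<rho> * r)\<close> and \<open>r \<le> 2 * real p\<close>. The
  logarithmic condition of (B) is the hypothesis on \<open>\<rho>\<close> for
  \<open>\<rho> = \<gamma>\<^sub>2 * real j\<close>.\<close>

lemma V_tail_moments:
  assumes am: "all_moments \<Omega> G" and r: "2 \<le> r" and t: "0 < t"
    and W: "\<And>p. 1 \<le> p \<Longrightarrow> real p \<le> r \<Longrightarrow> (\<integral>x. ((G x)\<^sup>2) ^ p \<partial>\<Omega>) \<le> W ^ p" "0 \<le> W"
    and \<rho>: "real N / real j \<le> exp (\<rho> * r)" "0 \<le> \<rho>"
    and gauss: "(1024 * r) ^ j * (\<integral>x. (\<phi> x)\<^sup>2 \<partial>\<Omega>) \<le> t\<^sup>2"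
    and poisson: "real (m choose j) * (8 * r) ^ j * (16 * (r * ((real j)\<^sup>2 / real N) * exp (2 * \<rho>) * W)) \<le> t\<^sup>2"
  shows "measure \<Omega> {x\<in>space \<Omega>. t \<le> \<bar>V x\<bar>} \<le> exp (- r)"
proof -
  obtain p where p: "1 \<le> p" "r \<le> 2 * real p" "real p \<le> r" using obtain_moment_order[OF r] by blast
  have pow: "z ^ p = z * z ^ (p - 1)" for z :: real using p(1) by (cases p) auto
  define \<delta> where "\<delta> = (real j)\<^sup>2 / real N"
  have N: "0 < real N" "0 < real j" "1 \<le> real j" using jm by auto
  have \<delta>: "0 < \<delta>" using N by (simp add: \<delta>_def)
  show ?thesis
  proof (rule V_tail[OF am p W(1)[OF p(1,3)] _ _ _ t gauss poisson])
    have "1 \<le> \<delta> * (real N / real j)"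
      using N by (simp add: \<delta>_def power2_eq_square)
    also have "\<dots> \<le> \<delta> * exp (2 * \<rho>) ^ p"
    proof (intro mult_left_mono)
      have "\<rho> * r \<le> \<rho> * (2 * real p)" using p \<rho> by (intro mult_left_mono)
      then have "exp (\<rho> * r) \<le> exp (real p * (2 * \<rho>))" by (simp add: mult_ac)
      then show "real N / real j \<le> exp (2 * \<rho>) ^ p"
        using \<rho>(1) by (simp add: exp_of_nat_mult)
    qed (use \<delta> in auto)
    finally have one: "1 \<le> \<delta> * exp (2 * \<rho>) ^ p" .
    have "real p ^ p * \<delta> ^ (p - 1) * W ^ p * 1 \<le> real p ^ p * \<delta> ^ (p - 1) * W ^ p * (\<delta> * exp (2 * \<rho>) ^ p)"
      using one \<delta> W(2) by (intro mult_left_mono) auto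
    also have "\<dots> = (real p * \<delta> * exp (2 * \<rho>) * W) ^ p"
      by (simp only: power_mult_distrib pow[of \<delta>] mult_ac)
    finally show "real p ^ p * ((real j)\<^sup>2 / real N) ^ (p - 1) * W ^ p \<le>
        (real p * ((real j)\<^sup>2 / real N) * exp (2 * \<rho>) * W) ^ p"
      by (simp add: \<delta>_def)
    show "0 \<le> real p * ((real j)\<^sup>2 / real N) * exp (2 * \<rho>) * W" using W(2) by simp
    have "real p * \<delta> * exp (2 * \<rho>) * W \<le> r * \<delta> * exp (2 * \<rho>) * W"
      using p \<delta> W(2) by (intro mult_right_mono) auto
    then show "real p * ((real j)\<^sup>2 / real N) * exp (2 * \<rho>) * W \<le>
        2 * (\<integral>x. (G x)\<^sup>2 \<partial>\<Omega>) + r * ((real j)\<^sup>2 / real N) * exp (2 * \<rho>) * W"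
      unfolding \<delta>_def by (rule order_trans) simp
  qed
qed

end

section \<open>Mixed derivatives and box increments\<close>

text \<open>
  Everywhere differentiable functions are primitives of their derivative in the sense of the
  Henstock--Kurzweil integral, so an almost everywhere bound on the derivative suffices.
\<close>
lemma lipschitz_from_AE_deriv_bound:
  fixes f :: "real \<Rightarrow> real"
  assumes deriv: "\<And>s. (f has_real_derivative f' s) (at s)"
    and bound: "AE s in lborel. \<bar>f' s\<bar> \<le> D" and "0 \<le> D"
  shows "\<bar>f a - f b\<bar> \<le> D * \<bar>a - b\<bar>"
proof -
  have le: "\<bar>f b - f a\<bar> \<le> D * (b - a)" if "a \<le> b" for a b
  proof -
    obtain N where N: "{s\<in>space lborel. \<not> \<bar>f' s\<bar> \<le> D} \<subseteq> N" "N \<in> null_sets lborel"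
      using AE_E[OF bound] by (metis null_setsI)
    have "negligible N"
      unfolding negligible_iff_null_sets using N(2) by (rule null_sets_completionI)
    have "(f' has_integral (f b - f a)) {a..b}"
      using that deriv
      by (intro fundamental_theorem_of_calculus)
        (auto simp: has_real_derivative_iff_has_vector_derivative[symmetric] intro: has_field_derivative_at_within)
    \<comment> \<open>Resetting the derivative to 0 on the null set makes the bound hold everywhere
      and leaves the gauge integral unchanged.\<close>
    then have "((\<lambda>s. if s \<in> N then 0 else f' s) has_integral (f b - f a)) {a..b}"
      by (rule has_integral_spike[OF \<open>negligible N\<close>, rotated]) auto
    then have "norm (f b - f a) \<le> D * measure lborel {a..b}"
      by (rule has_integral_bound_real[OF \<open>0 \<le> D\<close> finite.emptyI]) (use N(1) \<open>0 \<le> D\<close> in auto)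
    then show ?thesis using that by simp
  qed
  show ?thesis
    using le[of a b] le[of b a] by (cases "a \<le> b") (simp_all add: abs_minus_commute)
qed

text \<open>Tonelli's theorem for the indicator of a null set, with the new coordinate outermost:
  the induction over box increments needs one null set of values \<open>y\<close> outside which the
  slice is good almost everywhere.\<close>

lemma (in product_sigma_finite) AE_PiM_insert:
  assumes I: "finite I" "i \<notin> I" and P: "AE x in Pi\<^sub>M (insert i I) M. P x"
  shows "AE y in M i. AE x in Pi\<^sub>M I M. P (x(i := y))"
proof -
  obtain N where N: "{x\<in>space (Pi\<^sub>M (insert i I) M). \<not> P x} \<subseteq> N" "N \<in> null_sets (Pi\<^sub>M (insert i I) M)"
    using AE_E[OF P] by (metis null_setsI)
  have [measurable]: "N \<in> sets (Pi\<^sub>M (insert i I) M)" using N(2) by auto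
  interpret I: finite_product_sigma_finite M I by standard fact
  have upd: "(\<lambda>(y, x). x(i := y)) \<in> measurable (M i \<Otimes>\<^sub>M Pi\<^sub>M I M) (Pi\<^sub>M (insert i I) M)"
    using measurable_add_dim[of i I M] by measurable
  have m: "(\<lambda>(y, x). indicator N (x(i := y)) :: ennreal) \<in> borel_measurable (M i \<Otimes>\<^sub>M Pi\<^sub>M I M)"
    using measurable_compose[OF upd, of "indicator N :: _ \<Rightarrow> ennreal"] by (simp add: case_prod_beta')
  have "(\<integral>\<^sup>+ y. \<integral>\<^sup>+ x. indicator N (x(i := y)) \<partial>Pi\<^sub>M I M \<partial>M i) = emeasure (Pi\<^sub>M (insert i I) M) N"
    by (subst product_nn_integral_insert_rev[OF I, symmetric]) auto
  also have "\<dots> = 0" using N(2) by auto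
  finally have "AE y in M i. (\<integral>\<^sup>+ x. indicator N (x(i := y)) \<partial>Pi\<^sub>M I M) = 0"
    using I.borel_measurable_nn_integral[OF m] by (subst (asm) nn_integral_0_iff_AE) auto
  then show ?thesis
    using AE_space
  proof eventually_elim
    case (elim y)
    have my: "(\<lambda>x. indicator N (x(i := y)) :: ennreal) \<in> borel_measurable (Pi\<^sub>M I M)"
      using measurable_Pair2[OF m elim(2)] by simp
    have "AE x in Pi\<^sub>M I M. indicator N (x(i := y)) = (0 :: ennreal)"
      using elim(1) my by (subst (asm) nn_integral_0_iff_AE) auto
    then show ?case
      using AE_space
    proof eventually_elim
      case (elim x)
      have "x(i := y) \<in> space (Pi\<^sub>M (insert i I) M)"
        using elim(2) \<open>y \<in> space (M i)\<close> by (auto simp: space_PiM PiE_iff extensional_def)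
      moreover have "x(i := y) \<notin> N" using elim(1) by (auto simp: indicator_def split: if_splits)
      ultimately show ?case using N(1) by auto
    qed
  qed
qed

lemma mixed_deriv_slice:
  assumes "mixed_deriv_exists k f" "k < l"
  shows "mixed_deriv_exists k (\<lambda>x. f (x(l := s))) \<and>
    mixed_deriv k (\<lambda>x. f (x(l := s))) = (\<lambda>x. mixed_deriv k f (x(l := s)))"
  using assms
proof (induction k arbitrary: f)
  case (Suc k)
  have upd: "x(Suc k := r, l := s) = x(l := s, Suc k := r)" for x :: "nat \<Rightarrow> real" and r
    using Suc.prems(2) by (intro fun_upd_twist) auto
  have pd: "partial_deriv (Suc k) (\<lambda>x. f (x(l := s))) = (\<lambda>x. partial_deriv (Suc k) f (x(l := s)))"
    unfolding partial_deriv_def upd using Suc.prems(2) by simp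
  have "(\<lambda>r. f (x(Suc k := r, l := s))) differentiable (at (x (Suc k)))" for x
  proof -
    have "(\<lambda>r. f ((x(l := s))(Suc k := r))) differentiable (at ((x(l := s)) (Suc k)))"
      using Suc.prems(1) by (simp only: mixed_deriv_exists.simps)
    then show ?thesis unfolding upd using Suc.prems(2) by simp
  qed
  moreover have "mixed_deriv_exists k (partial_deriv (Suc k) f)" "k < l"
    using Suc.prems by simp_all
  note Suc.IH[OF this]
  ultimately show ?case
    unfolding mixed_deriv_exists.simps mixed_deriv.simps pd by blast
qed simp

text \<open>The iterated first difference in \<open>k\<close> variables, positive at the corner
  \<open>x\<close>. Vertices are extensional on \<open>{1..k}\<close>, so for \<open>k = 0\<close>
  the only vertex is \<open>\<lambda>_. undefined\<close>, the single point of the empty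
  product.\<close>

definition box_increment :: "nat \<Rightarrow> ((nat \<Rightarrow> real) \<Rightarrow> real) \<Rightarrow> (nat \<Rightarrow> real) \<Rightarrow> (nat \<Rightarrow> real) \<Rightarrow> real" where
  "box_increment k f x y =
    (\<Sum>I\<in>Pow {1..k}. (- 1) ^ (k - card I) * f (\<lambda>i\<in>{1..k}. if i \<in> I then x i else y i))"

lemma box_increment_Suc:
  "box_increment (Suc k) f x y =
    box_increment k (\<lambda>z. f (z(Suc k := x (Suc k)))) x y - box_increment k (\<lambda>z. f (z(Suc k := y (Suc k)))) x y"
proof -
  have set: "{1..Suc k} = insert (Suc k) {1..k}" by auto
  have arg: "(\<lambda>i\<in>{1..Suc k}. if i \<in> I then x i else y i) =
      (\<lambda>i\<in>{1..k}. if i \<in> I then x i else y i)(Suc k := y (Suc k))"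
    "(\<lambda>i\<in>{1..Suc k}. if i \<in> insert (Suc k) I then x i else y i) =
      (\<lambda>i\<in>{1..k}. if i \<in> I then x i else y i)(Suc k := x (Suc k))"
    if "I \<in> Pow {1..k}" for I
    using that by (auto simp: fun_eq_iff)
  have sign: "(- 1) ^ (Suc k - card I) = - ((- 1) ^ (k - card I) :: real)"
    "(- 1) ^ (Suc k - card (insert (Suc k) I)) = ((- 1) ^ (k - card I) :: real)"
    if I: "I \<in> Pow {1..k}" for I
  proof -
    have fin: "finite I" using I by (auto intro: finite_subset)
    have "card I \<le> k" using I card_mono[of "{1..k}" I] by auto
    then show "(- 1) ^ (Suc k - card I) = - ((- 1) ^ (k - card I) :: real)" by (simp add: Suc_diff_le)
    have "Suc k \<notin> I" using I by auto
    with fin show "(- 1) ^ (Suc k - card (insert (Suc k) I)) = ((- 1) ^ (k - card I) :: real)" by simp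
  qed
  have "box_increment (Suc k) f x y = (\<Sum>I\<in>Pow {1..k}.
      (- 1) ^ (Suc k - card I) * f (\<lambda>i\<in>{1..Suc k}. if i \<in> I then x i else y i) +
      (- 1) ^ (Suc k - card (insert (Suc k) I)) *
        f (\<lambda>i\<in>{1..Suc k}. if i \<in> insert (Suc k) I then x i else y i))"
    unfolding box_increment_def by (subst (1) set, rule sum_Pow_insert) auto
  also have "\<dots> = (\<Sum>I\<in>Pow {1..k}.
      (- 1) ^ (k - card I) * f ((\<lambda>i\<in>{1..k}. if i \<in> I then x i else y i)(Suc k := x (Suc k))) -
      (- 1) ^ (k - card I) * f ((\<lambda>i\<in>{1..k}. if i \<in> I then x i else y i)(Suc k := y (Suc k))))"
  proof (rule sum.cong[OF refl])
    fix I assume I: "I \<in> Pow {1..k}"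
    show "(- 1) ^ (Suc k - card I) * f (\<lambda>i\<in>{1..Suc k}. if i \<in> I then x i else y i) +
        (- 1) ^ (Suc k - card (insert (Suc k) I)) *
          f (\<lambda>i\<in>{1..Suc k}. if i \<in> insert (Suc k) I then x i else y i) =
        (- 1) ^ (k - card I) * f ((\<lambda>i\<in>{1..k}. if i \<in> I then x i else y i)(Suc k := x (Suc k))) -
        (- 1) ^ (k - card I) * f ((\<lambda>i\<in>{1..k}. if i \<in> I then x i else y i)(Suc k := y (Suc k)))"
      unfolding arg[OF I] sign[OF I] by simp
  qed
  finally show ?thesis unfolding box_increment_def sum_subtractf .
qed

text \<open>
  The mixed derivative is integrated back one variable at a time, starting with the innermost
  derivative: the increment over the first \<open>k\<close> variables of almost every slice of
  \<open>partial_deriv (Suc k) f\<close> is bounded by induction, and it is the derivative in the last variable of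
  the increment of the slices of \<open>f\<close>.
\<close>
lemma box_increment_le:
  assumes "mixed_deriv_exists k f" "AE x in Pi\<^sub>M {1..k} (\<lambda>_. lborel). \<bar>mixed_deriv k f x\<bar> \<le> D" "0 \<le> D"
  shows "\<bar>box_increment k f x y\<bar> \<le> D * (\<Prod>i\<in>{1..k}. \<bar>x i - y i\<bar>)"
  using assms
proof (induction k arbitrary: f D)
  case 0
  have "{1..0::nat} = {}" by simp
  \<comment> \<open>The empty product measure is a point mass, so here almost everywhere means at
    the one vertex of the increment.\<close>
  from "0.prems"(2)[unfolded this PiM_empty] have "\<bar>f (\<lambda>_. undefined)\<bar> \<le> D"
    by (simp add: AE_count_space)
  then show ?case by (simp add: box_increment_def restrict_def)
next
  case (Suc k)
  interpret L: product_sigma_finite "\<lambda>_::nat. lborel :: real measure"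
    by (simp add: product_sigma_finite_def lborel.sigma_finite_measure_axioms)
  define u where "u = partial_deriv (Suc k) f"
  define P where "P = (\<Prod>i\<in>{1..k}. \<bar>x i - y i\<bar>)"
  define \<psi> where "\<psi> s = box_increment k (\<lambda>z. f (z(Suc k := s))) x y" for s
  have P: "0 \<le> P" unfolding P_def by (intro prod_nonneg) auto
  have ex_u: "mixed_deriv_exists k u" using Suc.prems(1) by (simp add: u_def)
  have set: "{1..Suc k} = insert (Suc k) {1..k}" by auto
  have "AE z in Pi\<^sub>M (insert (Suc k) {1..k}) (\<lambda>_. lborel). \<bar>mixed_deriv k u z\<bar> \<le> D"
    using Suc.prems(2) by (simp only: mixed_deriv.simps set u_def)
  then have "AE s in lborel. AE z in Pi\<^sub>M {1..k} (\<lambda>_. lborel). \<bar>mixed_deriv k u (z(Suc k := s))\<bar> \<le> D"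
    by (rule L.AE_PiM_insert[rotated 2]) auto
  then have bound: "AE s in lborel. \<bar>box_increment k (\<lambda>z. u (z(Suc k := s))) x y\<bar> \<le> D * P"
  proof eventually_elim
    case (elim s)
    have ex: "mixed_deriv_exists k (\<lambda>z. u (z(Suc k := s)))"
      and eq: "mixed_deriv k (\<lambda>z. u (z(Suc k := s))) = (\<lambda>z. mixed_deriv k u (z(Suc k := s)))"
      using mixed_deriv_slice[OF ex_u, of "Suc k" s] by simp_all
    show ?case
      unfolding P_def by (rule Suc.IH[OF ex]) (simp_all only: eq elim Suc.prems(3))
  qed
  have "((\<lambda>s. f (z(Suc k := s))) has_real_derivative u (z(Suc k := s))) (at s)" for z s
  proof -
    have "(\<lambda>r. f ((z(Suc k := s))(Suc k := r))) differentiable (at ((z(Suc k := s)) (Suc k)))"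
      using Suc.prems(1) by (simp only: mixed_deriv_exists.simps)
    then have "(\<lambda>r. f (z(Suc k := r))) differentiable (at s)" by simp
    then have "((\<lambda>r. f (z(Suc k := r))) has_real_derivative deriv (\<lambda>r. f (z(Suc k := r))) s) (at s)"
      by (simp add: DERIV_deriv_iff_real_differentiable)
    then show ?thesis by (simp add: u_def partial_deriv_def)
  qed
  then have "(\<psi> has_real_derivative box_increment k (\<lambda>z. u (z(Suc k := s))) x y) (at s)" for s
    unfolding \<psi>_def box_increment_def by (intro DERIV_sum DERIV_cmult)
  from lipschitz_from_AE_deriv_bound[OF this bound]
  have "\<bar>\<psi> (x (Suc k)) - \<psi> (y (Suc k))\<bar> \<le> D * P * \<bar>x (Suc k) - y (Suc k)\<bar>"
    using Suc.prems(3) P by simp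
  moreover have "(\<Prod>i\<in>{1..Suc k}. \<bar>x i - y i\<bar>) = \<bar>x (Suc k) - y (Suc k)\<bar> * P"
    unfolding set P_def by (rule prod.insert) auto
  ultimately show ?case
    unfolding box_increment_Suc \<psi>_def by (simp only: mult_ac)
qed

section \<open>Bounds on the projection\<close>

context iid_product
begin

lemma
  fixes g :: "'i \<Rightarrow> 'a \<Rightarrow> real"
  assumes J: "J \<subseteq> S" and g: "\<And>i. i \<in> J \<Longrightarrow> integrable Q (g i)"
  shows integrable_prod_components: "integrable \<Omega> (\<lambda>x. \<Prod>i\<in>J. g i (x i))"
    and integral_prod_components: "(\<integral>x. (\<Prod>i\<in>J. g i (x i)) \<partial>\<Omega>) = (\<Prod>i\<in>J. \<integral>x. g i x \<partial>Q)"
proof -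
  \<comment> \<open>Padding with the constant 1 makes the product run over all of \<open>S\<close>;
    each added factor has integral 1.\<close>
  define g' where "g' i = (if i \<in> J then g i else (\<lambda>_. 1))" for i
  have int: "integrable Q (g' i)" for i using g by (simp add: g'_def)
  have e: "(\<Prod>i\<in>J. g i (x i)) = (\<Prod>i\<in>S. g' i (x i))" for x
    using J finite_S by (intro prod.mono_neutral_cong_left) (auto simp: g'_def)
  have e': "(\<Prod>i\<in>S. \<integral>x. g' i x \<partial>Q) = (\<Prod>i\<in>J. \<integral>x. g i x \<partial>Q)"
    using J finite_S by (intro prod.mono_neutral_cong_right) (auto simp: g'_def PQ.M.prob_space)
  show "integrable \<Omega> (\<lambda>x. \<Prod>i\<in>J. g i (x i))"
    unfolding e \<Omega>_def by (rule PQ.product_integrable_prod[OF finite_S int])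
  show "(\<integral>x. (\<Prod>i\<in>J. g i (x i)) \<partial>\<Omega>) = (\<Prod>i\<in>J. \<integral>x. g i x \<partial>Q)"
    unfolding e e'[symmetric] unfolding \<Omega>_def by (rule PQ.product_integral_prod[OF finite_S int])
qed

lemma AE_cexp_le:
  assumes meas: "\<phi> \<in> borel_measurable \<Omega>" and H: "AE x in \<Omega>. \<bar>\<phi> x\<bar> \<le> H"
  shows "AE y in \<Omega>. \<bar>cexp I \<phi> y\<bar> \<le> H"
  using AE_mix[OF meas H, of I] AE_space
proof eventually_elim
  case (elim y)
  have [measurable]: "(\<lambda>x. \<phi> (mix I y x)) \<in> borel_measurable \<Omega>"
    using measurable_compose[OF measurable_mix_right[OF elim(2)] meas] .
  have int: "integrable \<Omega> (\<lambda>x. \<phi> (mix I y x))"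
    by (rule P.integrable_const_bound[where B=H]) (use elim in auto)
  have "\<bar>cexp I \<phi> y\<bar> \<le> (\<integral>x. \<bar>\<phi> (mix I y x)\<bar> \<partial>\<Omega>)" unfolding cexp_def by (rule integral_abs_bound)
  also have "\<dots> \<le> (\<integral>x. H \<partial>\<Omega>)" using int elim by (intro integral_mono_AE) auto
  finally show ?case by (simp add: P.prob_space)
qed

end

context hoeffding_kernel
begin

lemma AE_G_le:
  assumes H: "AE x in \<Omega>. \<bar>\<phi> x\<bar> \<le> H"
  shows "AE x in \<Omega>. \<bar>G x\<bar> \<le> 2 ^ j * H"
proof -
  have "AE y in \<Omega>. \<forall>I\<in>Pow {1..j}. \<bar>cexp I \<phi> y\<bar> \<le> H"
    using AE_cexp_le[OF \<phi>_meas H] by (intro AE_finite_allI) auto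
  then show ?thesis
  proof eventually_elim
    case (elim y)
    have "\<bar>G y\<bar> \<le> (\<Sum>I\<in>Pow {1..j}. \<bar>(- 1) ^ (j - card I) * cexp I \<phi> y\<bar>)"
      unfolding G_def by (rule sum_abs)
    also have "\<dots> \<le> (\<Sum>I\<in>Pow {1..j}. H)"
      using elim by (intro sum_mono) (simp add: abs_mult)
    also have "\<dots> = 2 ^ j * H" by (simp add: card_Pow)
    finally show ?case .
  qed
qed

text \<open>By the tower property, each conditional expectation given \<open>I\<close> inside
  \<open>{1..j}\<close> is the mean of \<open>f\<close> with the coordinates outside
  \<open>I\<close> resampled. The same copy \<open>x\<close> serves all \<open>I\<close>, so the
  alternating sum moves under one integral and becomes a box increment.\<close>

lemma AE_G_eq_increment:
  fixes f :: "(nat \<Rightarrow> 'a) \<Rightarrow> real"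
  defines "f \<equiv> cexp {1..j} \<phi>"
  shows "AE y in \<Omega>. (\<forall>I\<in>Pow {1..j}. integrable \<Omega> (\<lambda>x. f (\<lambda>i\<in>{1..j}. if i \<in> I then y i else x i))) \<and>
    G y = (\<integral>x. (\<Sum>I\<in>Pow {1..j}. (- 1) ^ (j - card I) * f (\<lambda>i\<in>{1..j}. if i \<in> I then y i else x i)) \<partial>\<Omega>)"
proof -
  have f_mix: "f (\<lambda>i\<in>{1..j}. if i \<in> I then y i else x i) = f (mix I y x)" for I y x
    unfolding f_def using jm by (intro depends_onD[OF depends_cexp]) (auto simp: mix_def)
  have "AE y in \<Omega>. \<forall>I\<in>Pow {1..j}. integrable \<Omega> (\<lambda>x. \<phi> (mix I y x))"
    using AE_integrable_mix[OF \<phi>_meas \<phi>_int] by (intro AE_finite_allI) auto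
  then show ?thesis
    using AE_space
  proof eventually_elim
    case (elim y)
    have I: "integrable \<Omega> (\<lambda>x. f (mix I y x))" "(\<integral>x. f (mix I y x) \<partial>\<Omega>) = cexp I \<phi> y"
      if "I \<in> Pow {1..j}" for I
    proof -
      have e: "I \<inter> {1..j} = I" using that by auto
      have i: "integrable \<Omega> (\<lambda>x. \<phi> (mix (I \<inter> {1..j}) y x))" unfolding e using elim(1) that by blast
      show "integrable \<Omega> (\<lambda>x. f (mix I y x))"
        unfolding f_def by (rule integrable_cexp_mix[OF \<phi>_meas elim(2) i])
      show "(\<integral>x. f (mix I y x) \<partial>\<Omega>) = cexp I \<phi> y"
        using cexp_cexp[OF \<phi>_meas elim(2) i] unfolding e by (simp only: cexp_def[of I "cexp {1..j} \<phi>"] f_def)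
    qed
    have "G y = (\<Sum>I\<in>Pow {1..j}. (- 1) ^ (j - card I) * (\<integral>x. f (mix I y x) \<partial>\<Omega>))"
      unfolding G_def using I by (intro sum.cong) auto
    also have "\<dots> = (\<integral>x. (\<Sum>I\<in>Pow {1..j}. (- 1) ^ (j - card I) * f (mix I y x)) \<partial>\<Omega>)"
      using I by (subst Bochner_Integration.integral_sum) auto
    finally show ?case unfolding f_mix using I by blast
  qed
qed

end

locale real_hoeffding_kernel = hoeffding_kernel Q for Q :: "real measure" +
  fixes D :: real
  assumes sets_Q: "sets Q = sets borel" and Q_int: "integrable Q (\<lambda>x. x)" and D: "0 \<le> D"
    and increment: "\<And>x y. \<bar>box_increment j (cexp {1..j} \<phi>) x y\<bar> \<le> D * (\<Prod>i\<in>{1..j}. \<bar>x i - y i\<bar>)"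
begin

definition \<mu> :: real where "\<mu> = (\<integral>x. x \<partial>Q)"
definition \<nu> :: real where "\<nu> = (\<integral>x. \<bar>x - \<mu>\<bar> \<partial>Q)"

lemma measurable_Q[measurable_cong]: "sets Q = sets borel"
  by (rule sets_Q)

lemma \<nu>_nonneg: "0 \<le> \<nu>"
  by (simp add: \<nu>_def)

text \<open>For fixed \<open>y\<close> the mean over the copy factorises into the means of the side
  lengths. The triangle inequality through \<open>\<mu>\<close> separates \<open>y\<close> from the
  copy and leaves central moments only.\<close>

lemma AE_G_le_prod: "AE y in \<Omega>. \<bar>G y\<bar> \<le> D * (\<Prod>i\<in>{1..j}. \<bar>y i - \<mu>\<bar> + \<nu>)"
  using AE_G_eq_increment
proof eventually_elim
  case (elim y)
  have int: "integrable Q (\<lambda>x. \<bar>a - x\<bar>)" for a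
    using Q_int by simp
  have intd: "integrable \<Omega> (\<lambda>x. \<Prod>i\<in>{1..j}. \<bar>y i - x i\<bar>)"
    using jm by (intro integrable_prod_components[where g="\<lambda>i z. \<bar>y i - z\<bar>"] int) auto
  have "integrable \<Omega> (\<lambda>x. box_increment j (cexp {1..j} \<phi>) y x)"
    unfolding box_increment_def
    by (rule Bochner_Integration.integrable_sum, rule integrable_mult_right) (use elim in blast)
  then have intb: "integrable \<Omega> (\<lambda>x. \<bar>box_increment j (cexp {1..j} \<phi>) y x\<bar>)" by simp
  have "\<bar>G y\<bar> \<le> (\<integral>x. \<bar>box_increment j (cexp {1..j} \<phi>) y x\<bar> \<partial>\<Omega>)"
    using elim[THEN conjunct2] unfolding box_increment_def[symmetric] by (simp only: integral_abs_bound)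
  also have "\<dots> \<le> (\<integral>x. D * (\<Prod>i\<in>{1..j}. \<bar>y i - x i\<bar>) \<partial>\<Omega>)"
    by (rule integral_mono[OF intb _ increment]) (use intd in simp)
  also have "\<dots> = D * (\<Prod>i\<in>{1..j}. \<integral>x. \<bar>y i - x\<bar> \<partial>Q)"
    using jm by (subst Bochner_Integration.integral_mult_right_zero)
      (subst integral_prod_components[where g="\<lambda>i z. \<bar>y i - z\<bar>"], auto intro!: int)
  also have "\<dots> \<le> D * (\<Prod>i\<in>{1..j}. \<bar>y i - \<mu>\<bar> + \<nu>)"
  proof (intro mult_left_mono prod_mono conjI D)
    fix i
    have "(\<integral>x. \<bar>y i - x\<bar> \<partial>Q) \<le> (\<integral>x. \<bar>y i - \<mu>\<bar> + \<bar>x - \<mu>\<bar> \<partial>Q)"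
      using Q_int by (intro integral_mono) auto
    also have "\<dots> = \<bar>y i - \<mu>\<bar> + \<nu>"
      using Q_int by (simp add: \<nu>_def PQ.M.prob_space)
    finally show "(\<integral>x. \<bar>y i - x\<bar> \<partial>Q) \<le> \<bar>y i - \<mu>\<bar> + \<nu>" .
  qed simp
  finally show ?case .
qed

lemma AE_G_le_bounded:
  assumes "AE x in Q. \<bar>x - \<mu>\<bar> \<le> K" "0 \<le> K"
  shows "AE y in \<Omega>. \<bar>G y\<bar> \<le> D * (2 * K) ^ j"
proof -
  have "\<nu> \<le> (\<integral>x. K \<partial>Q)"
    unfolding \<nu>_def using assms Q_int by (intro integral_mono_AE) auto
  then have \<nu>: "\<nu> \<le> K" by (simp add: PQ.M.prob_space)
  have "AE y in \<Omega>. \<bar>y i - \<mu>\<bar> \<le> K" if "i \<in> {1..j}" for i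
    unfolding \<Omega>_def using that jm by (intro AE_PiM_component assms prob_Q) auto
  then have "AE y in \<Omega>. \<forall>i\<in>{1..j}. \<bar>y i - \<mu>\<bar> \<le> K" by (intro AE_finite_allI) auto
  then show ?thesis
    using AE_G_le_prod
  proof eventually_elim
    case (elim y)
    have "(\<Prod>i\<in>{1..j}. \<bar>y i - \<mu>\<bar> + \<nu>) \<le> (\<Prod>i\<in>{1..j}. 2 * K)"
    proof (intro prod_mono conjI)
      fix i assume "i \<in> {1..j}"
      then have "\<bar>y i - \<mu>\<bar> \<le> K" using elim(1) by blast
      then show "\<bar>y i - \<mu>\<bar> + \<nu> \<le> 2 * K" using \<nu> by linarith
    qed (use \<nu>_nonneg in auto)
    then have "D * (\<Prod>i\<in>{1..j}. \<bar>y i - \<mu>\<bar> + \<nu>) \<le> D * (2 * K) ^ j"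
      using D by (intro mult_left_mono) auto
    with elim(2) show ?case by linarith
  qed
qed

context
  assumes Q_moments: "\<And>n. integrable Q (\<lambda>x. \<bar>x - \<mu>\<bar> ^ n)"
begin

lemma all_moments_shifted: "all_moments Q (\<lambda>x. \<bar>x - \<mu>\<bar> + \<nu>)"
proof (intro all_moments_add PQ.M.all_moments_const)
  show "all_moments Q (\<lambda>x. \<bar>x - \<mu>\<bar>)" using Q_moments by (simp add: all_moments_def)
qed

lemma integrable_shifted_power: "integrable Q (\<lambda>x. (\<bar>x - \<mu>\<bar> + \<nu>) ^ n)"
  by (intro all_moments_integrable all_moments_power all_moments_shifted)

lemma integrable_prod_shifted: "integrable \<Omega> (\<lambda>y. \<Prod>i\<in>{1..j}. (\<bar>y i - \<mu>\<bar> + \<nu>) ^ n)"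
  using jm by (intro integrable_prod_components[where g="\<lambda>i z. (\<bar>z - \<mu>\<bar> + \<nu>) ^ n"] integrable_shifted_power) auto

lemma AE_G_power_le: "AE y in \<Omega>. \<bar>G y\<bar> ^ n \<le> D ^ n * (\<Prod>i\<in>{1..j}. (\<bar>y i - \<mu>\<bar> + \<nu>) ^ n)"
  using AE_G_le_prod
proof eventually_elim
  case (elim y)
  have "\<bar>G y\<bar> ^ n \<le> (D * (\<Prod>i\<in>{1..j}. \<bar>y i - \<mu>\<bar> + \<nu>)) ^ n" using elim by (intro power_mono) auto
  then show ?case by (simp add: power_mult_distrib prod_power_distrib)
qed

lemma all_moments_G: "all_moments \<Omega> G"
  unfolding all_moments_def
proof (intro conjI allI G_meas)
  fix n
  show "integrable \<Omega> (\<lambda>x. \<bar>G x\<bar> ^ n)"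
  proof (rule Bochner_Integration.integrable_bound)
    show "integrable \<Omega> (\<lambda>y. D ^ n * (\<Prod>i\<in>{1..j}. (\<bar>y i - \<mu>\<bar> + \<nu>) ^ n))"
      using integrable_prod_shifted by simp
    show "AE x in \<Omega>. norm (\<bar>G x\<bar> ^ n) \<le> norm (D ^ n * (\<Prod>i\<in>{1..j}. (\<bar>x i - \<mu>\<bar> + \<nu>) ^ n))"
      using AE_G_power_le[of n] by eventually_elim auto
  qed measurable
qed

lemma G_moment_le:
  assumes p: "1 \<le> p" and a: "0 < a" "(\<integral>x. \<bar>x - \<mu>\<bar> ^ (2 * p) \<partial>Q) \<le> a ^ (2 * p)"
  shows "(\<integral>x. ((G x)\<^sup>2) ^ p \<partial>\<Omega>) \<le> (D\<^sup>2 * (2 * a) ^ (2 * j)) ^ p"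
proof -
  obtain n where n: "2 * p = 1 + n" using p by (intro that[of "2 * p - 1"]) auto
  have an: "a ^ (2 * p) = a * a ^ n" by (simp only: n power_add power_one_right)
  \<comment> \<open>Lyapunov's inequality between the orders 1 and \<open>2 * p\<close>, again
    obtained from Young's inequality with a constant factor.\<close>
  have \<nu>: "\<nu> \<le> a"
  proof -
    have "real (1 + n) * (\<nu> * a ^ n) = (\<integral>x. real (1 + n) * (\<bar>x - \<mu>\<bar> ^ 1 * a ^ n) \<partial>Q)"
      by (simp add: \<nu>_def)
    also have "\<dots> \<le> (\<integral>x. real 1 * \<bar>x - \<mu>\<bar> ^ (1 + n) + real n * a ^ (1 + n) \<partial>Q)"
      using a Q_moments[of 1] Q_moments[of "1 + n"]
      by (intro integral_mono Youngs_inequality_power Bochner_Integration.integrable_add) auto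
    also have "\<dots> = (\<integral>x. \<bar>x - \<mu>\<bar> ^ (2 * p) \<partial>Q) + real n * a ^ (2 * p)"
      unfolding n using Q_moments[of "1 + n"] by (simp add: PQ.M.prob_space)
    also have "\<dots> \<le> real (1 + n) * (a * a ^ n)" using a(2) unfolding an[symmetric] by (simp add: distrib_right)
    finally have "\<nu> * a ^ n \<le> a * a ^ n" by (rule mult_left_le_imp_le) simp
    then show ?thesis by (rule mult_right_le_imp_le) (use a in auto)
  qed
  have shifted: "(\<integral>x. (\<bar>x - \<mu>\<bar> + \<nu>) ^ (2 * p) \<partial>Q) \<le> (2 * a) ^ (2 * p)"
  proof -
    \<comment> \<open>Since \<open>\<nu> \<le> a\<close>, the sum is at most twice the midpoint of
      \<open>u\<close> and \<open>a\<close>; convexity then gives the base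
      \<open>2 * a\<close>.\<close>
    have "(u + \<nu>) ^ (2 * p) \<le> 2 ^ (2 * p) * (u ^ (2 * p) / 2 + a ^ (2 * p) / 2)" if "0 \<le> u" for u
    proof -
      have "(u + \<nu>) ^ (2 * p) \<le> (2 * ((1 - 1/2) *\<^sub>R u + (1/2) *\<^sub>R a)) ^ (2 * p)"
        using that \<nu> \<nu>_nonneg by (intro power_mono) auto
      also have "\<dots> = 2 ^ (2 * p) * ((1 - 1/2) *\<^sub>R u + (1/2) *\<^sub>R a) ^ (2 * p)"
        by (rule power_mult_distrib)
      also have "\<dots> \<le> 2 ^ (2 * p) * ((1 - 1/2) * u ^ (2 * p) + (1/2) * a ^ (2 * p))"
        using that a by (intro mult_left_mono convex_onD[OF convex_on_power_nonneg]) auto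
      finally show ?thesis by simp
    qed
    then have "(\<integral>x. (\<bar>x - \<mu>\<bar> + \<nu>) ^ (2 * p) \<partial>Q) \<le>
        (\<integral>x. 2 ^ (2 * p) * (\<bar>x - \<mu>\<bar> ^ (2 * p) / 2 + a ^ (2 * p) / 2) \<partial>Q)"
      using Q_moments[of "2 * p"] by (intro integral_mono integrable_shifted_power) auto
    also have "\<dots> = 2 ^ (2 * p) * ((\<integral>x. \<bar>x - \<mu>\<bar> ^ (2 * p) \<partial>Q) / 2 + a ^ (2 * p) / 2)"
      using Q_moments[of "2 * p"] by (simp add: PQ.M.prob_space)
    also have "\<dots> \<le> 2 ^ (2 * p) * (a ^ (2 * p) / 2 + a ^ (2 * p) / 2)"
      using a(2) by (intro mult_left_mono add_right_mono divide_right_mono) auto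
    finally show ?thesis by (simp add: power_mult_distrib)
  qed
  have "(\<integral>x. ((G x)\<^sup>2) ^ p \<partial>\<Omega>) = (\<integral>x. \<bar>G x\<bar> ^ (2 * p) \<partial>\<Omega>)"
    by (simp add: power_mult power_even_abs)
  also have "\<dots> \<le> (\<integral>y. D ^ (2 * p) * (\<Prod>i\<in>{1..j}. (\<bar>y i - \<mu>\<bar> + \<nu>) ^ (2 * p)) \<partial>\<Omega>)"
    using all_moments_G integrable_prod_shifted AE_G_power_le
    by (intro integral_mono_AE) (auto simp: all_moments_def)
  also have "\<dots> = D ^ (2 * p) * (\<Prod>i\<in>{1..j}. \<integral>x. (\<bar>x - \<mu>\<bar> + \<nu>) ^ (2 * p) \<partial>Q)"
    using jm by (subst Bochner_Integration.integral_mult_right_zero)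
      (subst integral_prod_components[where g="\<lambda>i z. (\<bar>z - \<mu>\<bar> + \<nu>) ^ (2 * p)"], auto intro!: integrable_shifted_power)
  also have "\<dots> \<le> D ^ (2 * p) * (\<Prod>i\<in>{1..j}. (2 * a) ^ (2 * p))"
    using D shifted \<nu>_nonneg
    by (intro mult_left_mono prod_mono) (auto intro!: Bochner_Integration.integral_nonneg)
  also have "\<dots> = (D\<^sup>2 * (2 * a) ^ (2 * j)) ^ p"
    by (simp add: power_mult_distrib power_mult[symmetric] mult_ac)
  finally show ?thesis .
qed

end

end

section \<open>Transfer from the sample to the product of its marginal laws\<close>

lemma joint_law_eq_PiM:
  assumes "iid_sample M X N" "1 \<le> N"
  shows "joint_law M X N = Pi\<^sub>M {1..N} (\<lambda>_. distr M borel (X 1))"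
proof -
  interpret prob_space M using assms(1) by (simp add: iid_sample_def)
  have N: "{1..N} \<noteq> {}" using assms(2) by auto
  have indep: "indep_vars (\<lambda>_. borel) X {1..N}" using assms(1) by (simp add: iid_sample_def)
  have "X i \<in> borel_measurable M" if "i \<in> {1..N}" for i
    using indep that by (auto simp: indep_vars_def)
  then have "joint_law M X N = Pi\<^sub>M {1..N} (\<lambda>i. distr M borel (X i))"
    unfolding joint_law_def using indep indep_vars_iff_distr_eq_PiM'[OF N, where X=X and M'="\<lambda>_. borel"] by simp
  also have "\<dots> = Pi\<^sub>M {1..N} (\<lambda>_. distr M borel (X 1))"
    using assms(1) unfolding iid_sample_def by (intro PiM_cong refl) blast
  finally show ?thesis .
qed

locale ustatistic =
  fixes M :: "'w measure" and X :: "nat \<Rightarrow> 'w \<Rightarrow> real" and N m j :: nat and h :: "(nat \<Rightarrow> real) \<Rightarrow> real"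
  assumes iid: "iid_sample M X N" and jmN: "2 \<le> j" "j \<le> m" "m \<le> N"
    and adm: "admissible_kernel M X m h"
begin

declare One_nat_def[simp del]

definition Q :: "real measure" where "Q = distr M borel (X 1)"

lemma prob_M: "prob_space M"
  using iid by (simp add: iid_sample_def)

lemma mN: "1 \<le> m" "m \<le> N" "1 \<le> N" "1 \<in> {1..N}"
  using jmN by auto

lemma X1_meas: "X 1 \<in> borel_measurable M"
  using iid mN(4) prob_M by (auto simp: iid_sample_def prob_space.indep_vars_def)

lemma h_meas: "h \<in> borel_measurable (Pi\<^sub>M {1..m} (\<lambda>_. borel))"
  using adm by (simp add: admissible_kernel_def)

lemma prob_Q: "prob_space Q"
  unfolding Q_def by (rule prob_space.prob_space_distr[OF prob_M X1_meas])

sublocale iid_product Q "{1..N}"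
  by (rule iid_product.intro[OF prob_Q finite_atLeastAtMost])

lemma \<Omega>_eq: "\<Omega> = joint_law M X N"
  unfolding \<Omega>_def unfolding Q_def by (rule joint_law_eq_PiM[OF iid mN(3), symmetric])

lemma sets_joint: "sets \<Omega> = sets (Pi\<^sub>M {1..N} (\<lambda>_. borel))"
  by (simp add: \<Omega>_eq joint_law_def)

sublocale hoeffding_kernel Q N m j "kernel_rv (\<lambda>i x. x i) m h"
proof (intro hoeffding_kernel.intro hoeffding_kernel_axioms.intro iid_product_axioms)
  show "1 \<le> j" "j \<le> m" "m \<le> N" using jmN by auto
  have "(\<lambda>x. \<lambda>i\<in>{1..m}. x i / sqrt (real m)) \<in> measurable \<Omega> (Pi\<^sub>M {1..m} (\<lambda>_. borel))"
  proof (rule measurable_restrict)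
    fix i assume "i \<in> {1..m}"
    then have "i \<in> {1..N}" using mN by auto
    then have [measurable]: "(\<lambda>x. x i) \<in> borel_measurable \<Omega>"
      unfolding measurable_cong_sets[OF sets_joint refl] by (rule measurable_component_singleton)
    show "(\<lambda>x. x i / sqrt (real m)) \<in> borel_measurable \<Omega>" by measurable
  qed
  from measurable_compose[OF this h_meas]
  show "kernel_rv (\<lambda>i x. x i) m h \<in> borel_measurable \<Omega>" by (simp add: kernel_rv_def[abs_def])
  show "integrable \<Omega> (\<lambda>x. (kernel_rv (\<lambda>i x. x i) m h x)\<^sup>2)"
    using adm admissible_joint_law[OF iid mN(1,2) h_meas]
    unfolding \<Omega>_eq admissible_kernel_def by blast
  fix e x assume e: "e permutes {1..m}" and x: "x \<in> space \<Omega>"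
  have "kernel_rv (\<lambda>i x. x i) m h (\<lambda>i\<in>{1..N}. x (e i)) = h ((\<lambda>i\<in>{1..m}. x i / sqrt (real m)) \<circ> e)"
    unfolding kernel_rv_def
  proof (rule arg_cong[where f=h], rule ext)
    fix i
    show "(\<lambda>i\<in>{1..m}. (\<lambda>i\<in>{1..N}. x (e i)) i / sqrt (real m)) i =
        ((\<lambda>i\<in>{1..m}. x i / sqrt (real m)) \<circ> e) i"
      using mN permutes_in_image[OF e, of i] by auto
  qed
  also have "\<dots> = h (\<lambda>i\<in>{1..m}. x i / sqrt (real m))"
    using adm e unfolding admissible_kernel_def symmetric_kernel_def by blast
  finally show "kernel_rv (\<lambda>i x. x i) m h (\<lambda>i\<in>{1..N}. x (e i)) = kernel_rv (\<lambda>i x. x i) m h x"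
    by (simp only: kernel_rv_def)
qed

lemma kernel_mean_eq_cexp:
  "kernel_mean M X m h I (\<lambda>k. z k / sqrt (real m)) = cexp I (kernel_rv (\<lambda>i x. x i) m h) z"
proof -
  have "kernel_mean M X m h I (\<lambda>k. z k / sqrt (real m)) =
      kernel_mean \<Omega> (\<lambda>i x. x i) m h I (\<lambda>k. z k / sqrt (real m))"
    unfolding \<Omega>_eq kernel_mean_joint_law[OF iid mN(1,2) h_meas] ..
  also have "\<dots> = cexp I (kernel_rv (\<lambda>i x. x i) m h) z"
    unfolding kernel_mean_def cexp_def kernel_rv_def mix_def using mN
    by (intro Bochner_Integration.integral_cong refl arg_cong[where f=h] restrict_ext) auto
  finally show ?thesis .
qed

lemma hoeffding_proj_eq_G: "hoeffding_proj M X m h j (\<lambda>k. z k / sqrt (real m)) = G z"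
  unfolding hoeffding_proj_def G_def kernel_mean_eq_cexp ..

lemma partial_mean_eq_cexp: "partial_mean M X m h j = cexp {1..j} (kernel_rv (\<lambda>i x. x i) m h)"
  by (rule ext) (simp only: partial_mean_def kernel_mean_eq_cexp)

lemma V_stat_tail:
  "measure M {\<omega>\<in>space M. t \<le> \<bar>V_stat M X m h N j \<omega>\<bar>} = measure \<Omega> {x\<in>space \<Omega>. t \<le> \<bar>V x\<bar>}"
proof -
  have "V_stat (joint_law M X N) (\<lambda>i x. x i) m h N j = V"
    unfolding V_stat_def V_def F_def hoeffding_proj_joint_law[OF iid mN(1,2) h_meas] hoeffding_proj_eq_G ..
  then show ?thesis
    using V_stat_joint_law[OF iid mN(1,2) h_meas, where j=j and t=t] by (simp add: \<Omega>_eq)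
qed

lemma variance_eq: "prob_space.variance M (kernel_rv X m h) = (\<integral>x. (kernel_rv (\<lambda>i x. x i) m h x)\<^sup>2 \<partial>\<Omega>)"
proof -
  have "admissible_kernel \<Omega> (\<lambda>i x. x i) m h"
    using adm admissible_joint_law[OF iid mN(1,2) h_meas] unfolding \<Omega>_eq by blast
  then have "(\<integral>x. kernel_rv (\<lambda>i x. x i) m h x \<partial>\<Omega>) = 0" by (simp add: admissible_kernel_def)
  then show ?thesis
    using variance_joint_law[OF iid mN(1,2) h_meas] by (simp add: \<Omega>_eq)
qed

text \<open>\<open>kernel_norm\<close> converts an extended real, and the conversion sends infinite
  values to 0. Boundedness of the kernel excludes positive infinity and the total mass 1 excludes
  negative values, so the number really bounds the kernel; the bound is then pulled back along the
  scaled first \<open>m\<close> coordinates.\<close>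

lemma AE_kernel_le_norm:
  assumes "bounded_kernel m h"
  shows "AE x in \<Omega>. \<bar>kernel_rv (\<lambda>i x. x i) m h x\<bar> \<le> kernel_norm M X m h"
    and "0 \<le> kernel_norm M X m h"
proof -
  let ?J = "joint_law M X N"
  let ?Y = "\<lambda>i x. x i / sqrt (real m) :: real"
  define R where "R = Pi\<^sub>M {1..m} (\<lambda>_. scaled_law M X m)"
  have iidJ: "iid_sample ?J (\<lambda>i x. x i) N" by (rule iid_joint_law[OF iid mN(1,2) h_meas])
  interpret D: prob_space ?J using iidJ by (simp add: iid_sample_def)
  have m1: "{1..m} \<noteq> {}" "{1..m} \<subseteq> {1..N}" using mN by auto
  have indep: "D.indep_vars (\<lambda>_. borel) (\<lambda>i x. x i) {1..N}" using iidJ by (simp add: iid_sample_def)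
  have "D.indep_vars (\<lambda>_. borel) ?Y {1..N}"
    using D.indep_vars_compose2[OF indep, where Y="\<lambda>_ z. z / sqrt (real m)" and N="\<lambda>_. borel"] by simp
  then have indepY: "D.indep_vars (\<lambda>_. borel) ?Y {1..m}" using m1(2) by (rule D.indep_vars_subset)
  have Ym: "?Y i \<in> borel_measurable ?J" if "i \<in> {1..m}" for i
    using indepY that by (auto simp: D.indep_vars_def)
  have law: "distr ?J borel (?Y i) = scaled_law M X m" if "i \<in> {1..m}" for i
  proof -
    have i: "i \<in> {1..N}" using that m1 by auto
    have ci: "(\<lambda>x. x i) \<in> borel_measurable ?J"
      using indep i by (auto simp: D.indep_vars_def)
    have "distr ?J borel (?Y i) = distr (distr ?J borel (\<lambda>x. x i)) borel (\<lambda>z. z / sqrt (real m))"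
      by (subst distr_distr[OF _ ci]) (auto simp: comp_def)
    also have "distr ?J borel (\<lambda>x. x i) = distr M borel (X 1)"
      using law_joint_law[OF iid mN(1,2) h_meas i] iid i unfolding iid_sample_def by metis
    also have "distr (distr M borel (X 1)) borel (\<lambda>z. z / sqrt (real m)) = scaled_law M X m"
      unfolding scaled_law_def by (subst distr_distr[OF _ X1_meas]) (auto simp: comp_def)
    finally show ?thesis .
  qed
  let ?T = "\<lambda>x. \<lambda>i\<in>{1..m}. ?Y i x"
  have distrT: "distr ?J (Pi\<^sub>M {1..m} (\<lambda>_. borel)) ?T = R"
  proof -
    have "distr ?J (Pi\<^sub>M {1..m} (\<lambda>_. borel)) ?T = Pi\<^sub>M {1..m} (\<lambda>i. distr ?J borel (?Y i))"
      using indepY D.indep_vars_iff_distr_eq_PiM'[OF m1(1), where X="?Y" and M'="\<lambda>_. borel"] Ym by simp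
    also have "\<dots> = R" unfolding R_def by (intro PiM_cong refl law)
    finally show ?thesis .
  qed
  have Tm: "?T \<in> measurable ?J (Pi\<^sub>M {1..m} (\<lambda>_. borel))" by (intro measurable_restrict Ym)
  interpret R: prob_space R unfolding distrT[symmetric] by (rule D.prob_space_distr[OF Tm])
  have setsR: "sets R = sets (Pi\<^sub>M {1..m} (\<lambda>_. borel))" unfolding distrT[symmetric] by simp
  have hR: "h \<in> borel_measurable R" unfolding measurable_cong_sets[OF setsR refl] by (rule h_meas)
  define E where "E = esssup R (\<lambda>y. ereal \<bar>h y\<bar>)"
  have norm: "kernel_norm M X m h = real_of_ereal E"
    by (simp add: kernel_norm_def ess_sup_norm_def E_def R_def)
  have AE_E: "AE y in R. ereal \<bar>h y\<bar> \<le> E" unfolding E_def by (rule esssup_AE)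
  obtain B where B: "\<And>y. y \<in> extensional {1..m} \<Longrightarrow> \<bar>h y\<bar> \<le> B"
    using assms by (auto simp: bounded_kernel_def)
  have "AE y in R. ereal \<bar>h y\<bar> \<le> ereal B"
  proof (rule AE_I2)
    fix y assume "y \<in> space R"
    then have "y \<in> extensional {1..m}" using sets_eq_imp_space_eq[OF setsR] by (auto simp: space_PiM PiE_def)
    then show "ereal \<bar>h y\<bar> \<le> ereal B" using B by simp
  qed
  then have EB: "E \<le> ereal B" unfolding E_def using hR by (intro esssup_I) measurable
  have E0: "0 \<le> E"
  proof (rule ccontr)
    assume "\<not> 0 \<le> E"
    then have "E < 0" by simp
    have "AE y in R. False"
      using AE_E
    proof eventually_elim
      case (elim y)
      then show False using \<open>E < 0\<close> order_le_less_trans[OF elim \<open>E < 0\<close>] by simp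
    qed
    then show False by simp
  qed
  have real: "ereal (real_of_ereal E) = E" using E0 EB by (cases E) auto
  show "0 \<le> kernel_norm M X m h" unfolding norm using E0 by (rule real_of_ereal_pos)
  have "AE y in distr ?J (Pi\<^sub>M {1..m} (\<lambda>_. borel)) ?T. \<bar>h y\<bar> \<le> kernel_norm M X m h"
    unfolding distrT norm using AE_E by eventually_elim (metis real ereal_less_eq(3))
  then have "AE x in ?J. \<bar>h (?T x)\<bar> \<le> kernel_norm M X m h" by (rule AE_distrD[OF Tm])
  then show "AE x in \<Omega>. \<bar>kernel_rv (\<lambda>i x. x i) m h x\<bar> \<le> kernel_norm M X m h"
    unfolding \<Omega>_eq kernel_rv_def .
qed

text \<open>The derivative is controlled almost everywhere for Lebesgue measure, while
  \<open>Q\<close> may be discrete or singular. The passage to increments resolves this: their bound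
  holds at every pair of points and can be integrated against any law.\<close>

lemma smooth_kernel:
  assumes smooth: "smoothness_condition M X m h j C \<gamma>" and int: "integrable M (X 1)"
  shows "real_hoeffding_kernel N m j (kernel_rv (\<lambda>i x. x i) m h) Q
    ((C / real m) powr (real j / 2) * real j powr (\<gamma> * real j))"
proof (intro real_hoeffding_kernel.intro real_hoeffding_kernel_axioms.intro hoeffding_kernel_axioms)
  let ?f = "cexp {1..j} (kernel_rv (\<lambda>i x. x i) m h)"
  let ?D = "(C / real m) powr (real j / 2) * real j powr (\<gamma> * real j)"
  show "sets Q = sets borel" by (simp add: Q_def)
  show "integrable Q (\<lambda>x. x)" unfolding Q_def using int by (subst integrable_distr_eq[OF X1_meas]) auto
  show D: "0 \<le> ?D" by simp
  fix x y
  have ex: "mixed_deriv_exists j ?f"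
    and le: "esssup (Pi\<^sub>M {1..j} (\<lambda>_. lborel)) (\<lambda>y. ereal \<bar>mixed_deriv j ?f y\<bar>) \<le> ereal ?D"
    using smooth unfolding smoothness_condition_def ess_sup_norm_def partial_mean_eq_cexp by auto
  have "AE z in Pi\<^sub>M {1..j} (\<lambda>_. lborel). \<bar>mixed_deriv j ?f z\<bar> \<le> ?D"
    using esssup_AE[of "\<lambda>y. ereal \<bar>mixed_deriv j ?f y\<bar>" "Pi\<^sub>M {1..j} (\<lambda>_. lborel)"]
  proof eventually_elim
    case (elim z)
    from order_trans[OF elim le] show ?case by simp
  qed
  then show "\<bar>box_increment j ?f x y\<bar> \<le> ?D * (\<Prod>i\<in>{1..j}. \<bar>x i - y i\<bar>)"
    by (rule box_increment_le[OF ex _ D])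
qed

end

section \<open>Ranges of the parameters\<close>

text \<open>A weak form of Stirling's bound: the quotient of consecutive left sides involves (1 +
  1/j)^j, at most e, and 3 replaces e to keep later constants integral.\<close>

lemma power_le_fact: "(real j / 3) ^ j \<le> fact j"
proof (induction j)
  case (Suc j)
  show ?case
  proof (cases "j = 0")
    case False
    then have j: "0 < real j" by simp
    have "(1 + 1 / real j) ^ j \<le> exp (1 / real j) ^ j"
      by (intro power_mono exp_ge_add_one_self) simp
    also have "\<dots> = exp 1" using j by (simp add: exp_of_nat_mult[symmetric])
    also have "\<dots> \<le> (3::real)" using e_less_272 by simp
    finally have e: "(1 + 1 / real j) ^ j \<le> 3" .
    have "(real (Suc j) / 3) ^ Suc j = ((real j / 3) * (1 + 1 / real j)) ^ j * (real (Suc j) / 3)"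
    proof -
      have "(real j / 3) * (1 + 1 / real j) = real (Suc j) / 3" using j by (simp add: field_simps)
      then show ?thesis by (simp only: power_Suc2)
    qed
    also have "\<dots> = (real j / 3) ^ j * (1 + 1 / real j) ^ j * (real (Suc j) / 3)"
      by (simp only: power_mult_distrib)
    also have "\<dots> \<le> fact j * 3 * (real (Suc j) / 3)"
      using Suc.IH e by (intro mult_right_mono mult_mono) auto
    also have "\<dots> = fact (Suc j)" by simp
    finally show ?thesis .
  qed simp
qed simp

lemma binomial_le_power:
  assumes "1 \<le> j"
  shows "real (m choose j) \<le> (3 * real m / real j) ^ j"
proof -
  have "real (m choose j) * (real j / 3) ^ j \<le> real (m choose j) * fact j"
    by (intro mult_left_mono power_le_fact) simp
  also have "\<dots> \<le> real m ^ j"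
    using binomial_fact_pow[of m j] by (metis of_nat_fact of_nat_le_iff of_nat_mult of_nat_power)
  finally show ?thesis
    using assms by (simp add: power_divide power_mult_distrib field_simps)
qed

lemma le_powr_imp:
  fixes r y a :: real
  assumes "r \<le> y powr a" "0 \<le> r" "0 \<le> y" "0 < a"
  shows "r powr (1 / a) \<le> y"
proof -
  have "r powr (1 / a) \<le> (y powr a) powr (1 / a)" using assms by (intro powr_mono2) auto
  then show ?thesis using assms by (simp add: powr_powr)
qed

lemma powr_divide_power:
  fixes y a :: real
  assumes "0 < n"
  shows "(y powr (a / real n)) ^ n = y powr a"
proof (cases "y = 0")
  case False
  then have "0 < y powr (a / real n)" by simp
  then have "(y powr (a / real n)) ^ n = (y powr (a / real n)) powr real n" by (rule powr_realpow[symmetric])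
  also have "\<dots> = y powr (a / real n * real n)" by (rule powr_powr)
  also have "a / real n * real n = a" using assms by simp
  finally show ?thesis .
qed (use assms in \<open>simp add: power_0_left\<close>)

lemma gaussian_range:
  fixes r t v :: real
  assumes "r \<le> 1 / 1024 * (t\<^sup>2 / v) powr (1 / real j)" "0 < r" "1 \<le> j" "0 \<le> v"
  shows "(1024 * r) ^ j * v \<le> t\<^sup>2"
proof -
  have "(1024 * r) powr (1 / (1 / real j)) \<le> t\<^sup>2 / v"
    using assms by (intro le_powr_imp) auto
  then have le: "(1024 * r) ^ j \<le> t\<^sup>2 / v" using assms by (simp add: powr_realpow)
  have "0 < (1024 * r) ^ j" using assms by simp
  \<comment> \<open>Division by zero gives 0, so \<open>v = 0\<close> would make the right side of
    \<open>le\<close> vanish, against the positivity just shown.\<close>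
  then have "v \<noteq> 0" using le by auto
  then show ?thesis using le assms(4) by (simp add: field_simps)
qed

text \<open>The power \<open>j + 1\<close> clears both fractional exponents. The binomial
  coefficient then provides the factor (m/j)^j of the statement, and squaring t/H sqrt(N/j) provides
  j/N.\<close>

lemma poisson_range_bounded:
  fixes r t H :: real
  assumes jm: "1 \<le> j" "j \<le> m" "m \<le> N" and r: "0 < r" and H: "0 \<le> H" and t: "0 < t"
    and le: "r \<le> (t / H * sqrt (real N / real j)) powr (2 / (real j + 1)) /
      (1024 * (real m / real j) powr (real j / (real j + 1)))"
  shows "real (m choose j) * (8 * r) ^ j * (32 * r * ((real j)\<^sup>2 / real N * (2 ^ j * H)\<^sup>2)) \<le> t\<^sup>2"
proof -
  define w where "w = real m / real j"
  define y where "y = t / H * sqrt (real N / real j)"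
  have pos: "0 < w" "0 < real N" "0 < real j" using jm by (auto simp: w_def)
  have y: "0 \<le> y" using t H by (simp add: y_def)
  have "1024 * r * w powr (real j / (real j + 1)) \<le> y powr (2 / (real j + 1))"
    using le pos unfolding w_def[symmetric] y_def[symmetric] by (simp add: pos_le_divide_eq mult_ac)
  then have "(1024 * r * w powr (real j / (real j + 1))) ^ (j + 1) \<le> (y powr (2 / (real j + 1))) ^ (j + 1)"
    using r by (intro power_mono) auto
  moreover have j1: "real j + 1 = real (j + 1)" by simp
  have "(w powr (real j / (real j + 1))) ^ (j + 1) = w ^ j" "(y powr (2 / (real j + 1))) ^ (j + 1) = y\<^sup>2"
    unfolding j1 using pos y by (subst powr_divide_power; simp add: powr_realpow)+
  ultimately have le2: "(1024 * r) ^ (j + 1) * w ^ j \<le> y\<^sup>2"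
    by (simp only: power_mult_distrib[of "1024 * r"])
  have "0 < (1024 * r) ^ (j + 1) * w ^ j" using r pos by simp
  then have "H \<noteq> 0" using le2 by (auto simp: y_def)
  then have "0 < H" using H by simp
  have "y\<^sup>2 * (H\<^sup>2 * (real j / real N)) = t\<^sup>2"
    using \<open>0 < H\<close> pos by (simp add: y_def power_mult_distrib power_divide)
  then have le3: "((1024 * r) ^ (j + 1) * w ^ j) * (H\<^sup>2 * (real j / real N)) \<le> t\<^sup>2"
    using mult_right_mono[OF le2, of "H\<^sup>2 * (real j / real N)"] by simp
  \<comment> \<open>96 = 3 * 8 * 4 collects the binomial bound, the hypercontractive factor and the
    square of \<open>2 ^ j\<close>. One of the two factors \<open>j\<close> in j^2/N is left over
    and absorbed by \<open>2 ^ j\<close>.\<close>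
  have num: "96 ^ j * 32 * real j \<le> 1024 ^ (j + 1)"
  proof -
    have "real j \<le> 2 ^ j" using of_nat_mono[OF less_imp_le[OF less_exp[of j]], where 'a=real] by simp
    then have "96 ^ j * 32 * real j \<le> 96 ^ j * 32 * 2 ^ j" by (intro mult_left_mono) auto
    also have "\<dots> = 32 * 192 ^ j" using power_mult_distrib[of "96::real" 2 j] by simp
    also have "\<dots> \<le> 1024 * 1024 ^ j" by (intro mult_mono power_mono) auto
    finally show ?thesis by simp
  qed
  have "real (m choose j) * (8 * r) ^ j * (32 * r * ((real j)\<^sup>2 / real N * (2 ^ j * H)\<^sup>2))
      \<le> (3 * w) ^ j * (8 * r) ^ j * (32 * r * ((real j)\<^sup>2 / real N * (2 ^ j * H)\<^sup>2))"
    unfolding w_def using r binomial_le_power[OF jm(1), of m] by (intro mult_right_mono) auto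
  also have "\<dots> = (3 ^ j * 8 ^ j * (2 ^ j)\<^sup>2) * 32 * real j * (r ^ (j + 1) * w ^ j * (H\<^sup>2 * (real j / real N)))"
    by (simp add: power_mult_distrib power2_eq_square mult_ac)
  also have "3 ^ j * 8 ^ j * (2 ^ j)\<^sup>2 = (96 :: real) ^ j"
    by (simp add: power2_eq_square power_mult_distrib[symmetric])
  also have "96 ^ j * 32 * real j * (r ^ (j + 1) * w ^ j * (H\<^sup>2 * (real j / real N)))
      \<le> 1024 ^ (j + 1) * (r ^ (j + 1) * w ^ j * (H\<^sup>2 * (real j / real N)))"
    using num r pos by (intro mult_right_mono) auto
  also have "\<dots> = ((1024 * r) ^ (j + 1) * w ^ j) * (H\<^sup>2 * (real j / real N))"
    by (simp only: power_mult_distrib mult_ac)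
  finally show ?thesis using le3 by linarith
qed

text \<open>Counting powers of \<open>r\<close>: \<open>j\<close> from hypercontractivity, one from
  Rosenthal, and \<open>2 * \<gamma>\<^sub>2 * real j\<close> from moments of order up to
  \<open>2 * r\<close>; their sum is the denominator of the exponent. The \<open>m\<close> of the
  binomial bound cancels against C/m, and its division by \<open>j\<close> lowers
  \<open>\<gamma>\<^sub>1\<close> to \<open>\<gamma>\<^sub>1 - 1 / 2\<close>.\<close>

lemma poisson_range_smooth:
  fixes r t C K \<gamma>\<^sub>1 \<gamma>\<^sub>2 :: real
  assumes jm: "1 \<le> j" "j \<le> m" "m \<le> N" and r: "0 < r" and t: "0 < t"
    and C: "0 < C" and K: "0 < K" and \<gamma>\<^sub>2: "0 \<le> \<gamma>\<^sub>2"
    and le: "r \<le> (t * sqrt (real N / real j) /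
        (sqrt (6144 * C * exp (2 * \<gamma>\<^sub>2) * 4 powr \<gamma>\<^sub>2) * K * real j powr (\<gamma>\<^sub>1 - 1 / 2)) ^ j)
      powr (2 / (1 + real j * (2 * \<gamma>\<^sub>2 + 1)))"
  shows "real (m choose j) * (8 * r) ^ j * (32 * r * ((real j)\<^sup>2 / real N) * exp (2 * (\<gamma>\<^sub>2 * real j)) *
    (((C / real m) powr (real j / 2) * real j powr (\<gamma>\<^sub>1 * real j))\<^sup>2 * (2 * ((2 * r) powr \<gamma>\<^sub>2 * K)) ^ (2 * j))) \<le> t\<^sup>2"
proof -
  define E where "E = exp (2 * \<gamma>\<^sub>2)"
  define F where "F = 4 powr \<gamma>\<^sub>2"
  define \<Gamma> where "\<Gamma> = real j powr (2 * \<gamma>\<^sub>1)"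
  define \<rho> where "\<rho> = r powr (2 * \<gamma>\<^sub>2)"
  define Z where "Z = C * E * F * (\<Gamma> / real j) * K\<^sup>2"
  define R where "R = r * r ^ j * \<rho> ^ j"
  define a where "a = (2 * r) powr \<gamma>\<^sub>2 * K"
  define D where "D = (C / real m) powr (real j / 2) * real j powr (\<gamma>\<^sub>1 * real j)"
  define B where "B = sqrt (6144 * C * E * F) * K * real j powr (\<gamma>\<^sub>1 - 1 / 2)"
  define y where "y = t * sqrt (real N / real j) / B ^ j"
  define e where "e = 1 + real j * (2 * \<gamma>\<^sub>2 + 1)"
  have pos: "0 < real m" "0 < real N" "0 < real j" using jm by auto
  have pos': "0 < E" "0 < F" "0 < \<Gamma>" "0 < \<rho>" using pos r by (auto simp: E_def F_def \<Gamma>_def \<rho>_def)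
  have Z: "0 < Z" using pos pos' C K by (simp add: Z_def)
  have R: "0 < R" using r pos' by (simp add: R_def)
  have B: "0 < B" using pos pos' C K by (simp add: B_def)
  have y: "0 < y" using t pos B by (simp add: y_def)
  have e: "0 < e" using \<gamma>\<^sub>2 by (auto simp: e_def intro!: add_pos_nonneg)
  have B2: "B\<^sup>2 = 6144 * Z"
  proof -
    have "(real j powr (\<gamma>\<^sub>1 - 1 / 2))\<^sup>2 = \<Gamma> / real j"
      using pos by (simp add: \<Gamma>_def powr_power powr_diff power2_eq_square powr_add[symmetric])
    then show ?thesis
      using C pos' by (simp add: B_def Z_def power_mult_distrib)
  qed
  have "r powr (1 / (2 / e)) \<le> y"
    using le r y e by (intro le_powr_imp) (auto simp: y_def B_def E_def F_def e_def)
  then have "(r powr (e / 2))\<^sup>2 \<le> y\<^sup>2" by (intro power_mono) auto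
  moreover have "(r powr (e / 2))\<^sup>2 = R"
  proof -
    have "(r powr (e / 2))\<^sup>2 = r powr e" using r by (simp add: powr_power)
    moreover have "e = 1 + real j + (2 * \<gamma>\<^sub>2) * real j" by (simp add: e_def algebra_simps)
    moreover have "r powr (1 + real j + (2 * \<gamma>\<^sub>2) * real j) = r * r ^ j * \<rho> ^ j"
      using r by (simp add: powr_add powr_powr[symmetric] powr_realpow \<rho>_def)
    ultimately show ?thesis by (simp only: R_def)
  qed
  moreover have "y\<^sup>2 = t\<^sup>2 * (real N / real j) / (6144 * Z) ^ j"
  proof -
    have "(B ^ j)\<^sup>2 = (B\<^sup>2) ^ j" by (simp only: power_mult[symmetric] mult.commute)
    then have "(B ^ j)\<^sup>2 = (6144 * Z) ^ j" by (simp only: B2)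
    then show ?thesis by (simp add: y_def power_mult_distrib power_divide)
  qed
  ultimately have le2: "(6144 * Z) ^ j * R * (real j / real N) \<le> t\<^sup>2"
    using Z pos by (simp add: field_simps)
  have D2: "D\<^sup>2 = (C / real m) ^ j * \<Gamma> ^ j"
  proof -
    have "((C / real m) powr (real j / 2))\<^sup>2 = (C / real m) ^ j"
      using C pos by (simp add: powr_power powr_realpow)
    moreover have "(real j powr (\<gamma>\<^sub>1 * real j))\<^sup>2 = \<Gamma> ^ j"
      using pos by (simp add: \<Gamma>_def powr_power mult_ac)
    ultimately show ?thesis by (simp add: D_def power_mult_distrib)
  qed
  have a2: "(2 * a) ^ (2 * j) = (4 * F * \<rho> * K\<^sup>2) ^ j"
  proof -
    have "((2 * r) powr \<gamma>\<^sub>2)\<^sup>2 = F * \<rho>"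
    proof -
      have "((2 * r) powr \<gamma>\<^sub>2)\<^sup>2 = 2 powr (2 * \<gamma>\<^sub>2) * r powr (2 * \<gamma>\<^sub>2)"
        using r by (simp add: powr_power powr_mult power_mult_distrib)
      also have "(2::real) powr (2 * \<gamma>\<^sub>2) = (2 powr 2) powr \<gamma>\<^sub>2" by (simp only: powr_powr)
      also have "\<dots> = F" by (simp add: F_def)
      finally show ?thesis by (simp only: \<rho>_def)
    qed
    then have "(2 * a)\<^sup>2 = 4 * F * \<rho> * K\<^sup>2" by (simp add: a_def power_mult_distrib)
    then show ?thesis by (simp only: power_mult)
  qed
  have E2: "exp (2 * (\<gamma>\<^sub>2 * real j)) = E ^ j"
    by (simp add: E_def exp_of_nat_mult[symmetric] mult_ac)
  \<comment> \<open>6144 = 96 * 32 * 2, where 96 = 3 * 8 * 4 as in the bounded case with the 4 now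
    coming from the square of \<open>2 * a\<close>, and 2 from \<open>real j \<le> 2 ^ j\<close>.
    All of it goes under the power \<open>j\<close>.\<close>
  have num: "96 ^ j * 32 * real j \<le> 6144 ^ j"
  proof -
    have "real j \<le> 2 ^ j" using of_nat_mono[OF less_imp_le[OF less_exp[of j]], where 'a=real] by simp
    then have "96 ^ j * 32 * real j \<le> 96 ^ j * 32 ^ j * 2 ^ j"
      using jm(1) self_le_power[of "32::real" j] by (intro mult_mono) auto
    also have "\<dots> = 6144 ^ j" by (simp add: power_mult_distrib[symmetric])
    finally show ?thesis .
  qed
  have "real (m choose j) * (8 * r) ^ j * (32 * r * ((real j)\<^sup>2 / real N) * E ^ j * (D\<^sup>2 * (2 * a) ^ (2 * j)))
      \<le> (3 * real m / real j) ^ j * (8 * r) ^ j * (32 * r * ((real j)\<^sup>2 / real N) * E ^ j * (D\<^sup>2 * (2 * a) ^ (2 * j)))"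
    using r pos' binomial_le_power[OF jm(1), of m] unfolding a2
    by (intro mult_right_mono) (auto simp: K less_imp_le)
  also have "\<dots> = ((3 * real m / real j) * 8 * E * (C / real m) * \<Gamma> * (4 * F * K\<^sup>2)) ^ j *
      (32 * real j * (R * (real j / real N)))"
  proof -
    have "A ^ j * (8 * r) ^ j * (32 * r * ((real j)\<^sup>2 / real N) * E ^ j * (c ^ j * \<Gamma> ^ j * (4 * F * \<rho> * K\<^sup>2) ^ j)) =
        (A * 8 * E * c * \<Gamma> * (4 * F * K\<^sup>2)) ^ j * (32 * real j * (r * r ^ j * \<rho> ^ j * (real j / real N)))"
      for A c :: real
      by (simp only: power_mult_distrib power2_eq_square mult_ac times_divide_eq_left times_divide_eq_right)
    then show ?thesis unfolding D2 a2 R_def .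
  qed
  also have "(3 * real m / real j) * 8 * E * (C / real m) * \<Gamma> * (4 * F * K\<^sup>2) = 96 * Z"
    using pos by (simp add: Z_def field_simps)
  also have "(96 * Z) ^ j * (32 * real j * (R * (real j / real N)))
      = (96 ^ j * 32 * real j) * (Z ^ j * R * (real j / real N))"
    by (simp only: power_mult_distrib mult_ac)
  also have "\<dots> \<le> 6144 ^ j * (Z ^ j * R * (real j / real N))"
    using num Z R by (intro mult_right_mono) auto
  also have "\<dots> = (6144 * Z) ^ j * R * (real j / real N)"
    by (simp only: power_mult_distrib mult_ac)
  finally show ?thesis
    using le2 unfolding E2 D_def a_def by linarith
qed

text \<open>For \<open>K < c\<close>, Markov's inequality of order \<open>k\<close> bounds the
  probability of exceeding \<open>c\<close> by \<open>(K / c) ^ k\<close>, which tends to 0;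
  countably many \<open>c\<close> decreasing to \<open>K\<close> suffice.\<close>

lemma (in prob_space) AE_le_of_moments_le:
  fixes f :: "'a \<Rightarrow> real"
  assumes int: "\<And>k. 2 \<le> k \<Longrightarrow> integrable M (\<lambda>x. \<bar>f x\<bar> ^ k)"
    and le: "\<And>k. 2 \<le> k \<Longrightarrow> (\<integral>x. \<bar>f x\<bar> ^ k \<partial>M) \<le> K ^ k" and K: "0 < K"
    and [measurable]: "f \<in> borel_measurable M"
  shows "AE x in M. \<bar>f x\<bar> \<le> K"
proof -
  have "AE x in M. \<bar>f x\<bar> < c" if c: "K < c" for c
  proof -
    have c0: "0 < c" using c K by simp
    have "prob {x\<in>space M. c \<le> \<bar>f x\<bar>} \<le> (K / c) ^ k" if "2 \<le> k" for k
    proof -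
      have "prob {x\<in>space M. c \<le> \<bar>f x\<bar>} \<le> prob {x\<in>space M. c ^ k \<le> \<bar>f x\<bar> ^ k}"
        using c0 by (intro finite_measure_mono) (auto intro!: power_mono)
      also have "\<dots> \<le> (\<integral>x. \<bar>f x\<bar> ^ k \<partial>M) / c ^ k"
        using c0 by (intro integral_Markov_inequality_measure[OF int[OF that], where A="{}"]) auto
      also have "\<dots> \<le> (K / c) ^ k"
        using le[OF that] c0 by (simp add: power_divide divide_right_mono)
      finally show ?thesis .
    qed
    moreover have "(\<lambda>k. (K / c) ^ k) \<longlonglongrightarrow> 0"
      using c K by (intro LIMSEQ_realpow_zero) auto
    ultimately have "prob {x\<in>space M. c \<le> \<bar>f x\<bar>} \<le> 0"
      by (intro LIMSEQ_le_const[of "\<lambda>k. (K / c) ^ k"]) auto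
    then have "prob {x\<in>space M. c \<le> \<bar>f x\<bar>} = 0" by (simp add: measure_le_0_iff)
    then have "AE x in M. x \<notin> {x\<in>space M. c \<le> \<bar>f x\<bar>}"
      by (intro AE_not_in) (auto simp: null_sets_def emeasure_eq_measure)
    then show ?thesis using AE_space by eventually_elim auto
  qed
  then have "AE x in M. \<forall>n. \<bar>f x\<bar> < K + inverse (real (Suc n))"
    by (subst AE_all_countable) simp
  then show ?thesis
  proof eventually_elim
    case (elim x)
    show ?case
    proof (rule ccontr)
      assume "\<not> \<bar>f x\<bar> \<le> K"
      then obtain n where "inverse (real (Suc n)) < \<bar>f x\<bar> - K"
        using reals_Archimedean[of "\<bar>f x\<bar> - K"] by auto
      moreover have "\<bar>f x\<bar> < K + inverse (real (Suc n))" using elim by blast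
      ultimately show False by linarith
    qed
  qed
qed

section \<open>The concentration inequality\<close>

context ustatistic
begin

lemma
  fixes f :: "real \<Rightarrow> real"
  assumes "f \<in> borel_measurable borel"
  shows integrable_Q: "integrable Q f \<longleftrightarrow> integrable M (\<lambda>\<omega>. f (X 1 \<omega>))"
    and integral_Q: "(\<integral>x. f x \<partial>Q) = (\<integral>\<omega>. f (X 1 \<omega>) \<partial>M)"
  unfolding Q_def by (rule integrable_distr_eq[OF X1_meas assms] integral_distr[OF X1_meas assms])+

lemma tail_bounded_kernel:
  assumes bounded: "bounded_kernel m h" and t: "0 < t" and r: "2 \<le> r"
    and gauss: "r \<le> 1 / 1024 * (t\<^sup>2 / prob_space.variance M (kernel_rv X m h)) powr (1 / real j)"
    and poisson: "r \<le> (t / kernel_norm M X m h * sqrt (real N / real j)) powr (2 / (real j + 1)) /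
      (1024 * (real m / real j) powr (real j / (real j + 1)))"
  shows "measure M {\<omega>\<in>space M. t \<le> \<bar>V_stat M X m h N j \<omega>\<bar>} \<le> exp (- r)"
  unfolding V_stat_tail
proof (rule V_tail_bounded[OF AE_G_le[OF AE_kernel_le_norm(1)[OF bounded]] _ r t])
  show "0 \<le> 2 ^ j * kernel_norm M X m h" using AE_kernel_le_norm(2)[OF bounded] by simp
  show "(1024 * r) ^ j * (\<integral>x. (kernel_rv (\<lambda>i x. x i) m h x)\<^sup>2 \<partial>\<Omega>) \<le> t\<^sup>2"
    using gauss r jm by (intro gaussian_range) (auto simp: variance_eq)
  show "real (m choose j) * (8 * r) ^ j *
      (32 * r * ((real j)\<^sup>2 / real N * (2 ^ j * kernel_norm M X m h)\<^sup>2)) \<le> t\<^sup>2"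
    using poisson r t jm AE_kernel_le_norm(2)[OF bounded] by (intro poisson_range_bounded) auto
qed

text \<open>For \<open>\<gamma>\<^sub>2 = 0\<close> the norms of all orders are at most
  \<open>K\<close>, hence the sample is bounded and the route for bounded projections applies. For
  positive \<open>\<gamma>\<^sub>2\<close> the moment route is taken with
  \<open>\<rho> = \<gamma>\<^sub>2 * real j\<close>.\<close>

lemma tail_smooth_kernel:
  assumes smooth: "smoothness_condition M X m h j C \<gamma>\<^sub>1" and moment: "moment_condition M (X 1) \<gamma>\<^sub>2 K"
    and C: "0 < C" and \<gamma>\<^sub>2: "0 \<le> \<gamma>\<^sub>2" and K: "0 < K" and t: "0 < t" and r: "2 \<le> r"
    and large: "0 < \<gamma>\<^sub>2 \<Longrightarrow> ln (real N / real j) / (\<gamma>\<^sub>2 * real j) \<le> r"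
    and gauss: "r \<le> 1 / 1024 * (t\<^sup>2 / prob_space.variance M (kernel_rv X m h)) powr (1 / real j)"
    and poisson: "r \<le> (t * sqrt (real N / real j) /
        (sqrt (6144 * C * exp (2 * \<gamma>\<^sub>2) * 4 powr \<gamma>\<^sub>2) * K * real j powr (\<gamma>\<^sub>1 - 1 / 2)) ^ j)
      powr (2 / (1 + real j * (2 * \<gamma>\<^sub>2 + 1)))"
  shows "measure M {\<omega>\<in>space M. t \<le> \<bar>V_stat M X m h N j \<omega>\<bar>} \<le> exp (- r)"
proof -
  define D where "D = (C / real m) powr (real j / 2) * real j powr (\<gamma>\<^sub>1 * real j)"
  define a where "a = (2 * r) powr \<gamma>\<^sub>2 * K"
  let ?\<phi> = "kernel_rv (\<lambda>i x. x i) m h"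
  have int1: "integrable M (X 1)" using moment by (simp add: moment_condition_def)
  interpret R: real_hoeffding_kernel N m j ?\<phi> Q D
    unfolding D_def by (rule smooth_kernel[OF smooth int1])
  have D: "0 \<le> D" by (rule R.D)
  have \<mu>: "R.\<mu> = (\<integral>\<omega>. X 1 \<omega> \<partial>M)"
    unfolding R.\<mu>_def by (rule integral_Q) simp
  have moments:
    "integrable Q (\<lambda>x. \<bar>x - R.\<mu>\<bar> ^ k)" "(\<integral>x. \<bar>x - R.\<mu>\<bar> ^ k \<partial>Q) \<le> (real k powr \<gamma>\<^sub>2 * K) ^ k"
    if k: "2 \<le> k" for k
  proof -
    define I where "I = (\<integral>\<omega>. \<bar>X 1 \<omega> - R.\<mu>\<bar> ^ k \<partial>M)"
    have meas: "(\<lambda>x. \<bar>x - R.\<mu>\<bar> ^ k) \<in> borel_measurable borel" by measurable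
    have cond: "integrable M (\<lambda>\<omega>. \<bar>X 1 \<omega> - R.\<mu>\<bar> ^ k)" "I powr (1 / real k) \<le> real k powr \<gamma>\<^sub>2 * K"
      using moment k by (auto simp: moment_condition_def central_moment_root_def \<mu> I_def)
    show "integrable Q (\<lambda>x. \<bar>x - R.\<mu>\<bar> ^ k)"
      using cond(1) by (simp only: integrable_Q[OF meas])
    have "(\<integral>x. \<bar>x - R.\<mu>\<bar> ^ k \<partial>Q) = I"
      unfolding I_def by (rule integral_Q[OF meas])
    also have "I = (I powr (1 / real k)) ^ k"
    proof (cases "I = 0")
      case False
      moreover have "0 \<le> I" by (simp add: I_def)
      ultimately have "0 < I" by simp
      then show ?thesis using k by (simp add: powr_power)
    qed (use k in \<open>simp add: power_0_left\<close>)
    also have "\<dots> \<le> (real k powr \<gamma>\<^sub>2 * K) ^ k" using cond(2) by (intro power_mono) auto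
    finally show "(\<integral>x. \<bar>x - R.\<mu>\<bar> ^ k \<partial>Q) \<le> (real k powr \<gamma>\<^sub>2 * K) ^ k" .
  qed
  have Q_moments: "integrable Q (\<lambda>x. \<bar>x - R.\<mu>\<bar> ^ n)" for n
  proof -
    \<comment> \<open>The moment condition starts at order 2; order 1 comes from the integrability
      of the sample.\<close>
    consider "n = 0" | "n = 1" | "2 \<le> n" by linarith
    then show ?thesis
    proof cases
      case 2 then show ?thesis using R.Q_int by simp
    qed (use moments(1) in auto)
  qed
  have gauss': "(1024 * r) ^ j * (\<integral>x. (?\<phi> x)\<^sup>2 \<partial>\<Omega>) \<le> t\<^sup>2"
    using gauss r jm by (intro gaussian_range) (auto simp: variance_eq)
  have poisson': "real (m choose j) * (8 * r) ^ j *
      (32 * r * ((real j)\<^sup>2 / real N) * exp (2 * (\<gamma>\<^sub>2 * real j)) * (D\<^sup>2 * (2 * a) ^ (2 * j))) \<le> t\<^sup>2"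
    unfolding D_def a_def using r jm by (intro poisson_range_smooth[OF jm _ t C K \<gamma>\<^sub>2 poisson]) auto
  show ?thesis
    unfolding V_stat_tail
  proof (cases "\<gamma>\<^sub>2 = 0")
    case True
    have "AE x in Q. \<bar>x - R.\<mu>\<bar> \<le> K"
      using moments True K by (intro PQ.M.AE_le_of_moments_le) auto
    then have G: "AE x in \<Omega>. \<bar>G x\<bar> \<le> D * (2 * K) ^ j" using K by (intro R.AE_G_le_bounded) auto
    have "a = K" using True r by (simp add: a_def)
    show "measure \<Omega> {x\<in>space \<Omega>. t \<le> \<bar>V x\<bar>} \<le> exp (- r)"
    proof (rule V_tail_bounded[OF G _ r t gauss'])
      show "0 \<le> D * (2 * K) ^ j" using D K by simp
      have "(D * (2 * K) ^ j)\<^sup>2 = D\<^sup>2 * (2 * a) ^ (2 * j)"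
        by (simp only: \<open>a = K\<close> power_mult_distrib[of D] power_mult[symmetric] mult.commute[of j])
      then show "real (m choose j) * (8 * r) ^ j * (32 * r * ((real j)\<^sup>2 / real N * (D * (2 * K) ^ j)\<^sup>2)) \<le> t\<^sup>2"
        using poisson' True by (simp add: mult.assoc)
    qed
  next
    case False
    then have \<gamma>: "0 < \<gamma>\<^sub>2" using \<gamma>\<^sub>2 by simp
    have a: "0 < a" using r K by (simp add: a_def)
    have nonneg: "0 \<le> real (m choose j) * (8 * r) ^ j *
        (16 * (r * ((real j)\<^sup>2 / real N) * exp (2 * (\<gamma>\<^sub>2 * real j)) * (D\<^sup>2 * (2 * a) ^ (2 * j))))"
      using r by simp
    show "measure \<Omega> {x\<in>space \<Omega>. t \<le> \<bar>V x\<bar>} \<le> exp (- r)"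
    proof (rule V_tail_moments[OF R.all_moments_G[OF Q_moments] r t _ _ _ _ gauss'])
      fix p :: nat assume p: "1 \<le> p" "real p \<le> r"
      have "(\<integral>x. \<bar>x - R.\<mu>\<bar> ^ (2 * p) \<partial>Q) \<le> (real (2 * p) powr \<gamma>\<^sub>2 * K) ^ (2 * p)"
        using p by (intro moments(2)) auto
      also have "\<dots> \<le> a ^ (2 * p)"
        unfolding a_def using p \<gamma> K by (intro power_mono mult_right_mono powr_mono2) auto
      finally show "(\<integral>x. ((G x)\<^sup>2) ^ p \<partial>\<Omega>) \<le> (D\<^sup>2 * (2 * a) ^ (2 * j)) ^ p"
        by (rule R.G_moment_le[OF Q_moments p(1) a])
    next
      show "0 \<le> D\<^sup>2 * (2 * a) ^ (2 * j)" by simp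
      show "0 \<le> \<gamma>\<^sub>2 * real j" using \<gamma> by simp
      have pos: "0 < real N / real j" "0 < real j" using jm by auto
      have "ln (real N / real j) \<le> \<gamma>\<^sub>2 * real j * r"
        using large[OF \<gamma>] \<gamma> pos by (simp add: divide_le_eq mult_ac)
      then show "real N / real j \<le> exp (\<gamma>\<^sub>2 * real j * r)"
        using pos by (metis exp_le_cancel_iff exp_ln)
      show "real (m choose j) * (8 * r) ^ j *
          (16 * (r * ((real j)\<^sup>2 / real N) * exp (2 * (\<gamma>\<^sub>2 * real j)) * (D\<^sup>2 * (2 * a) ^ (2 * j)))) \<le> t\<^sup>2"
      proof -
        \<comment> \<open>\<open>poisson'\<close> carries the constant 32 of the bounded route so as
          to serve both cases; the moment route asks for 16 only.\<close>
        have two: "x * (32 * r * y * z * w) = 2 * (x * (16 * (r * y * z * w)))" for x y z w :: real by simp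
        have "x \<le> y" if "2 * x \<le> y" "0 \<le> x" for x y :: real using that by simp
        from this[OF poisson'[unfolded two] nonneg] show ?thesis .
      qed
    qed
  qed
qed

end

theorem theorem4p1:
  shows
    "(\<exists>c::real. c > 0 \<and>
       (\<forall>(M :: (nat \<Rightarrow> real) measure) (X :: nat \<Rightarrow> (nat \<Rightarrow> real) \<Rightarrow> real)
          (N::nat) (m::nat) (j::nat) (h :: (nat \<Rightarrow> real) \<Rightarrow> real) (t::real).
          iid_sample M X N \<longrightarrow> 2 \<le> j \<longrightarrow> j \<le> m \<longrightarrow> m \<le> N \<longrightarrow>
          admissible_kernel M X m h \<longrightarrow> bounded_kernel m h \<longrightarrow> t > 0 \<longrightarrow>
          (let r = min
                 (1 / c * (t\<^sup>2 / prob_space.variance M (kernel_rv X m h)) powr (1 / real j))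
                 ((t / kernel_norm M X m h * sqrt (real N / real j)) powr (2 / (real j + 1)) /
                  (c * (real m / real j) powr (real j / (real j + 1))))
           in 2 \<le> r \<longrightarrow>
              measure M {\<omega>\<in>space M. \<bar>V_stat M X m h N j \<omega>\<bar> \<ge> t} \<le> exp (- r))))
     \<and>
     (\<forall>(C\<^sub>1::real) (\<gamma>\<^sub>1::real) (\<gamma>\<^sub>2::real). C\<^sub>1 > 0 \<longrightarrow> \<gamma>\<^sub>1 \<ge> 1 / 2 \<longrightarrow> \<gamma>\<^sub>2 \<ge> 0 \<longrightarrow>
       (\<exists>(c\<^sub>1::real) (c\<^sub>2::real). c\<^sub>1 > 0 \<and> c\<^sub>2 > 0 \<and>
         (\<forall>(M :: (nat \<Rightarrow> real) measure) (X :: nat \<Rightarrow> (nat \<Rightarrow> real) \<Rightarrow> real)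
            (N::nat) (m::nat) (j::nat) (h :: (nat \<Rightarrow> real) \<Rightarrow> real) (K::real) (t::real).
            iid_sample M X N \<longrightarrow> 2 \<le> j \<longrightarrow> j \<le> m \<longrightarrow> m \<le> N \<longrightarrow>
            admissible_kernel M X m h \<longrightarrow>
            smoothness_condition M X m h j C\<^sub>1 \<gamma>\<^sub>1 \<longrightarrow>
            K > 0 \<longrightarrow> moment_condition M (X 1) \<gamma>\<^sub>2 K \<longrightarrow> t > 0 \<longrightarrow>
            (let r = min
                   (1 / c\<^sub>1 * (t\<^sup>2 / prob_space.variance M (kernel_rv X m h)) powr (1 / real j))
                   ((t * sqrt (real N / real j) /
                       (c\<^sub>2 * K * real j powr (\<gamma>\<^sub>1 - 1 / 2)) ^ j)
                     powr (2 / (1 + real j * (2 * \<gamma>\<^sub>2 + 1))))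
             in (\<gamma>\<^sub>2 > 0 \<longrightarrow> max 2 (ln (real N / real j) / (\<gamma>\<^sub>2 * real j)) \<le> r \<longrightarrow>
                   measure M {\<omega>\<in>space M. \<bar>V_stat M X m h N j \<omega>\<bar> \<ge> t} \<le> exp (- r)) \<and>
                (\<gamma>\<^sub>2 = 0 \<longrightarrow> 2 \<le> r \<longrightarrow>
                   measure M {\<omega>\<in>space M. \<bar>V_stat M X m h N j \<omega>\<bar> \<ge> t} \<le> exp (- r))))))"
proof (rule conjI, goal_cases)
  case 1
  show ?case
    unfolding Let_def
    by (rule exI[of _ 1024]) (auto intro!: ustatistic.tail_bounded_kernel ustatistic.intro)
next
  case 2
  show ?case
  proof (intro allI impI, goal_cases)
    case (1 C \<gamma>\<^sub>1 \<gamma>\<^sub>2)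
    \<comment> \<open>The constant of the Gaussian term is the absolute 1024. In the other one,
      \<open>exp (2 * \<gamma>\<^sub>2)\<close> pays for the missing power of j^2/N,
      \<open>4 powr \<gamma>\<^sub>2\<close> for moments of order up to \<open>2 * r\<close>, and
      \<open>C\<close> for the derivative bound; the root appears because the tail compares
      squares.\<close>
    show ?case
      unfolding Let_def
    proof (rule exI[of _ 1024], rule exI[of _ "sqrt (6144 * C * exp (2 * \<gamma>\<^sub>2) * 4 powr \<gamma>\<^sub>2)"],
        intro conjI allI impI, goal_cases)
      case 1 show ?case by simp
    next
      case 2 show ?case using 1 by simp
    next
      case (3 M X N m j h K t)
      show ?case
        by (rule ustatistic.tail_smooth_kernel[where C=C and K=K and \<gamma>\<^sub>1=\<gamma>\<^sub>1 and \<gamma>\<^sub>2=\<gamma>\<^sub>2])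
          (use 1 3 in \<open>simp_all only: ustatistic.intro max.bounded_iff min.bounded_iff
              min.cobounded1 min.cobounded2 order_refl less_irrefl\<close>)
    next
      case (4 M X N m j h K t)
      show ?case
        by (rule ustatistic.tail_smooth_kernel[where C=C and K=K and \<gamma>\<^sub>1=\<gamma>\<^sub>1 and \<gamma>\<^sub>2=\<gamma>\<^sub>2])
          (use 1 4 in \<open>simp_all only: ustatistic.intro max.bounded_iff min.bounded_iff
              min.cobounded1 min.cobounded2 order_refl less_irrefl\<close>)
    qed
  qed
qed

end
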